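(* Let $K\subset\mathbb{R}^n$ be a convex compact polytope. Then for every $s>1$ there is a constant $C=C(K,s)<\infty$ such that for all $f\in L^2(\mathbb{R}^n)$ and all continuous weights $w\ge 0$ on $\mathbb{R}^n$, $$\int_{\mathbb{R}^n}|S_Kf(x)|^2\,w(x)\,dx\le C\int_{\mathbb{R}^n}|f(x)|^2\,\bigl(\mathcal{M}(w^s)(x)\bigr)^{1/s}\,dx .$$
   Context: $\widehat f$ denotes the Fourier transform on $\mathbb{R}^n$. $S_K$ is the Fourier multiplier operator with symbol $1_K$: $\widehat{S_Kf}=1_K\cdot\widehat f$. For $w\ge 0$ on $\mathbb{R}^n$, the Nikodym-type maximal function is the supremum of averages over all centered line segments: $$\mathcal{M}w(x)=\sup_{r>0,\ \omega\in\mathbb{R}^n,\ |\omega|=1}\frac1{2r}\int_{-r}^{r}w(x-t\omega)\,dt .$$ *)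

theory Defs
  imports "HOL-Analysis.Analysis"
begin

text \<open>
  Elements of \<open>L\<^sup>2\<close> are represented by functions; all statements about them are insensitive to
  changes on null sets.
\<close>

definition L2_functions :: "(real ^ 'n \<Rightarrow> complex) set" where
  "L2_functions = {f \<in> borel_measurable lebesgue. (\<integral>\<^sup>+x. ennreal ((cmod (f x))\<^sup>2) \<partial>lebesgue) < \<infinity>}"

definition fourier_integral :: "(real ^ 'n \<Rightarrow> complex) \<Rightarrow> real ^ 'n \<Rightarrow> complex" where
  "fourier_integral f \<xi> = (LINT x|lebesgue. cis (- (2 * pi * (x \<bullet> \<xi>))) * f x)"

text \<open>
  The Fourier transform on \<open>L\<^sup>2\<close> is the \<open>L\<^sup>2\<close>-limit of the Fourier integrals of the truncations of
  \<open>f\<close> to balls, which lie in \<open>L\<^sup>1 \<inter> L\<^sup>2\<close>. By Plancherel's theorem the limit exists for every \<open>f\<close> in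
  \<open>L\<^sup>2\<close>; it is unique only almost everywhere, so a representative is chosen.
\<close>

definition fourier_L2 :: "(real ^ 'n \<Rightarrow> complex) \<Rightarrow> real ^ 'n \<Rightarrow> complex" where
  "fourier_L2 f = (SOME g. g \<in> L2_functions \<and>
     (\<lambda>k::nat. \<integral>\<^sup>+\<xi>. ennreal ((cmod (fourier_integral (\<lambda>x. indicator (cball 0 (real k)) x * f x) \<xi> - g \<xi>))\<^sup>2)
        \<partial>lebesgue) \<longlonglongrightarrow> 0)"

definition fourier_multiplier ::
    "(real ^ 'n \<Rightarrow> complex) \<Rightarrow> (real ^ 'n \<Rightarrow> complex) \<Rightarrow> real ^ 'n \<Rightarrow> complex" where
  "fourier_multiplier m f = (SOME h. h \<in> L2_functions \<and>
     (AE \<xi> in lebesgue. fourier_L2 h \<xi> = m \<xi> * fourier_L2 f \<xi>))"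

definition set_multiplier ::
    "(real ^ 'n) set \<Rightarrow> (real ^ 'n \<Rightarrow> complex) \<Rightarrow> real ^ 'n \<Rightarrow> complex" where
  "set_multiplier K = fourier_multiplier (indicator K)"

text \<open>
  The maximal function may be infinite even for a continuous weight, so it takes values in
  \<^typ>\<open>ennreal\<close>.
\<close>

definition nikodym_maximal :: "(real ^ 'n \<Rightarrow> real) \<Rightarrow> real ^ 'n \<Rightarrow> ennreal" where
  "nikodym_maximal w x = (SUP (r, \<omega>) \<in> {0<..} \<times> sphere 0 1.
     ennreal (1 / (2 * r)) * (\<integral>\<^sup>+t\<in>{-r..r}. ennreal (w (x - t *\<^sub>R \<omega>)) \<partial>lborel))"

text \<open>Only meant for exponents \<open>p > 0\<close>.\<close>

definition ennreal_powr :: "ennreal \<Rightarrow> real \<Rightarrow> ennreal" where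
  "ennreal_powr a p = (if a = \<infinity> then \<infinity> else ennreal (enn2real a powr p))"

end

theory Submission
  imports Defs "HOL-Probability.Probability"
begin

text \<open>
  By Plancherel's theorem \<open>S\<^sub>K\<close> is a composition of half-space multipliers, one for each facet, and each of
  these is an affine function of a sign multiplier in the direction of the facet normal. A sign multiplier is
  a superposition over all scales of products of two convolutions along the normal, so pairing it with
  \<open>u = w h\<close> leaves two square functions. Put \<open>v = w\<^sup>s\<close>. The square function of \<open>u\<close> is bounded with the weights
  \<open>(A\<^sub>k v)\<^sup>-\<^sup>1\<^sup>/\<^sup>s\<close>, where \<open>A\<^sub>k\<close> is the Gaussian average at scale \<open>2\<^sup>k\<^sup>/\<^sup>2\<close> along the normal: the gap in Jensen's inequality
  for the convex function \<open>|p|\<^sup>2 / z\<^sup>1\<^sup>/\<^sup>s\<close> controls the oscillation of \<open>A\<^sub>k u\<close>, and these gaps telescope to at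
  most \<open>\<integral> |u|\<^sup>2 / v\<^sup>1\<^sup>/\<^sup>s = \<integral> |h|\<^sup>2 w\<close>. The other square function has compactly supported kernels, so a layer-cake
  argument bounds it with the weights \<open>(A\<^sub>k v)\<^sup>1\<^sup>/\<^sup>s\<close> by the supremum of these weights over \<open>k\<close>. Iterating over the
  facets produces iterated Gaussian averages of \<open>w\<^sup>s\<close>. Averaging these over a common dilation factor in
  \<open>[1, 2]\<close>, with the Gaussian variables frozen, dominates them by averages over centered segments.
\<close>

section \<open>Square-integrable functions\<close>

text \<open>The two square functions make opposite demands on their kernels: telescoping the Jensen
  gaps needs a semigroup, hence Gaussians, while cutting \<open>f\<close> down to a level set of the
  weight needs bounded support, hence Haar kernels. The product of all symbols must be odd to
  reproduce a sign, so two Haar factors go to one side and one Haar factor with a Gaussian to the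
  other. The condition s > 1 enters through the exponent 1/s < 1: the quantitative Jensen gap
  degenerates as 1/s tends to 1. Scales are indexed by a real r through \<open>half_pow r\<close>,
  so dilations become translations of Lebesgue measure and r + 1 is exactly the scale of a repeated
  Gaussian average; weights are sampled only at integer indices, so that suprema of iterated
  averages are countable. The bound for the integral of |h|^2 w has half of that integral on its
  right side; subtracting it requires finiteness, so weights are kept between positive constants
  until the induction is over. In the induction the multiplier of the remaining half-spaces commutes
  with the Haar convolutions, so the hypothesis can be used at every scale with its own
  weight.\<close>

definition L2_borel :: "('a::euclidean_space \<Rightarrow> complex) set" where
  "L2_borel = {f \<in> borel_measurable borel. integrable lborel (\<lambda>x. (cmod (f x))\<^sup>2)}"

definition L2_norm :: "('a::euclidean_space \<Rightarrow> complex) \<Rightarrow> real" where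
  "L2_norm f = sqrt (LINT x|lborel. (cmod (f x))\<^sup>2)"

lemma L2_borel_measurable [measurable_dest]: "f \<in> L2_borel \<Longrightarrow> f \<in> borel_measurable borel"
  and L2_borel_integrable: "f \<in> L2_borel \<Longrightarrow> integrable lborel (\<lambda>x. (cmod (f x))\<^sup>2)"
  by (simp_all add: L2_borel_def)

lemma L2_borelI_bound:
  assumes [measurable]: "f \<in> borel_measurable borel"
    and "integrable lborel g" "\<And>x. (cmod (f x))\<^sup>2 \<le> g x"
  shows "f \<in> L2_borel"
  unfolding L2_borel_def
  by (auto intro!: Bochner_Integration.integrable_bound[OF assms(2)] AE_I2 order_trans[OF assms(3)])

lemma L2_borelI_nn:
  assumes [measurable]: "f \<in> borel_measurable borel"
    and "(\<integral>\<^sup>+x. ennreal ((cmod (f x))\<^sup>2) \<partial>lborel) < \<infinity>"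
  shows "f \<in> L2_borel"
  using assms by (auto simp: L2_borel_def integrable_iff_bounded)

lemma nn_integral_L2:
  assumes "f \<in> L2_borel"
  shows "(\<integral>\<^sup>+x. ennreal ((cmod (f x))\<^sup>2) \<partial>lborel) = ennreal ((L2_norm f)\<^sup>2)"
  using L2_borel_integrable[OF assms] by (simp add: L2_norm_def nn_integral_eq_integral)

lemma L2_norm_nonneg [simp]: "0 \<le> L2_norm f"
  by (simp add: L2_norm_def)

lemma L2_norm_le_iff_nn:
  assumes "f \<in> borel_measurable borel" "0 \<le> B"
    and "(\<integral>\<^sup>+x. ennreal ((cmod (f x))\<^sup>2) \<partial>lborel) \<le> ennreal (B\<^sup>2)"
  shows "f \<in> L2_borel" "L2_norm f \<le> B"
proof -
  show f: "f \<in> L2_borel"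
    using assms by (intro L2_borelI_nn) (auto simp: top.not_eq_extremum order_le_less_trans)
  have "(L2_norm f)\<^sup>2 \<le> B\<^sup>2"
    using assms(3) nn_integral_L2[OF f] by simp
  then show "L2_norm f \<le> B" using assms(2) by (rule power2_le_imp_le)
qed

lemma square_norm_add_le:
  fixes a b :: "'a::real_normed_vector"
  shows "(norm (a + b))\<^sup>2 \<le> 2 * (norm a)\<^sup>2 + 2 * (norm b)\<^sup>2"
proof -
  have "(norm (a + b))\<^sup>2 \<le> (norm a + norm b)\<^sup>2"
    by (intro power_mono norm_triangle_ineq) auto
  also have "\<dots> \<le> 2 * (norm a)\<^sup>2 + 2 * (norm b)\<^sup>2"
    using sum_squares_bound[of "norm a" "norm b"] by (simp add: power2_sum)
  finally show ?thesis .
qed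

lemma L2_borel_add: "f \<in> L2_borel \<Longrightarrow> g \<in> L2_borel \<Longrightarrow> (\<lambda>x. f x + g x) \<in> L2_borel"
  by (rule L2_borelI_bound[where g="\<lambda>x. 2 * (cmod (f x))\<^sup>2 + 2 * (cmod (g x))\<^sup>2"])
     (auto simp: L2_borel_integrable intro: square_norm_add_le)

lemma L2_borel_bounded_mult:
  assumes f: "f \<in> L2_borel" and [measurable]: "m \<in> borel_measurable borel" and b: "\<And>x. cmod (m x) \<le> B"
  shows "(\<lambda>x. m x * f x) \<in> L2_borel"
proof (rule L2_borelI_bound[where g="\<lambda>x. B\<^sup>2 * (cmod (f x))\<^sup>2"])
  show "(cmod (m x * f x))\<^sup>2 \<le> B\<^sup>2 * (cmod (f x))\<^sup>2" for x
    using b[of x] by (auto simp: norm_mult power_mult_distrib intro!: mult_right_mono power_mono)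
qed (use f in \<open>auto intro: L2_borel_integrable\<close>)

lemma L2_norm_bounded_mult:
  assumes f: "f \<in> L2_borel" and [measurable]: "m \<in> borel_measurable borel"
    and b: "\<And>x. cmod (m x) \<le> B" and "0 \<le> B"
  shows "L2_norm (\<lambda>x. m x * f x) \<le> B * L2_norm f"
proof -
  have "(LINT x|lborel. (cmod (m x * f x))\<^sup>2) \<le> (LINT x|lborel. B\<^sup>2 * (cmod (f x))\<^sup>2)"
    using b by (intro integral_mono L2_borel_integrable[OF L2_borel_bounded_mult[OF f _ b]])
      (auto simp: norm_mult power_mult_distrib intro!: mult_right_mono power_mono L2_borel_integrable f)
  then have "L2_norm (\<lambda>x. m x * f x) \<le> sqrt (B\<^sup>2 * (LINT x|lborel. (cmod (f x))\<^sup>2))"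
    unfolding L2_norm_def by simp
  also have "\<dots> = B * L2_norm f" using \<open>0 \<le> B\<close> by (simp add: real_sqrt_mult L2_norm_def)
  finally show ?thesis .
qed

lemma L2_borel_cmult: "f \<in> L2_borel \<Longrightarrow> (\<lambda>x. c * f x) \<in> L2_borel"
  by (rule L2_borel_bounded_mult[where B="cmod c"]) auto

lemma L2_norm_cmult: "L2_norm (\<lambda>x. c * f x) = cmod c * L2_norm f"
  by (simp add: L2_norm_def norm_mult power_mult_distrib real_sqrt_mult)

lemma L2_borel_diff: "f \<in> L2_borel \<Longrightarrow> g \<in> L2_borel \<Longrightarrow> (\<lambda>x. f x - g x) \<in> L2_borel"
  using L2_borel_add[OF _ L2_borel_cmult[of g "-1"]] by simp

lemma borel_measurable_cnj [measurable]: "cnj \<in> borel_measurable borel"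
  by (intro borel_measurable_continuous_onI continuous_intros)

lemma L2_borel_cnj: "f \<in> L2_borel \<Longrightarrow> (\<lambda>x. cnj (f x)) \<in> L2_borel"
  by (auto simp: L2_borel_def)

lemma L2_norm_cnj: "L2_norm (\<lambda>x. cnj (f x)) = L2_norm f"
  by (simp add: L2_norm_def)

lemma L2_norm_commute: "L2_norm (\<lambda>x. f x - g x) = L2_norm (\<lambda>x. g x - f x)"
  by (simp add: L2_norm_def norm_minus_commute)

lemma L2_norm_AE_cong:
  assumes "AE x in lborel. f x = g x" and [measurable]: "f \<in> borel_measurable borel" "g \<in> borel_measurable borel"
  shows "L2_norm f = L2_norm g"
proof -
  have "(LINT x|lborel. (cmod (f x))\<^sup>2) = (LINT x|lborel. (cmod (g x))\<^sup>2)"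
    using assms by (intro integral_cong_AE) auto
  then show ?thesis by (simp add: L2_norm_def)
qed

lemma L2_norm_eq_0:
  assumes "f \<in> L2_borel" "L2_norm f = 0"
  shows "AE x in lborel. f x = 0"
  using integral_nonneg_eq_0_iff_AE[OF L2_borel_integrable[OF assms(1)]] assms(2)
  by (simp add: L2_norm_def)

lemma L2_integrable_mult:
  assumes [measurable]: "f \<in> L2_borel" "g \<in> L2_borel"
  shows "integrable lborel (\<lambda>x. f x * g x)"
proof (rule Bochner_Integration.integrable_bound[where f="\<lambda>x. (cmod (f x))\<^sup>2 + (cmod (g x))\<^sup>2"])
  have "cmod (f x) * cmod (g x) \<le> (cmod (f x))\<^sup>2 + (cmod (g x))\<^sup>2" for x
  proof -
    have "2 * (cmod (f x) * cmod (g x)) \<le> (cmod (f x))\<^sup>2 + (cmod (g x))\<^sup>2"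
      using sum_squares_bound[of "cmod (f x)" "cmod (g x)"] by (simp add: algebra_simps)
    moreover have "0 \<le> cmod (f x) * cmod (g x)" by simp
    ultimately show ?thesis by linarith
  qed
  then show "AE x in lborel. norm (f x * g x) \<le> norm ((cmod (f x))\<^sup>2 + (cmod (g x))\<^sup>2)"
    by (auto simp: norm_mult)
qed (use assms in \<open>auto intro: L2_borel_integrable\<close>)

text \<open>The choice t = B / A turns the right side into 2 A B. This converts weighted AM-GM
  bounds into Cauchy-Schwarz; when A or B vanishes, another t is needed.\<close>

lemma le_mult_of_weighted_le:
  fixes S A B :: real
  assumes "0 \<le> A" "0 \<le> B" and S: "\<And>t. 0 < t \<Longrightarrow> 2 * S \<le> t * A\<^sup>2 + B\<^sup>2 / t"
  shows "S \<le> A * B"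
proof (cases "A = 0 \<or> B = 0")
  case False
  then have "0 < B / A" "A \<noteq> 0" "B \<noteq> 0" using assms by auto
  then show ?thesis using S[of "B / A"] by (simp add: field_simps power2_eq_square)
next
  case True
  show ?thesis
  proof (rule ccontr)
    assume "\<not> S \<le> A * B"
    then have S0: "S > 0" using True by auto
    show False
    proof (cases "A = 0")
      case True
      \<comment> \<open>For A = 0 a large t is wanted: this one makes B^2 / t at most S, against 2 S
        on the left.\<close>
      have p: "0 < B\<^sup>2 / S + 1" using S0 by (simp add: add_nonneg_pos)
      have "2 * S \<le> B\<^sup>2 / (B\<^sup>2 / S + 1)" using S[OF p] True by simp
      moreover have "B\<^sup>2 / (B\<^sup>2 / S + 1) \<le> S"
        using S0 p by (simp add: divide_simps)
      ultimately show False using S0 by linarith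
    next
      case False
      with True have B0: "B = 0" by simp
      \<comment> \<open>For B = 0 this small t makes the right side equal to S.\<close>
      have "0 < S / A\<^sup>2" using S0 False by simp
      from S[OF this] show False using B0 False S0 by simp
    qed
  qed
qed

lemma L2_Cauchy_Schwarz:
  assumes [measurable]: "f \<in> L2_borel" "g \<in> L2_borel"
  shows "(LINT x|lborel. cmod (f x) * cmod (g x)) \<le> L2_norm f * L2_norm g"
proof (rule le_mult_of_weighted_le)
  fix t :: real assume t: "0 < t"
  have p: "2 * (a * b) \<le> t * a\<^sup>2 + b\<^sup>2 / t" for a b :: real
  proof -
    have "0 \<le> (sqrt t * a - b / sqrt t)\<^sup>2" by simp
    also have "\<dots> = t * a\<^sup>2 + b\<^sup>2 / t - 2 * (a * b)"
      using t by (simp add: power2_diff power_mult_distrib power_divide)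
    finally show ?thesis by simp
  qed
  have i: "integrable lborel (\<lambda>x. cmod (f x) * cmod (g x))"
    using integrable_norm[OF L2_integrable_mult[OF assms]] by (simp add: norm_mult)
  have "2 * (LINT x|lborel. cmod (f x) * cmod (g x)) = (LINT x|lborel. 2 * (cmod (f x) * cmod (g x)))"
    by simp
  also have "\<dots> \<le> (LINT x|lborel. t * (cmod (f x))\<^sup>2 + (cmod (g x))\<^sup>2 / t)"
    using i L2_borel_integrable[OF assms(1)] L2_borel_integrable[OF assms(2)]
    by (intro integral_mono p) auto
  also have "\<dots> = t * (L2_norm f)\<^sup>2 + (L2_norm g)\<^sup>2 / t"
    using L2_borel_integrable[OF assms(1)] L2_borel_integrable[OF assms(2)] by (simp add: L2_norm_def)
  finally show "2 * (LINT x|lborel. cmod (f x) * cmod (g x)) \<le> t * (L2_norm f)\<^sup>2 + (L2_norm g)\<^sup>2 / t" .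
qed auto

lemma L2_norm_integral_mult_le:
  assumes "f \<in> L2_borel" "g \<in> L2_borel"
  shows "cmod (LINT x|lborel. f x * g x) \<le> L2_norm f * L2_norm g"
proof -
  have "cmod (LINT x|lborel. f x * g x) \<le> (LINT x|lborel. cmod (f x * g x))"
    by (rule integral_norm_bound)
  then show ?thesis using L2_Cauchy_Schwarz[OF assms] by (simp add: norm_mult)
qed

lemma L2_norm_triangle:
  assumes f: "f \<in> L2_borel" and g: "g \<in> L2_borel"
  shows "L2_norm (\<lambda>x. f x + g x) \<le> L2_norm f + L2_norm g"
proof (rule power2_le_imp_le)
  have i: "integrable lborel (\<lambda>x. cmod (f x) * cmod (g x))"
    using integrable_norm[OF L2_integrable_mult[OF f g]] by (simp add: norm_mult)
  note [simp] = L2_borel_integrable[OF f] L2_borel_integrable[OF g] i L2_borel_integrable[OF L2_borel_add[OF f g]]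
  have "(L2_norm (\<lambda>x. f x + g x))\<^sup>2 = (LINT x|lborel. (cmod (f x + g x))\<^sup>2)"
    by (simp add: L2_norm_def)
  also have "\<dots> \<le> (LINT x|lborel. (cmod (f x))\<^sup>2 + (cmod (g x))\<^sup>2 + 2 * (cmod (f x) * cmod (g x)))"
  proof (rule integral_mono)
    show "(cmod (f x + g x))\<^sup>2 \<le> (cmod (f x))\<^sup>2 + (cmod (g x))\<^sup>2 + 2 * (cmod (f x) * cmod (g x))" for x
      using power_mono[OF norm_triangle_ineq[of "f x" "g x"], of 2] by (simp add: power2_sum)
  qed auto
  also have "\<dots> = (L2_norm f)\<^sup>2 + (L2_norm g)\<^sup>2 + 2 * (LINT x|lborel. cmod (f x) * cmod (g x))"
    by (simp add: L2_norm_def)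
  also have "\<dots> \<le> (L2_norm f + L2_norm g)\<^sup>2"
    using L2_Cauchy_Schwarz[OF f g] by (simp add: power2_sum)
  finally show "(L2_norm (\<lambda>x. f x + g x))\<^sup>2 \<le> (L2_norm f + L2_norm g)\<^sup>2" .
qed simp

lemma L2_norm_triangle_diff:
  assumes "f \<in> L2_borel" "g \<in> L2_borel" "h \<in> L2_borel"
  shows "L2_norm (\<lambda>x. f x - h x) \<le> L2_norm (\<lambda>x. f x - g x) + L2_norm (\<lambda>x. g x - h x)"
  using L2_norm_triangle[OF L2_borel_diff[OF assms(1,2)] L2_borel_diff[OF assms(2,3)]] by simp

lemma L2_norm_diff_abs:
  assumes "f \<in> L2_borel" "g \<in> L2_borel"
  shows "\<bar>L2_norm f - L2_norm g\<bar> \<le> L2_norm (\<lambda>x. f x - g x)"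
  using L2_norm_triangle[OF L2_borel_diff[OF assms] assms(2)]
    L2_norm_triangle[OF L2_borel_diff[OF assms(2,1)] assms(1)] L2_norm_commute[of f g]
  by simp

lemma L2_norm_tendsto:
  assumes "\<And>k. F k \<in> L2_borel" "g \<in> L2_borel" "(\<lambda>k. L2_norm (\<lambda>x. F k x - g x)) \<longlonglongrightarrow> 0"
  shows "(\<lambda>k. L2_norm (F k)) \<longlonglongrightarrow> L2_norm g"
proof -
  have "(\<lambda>k. L2_norm (F k) - L2_norm g) \<longlonglongrightarrow> 0"
    by (rule Lim_null_comparison[OF _ assms(3)]) (simp add: L2_norm_diff_abs[OF assms(1,2)])
  then show ?thesis by (simp add: LIM_zero_iff)
qed

lemma L2_integral_mult_tendsto:
  assumes "\<And>k. F k \<in> L2_borel" "f \<in> L2_borel" "g \<in> L2_borel" "(\<lambda>k. L2_norm (\<lambda>x. F k x - f x)) \<longlonglongrightarrow> 0"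
  shows "(\<lambda>k. LINT x|lborel. F k x * g x) \<longlonglongrightarrow> (LINT x|lborel. f x * g x)"
proof -
  have "(\<lambda>k. (LINT x|lborel. F k x * g x) - (LINT x|lborel. f x * g x)) \<longlonglongrightarrow> 0"
  proof (rule Lim_null_comparison)
    show "(\<lambda>k. L2_norm (\<lambda>x. F k x - f x) * L2_norm g) \<longlonglongrightarrow> 0"
      using tendsto_mult_right[OF assms(4), of "L2_norm g"] by simp
    have "cmod ((LINT x|lborel. F k x * g x) - (LINT x|lborel. f x * g x)) \<le> L2_norm (\<lambda>x. F k x - f x) * L2_norm g" for k
    proof -
      have "(LINT x|lborel. F k x * g x) - (LINT x|lborel. f x * g x) = (LINT x|lborel. (F k x - f x) * g x)"
        using L2_integrable_mult[OF assms(1,3)] L2_integrable_mult[OF assms(2,3)]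
        by (simp add: left_diff_distrib)
      then show ?thesis using L2_norm_integral_mult_le[OF L2_borel_diff[OF assms(1,2)] assms(3)] by simp
    qed
    then show "\<forall>\<^sub>F k in sequentially. norm ((LINT x|lborel. F k x * g x) - (LINT x|lborel. f x * g x))
         \<le> L2_norm (\<lambda>x. F k x - f x) * L2_norm g" by simp
  qed
  then show ?thesis by (simp add: LIM_zero_iff)
qed

lemma L2_limit_unique:
  assumes "\<And>k. F k \<in> L2_borel" "f \<in> L2_borel" "g \<in> L2_borel"
    and "(\<lambda>k. L2_norm (\<lambda>x. F k x - f x)) \<longlonglongrightarrow> 0" "(\<lambda>k. L2_norm (\<lambda>x. F k x - g x)) \<longlonglongrightarrow> 0"
  shows "AE x in lborel. f x = g x"
proof -
  have "L2_norm (\<lambda>x. f x - g x) \<le> L2_norm (\<lambda>x. F k x - f x) + L2_norm (\<lambda>x. F k x - g x)" for k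
    using L2_norm_triangle_diff[OF assms(2) assms(1)[of k] assms(3)] L2_norm_commute[of f "F k"] by simp
  then have "L2_norm (\<lambda>x. f x - g x) \<le> 0"
    using tendsto_add[OF assms(4,5)] by (intro LIMSEQ_le_const[where X="\<lambda>k. L2_norm (\<lambda>x. F k x - f x) + L2_norm (\<lambda>x. F k x - g x)"]) auto
  then have "L2_norm (\<lambda>x. f x - g x) = 0" by (simp add: antisym)
  from L2_norm_eq_0[OF L2_borel_diff[OF assms(2,3)] this] show ?thesis by simp
qed

lemma L2_dominated_convergence:
  assumes [measurable]: "\<And>k. F k \<in> borel_measurable borel" "f \<in> borel_measurable borel"
    and G: "integrable lborel (\<lambda>x. (G x)\<^sup>2)"
    and bd: "\<And>k x. cmod (F k x) \<le> G x" "\<And>x. cmod (f x) \<le> G x"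
    and lim: "AE x in lborel. (\<lambda>k. F k x) \<longlonglongrightarrow> f x"
  shows "F k \<in> L2_borel" "f \<in> L2_borel" "(\<lambda>k. L2_norm (\<lambda>x. F k x - f x)) \<longlonglongrightarrow> 0"
proof -
  show "F k \<in> L2_borel" "f \<in> L2_borel"
    using bd by (auto intro!: L2_borelI_bound[OF _ G] power_mono)
  have "(\<lambda>k. LINT x|lborel. (cmod (F k x - f x))\<^sup>2) \<longlonglongrightarrow> (LINT x|(lborel :: 'a measure). 0)"
  proof (rule integral_dominated_convergence[where w="\<lambda>x. 4 * (G x)\<^sup>2"])
    show "AE x in lborel. (\<lambda>k. (cmod (F k x - f x))\<^sup>2) \<longlonglongrightarrow> 0"
      using lim
    proof eventually_elim
      case (elim x)
      then have "(\<lambda>k. (cmod (F k x - f x))\<^sup>2) \<longlonglongrightarrow> (cmod (f x - f x))\<^sup>2"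
        by (intro tendsto_intros)
      then show ?case by simp
    qed
    have "(cmod (F k x - f x))\<^sup>2 \<le> 4 * (G x)\<^sup>2" for k x
    proof -
      have "cmod (F k x - f x) \<le> 2 * G x"
        using norm_triangle_ineq4[of "F k x" "f x"] bd(1)[of k x] bd(2)[of x] by linarith
      then have "(cmod (F k x - f x))\<^sup>2 \<le> (2 * G x)\<^sup>2" by (intro power_mono) auto
      then show ?thesis by (simp add: power_mult_distrib)
    qed
    then show "AE x in lborel. norm ((cmod (F k x - f x))\<^sup>2) \<le> 4 * (G x)\<^sup>2" for k by simp
  qed (use G in auto)
  from tendsto_real_sqrt[OF this] show "(\<lambda>k. L2_norm (\<lambda>x. F k x - f x)) \<longlonglongrightarrow> 0"
    by (simp add: L2_norm_def)
qed

text \<open>Riesz-Fischer. Along a subsequence the increments \<open>d i\<close> have norm at most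
  4^-i; weighting their squares by 2^i still gives an integrable series, and its finiteness at a
  point forces |d i| to decay like 2^(-i/2), so the subsequence converges almost everywhere. Fatou's
  lemma then leads from the pointwise limit back to the whole sequence.\<close>

lemma L2_complete:
  assumes F: "\<And>k. F k \<in> L2_borel"
    and C: "\<And>e. 0 < e \<Longrightarrow> \<exists>N. \<forall>j\<ge>N. \<forall>k\<ge>N. L2_norm (\<lambda>x. F j x - F k x) < e"
  obtains g where "g \<in> L2_borel" "(\<lambda>k. L2_norm (\<lambda>x. F k x - g x)) \<longlonglongrightarrow> 0"
proof -
  note [measurable] = L2_borel_measurable[OF F]
  have "\<forall>i::nat. \<exists>N. \<forall>j\<ge>N. \<forall>k\<ge>N. L2_norm (\<lambda>x. F j x - F k x) < (1/4) ^ i"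
    using C by simp
  then obtain r where r: "\<And>i j k. j \<ge> r i \<Longrightarrow> k \<ge> r i \<Longrightarrow> L2_norm (\<lambda>x. F j x - F k x) < (1/4) ^ i"
    by metis
  \<comment> \<open>Summing all earlier \<open>r j\<close> makes \<open>R j\<close> dominate
    \<open>r i\<close> for every i <= j; the summand i makes \<open>R i\<close> at least i, which
    the Fatou step uses.\<close>
  define R where "R i = i + (\<Sum>j\<le>i. r j)" for i
  have Rr: "r i \<le> R j" if "i \<le> j" for i j
    using that member_le_sum[of i "{..j}" r] by (simp add: R_def trans_le_add2)
  define d where "d i x = F (R (Suc i)) x - F (R i) x" for i x
  have d: "d i \<in> L2_borel" "L2_norm (d i) \<le> (1/4) ^ i" for i
    using r[of i "R (Suc i)" "R i"] Rr[of i "Suc i"] Rr[of i i] L2_borel_diff[OF F F]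
    by (auto simp: d_def[abs_def] less_imp_le)
  have [measurable]: "d i \<in> borel_measurable borel" for i by (rule L2_borel_measurable[OF d(1)])
  have "(\<integral>\<^sup>+x. (\<Sum>i. ennreal (2 ^ i * (cmod (d i x))\<^sup>2)) \<partial>lborel)
      = (\<Sum>i. \<integral>\<^sup>+x. ennreal (2 ^ i * (cmod (d i x))\<^sup>2) \<partial>lborel)"
    by (intro nn_integral_suminf) simp
  also have "\<dots> \<le> (\<Sum>i. ennreal ((1/2) ^ i))"
  proof (intro suminf_le)
    fix i
    have "(\<integral>\<^sup>+x. ennreal (2 ^ i * (cmod (d i x))\<^sup>2) \<partial>lborel) = ennreal (2 ^ i) * (\<integral>\<^sup>+x. ennreal ((cmod (d i x))\<^sup>2) \<partial>lborel)"
      by (subst nn_integral_cmult[symmetric]) (auto simp: ennreal_mult')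
    also have "\<dots> = ennreal (2 ^ i * (L2_norm (d i))\<^sup>2)"
      by (simp add: nn_integral_L2[OF d(1)] ennreal_mult)
    also have "(L2_norm (d i))\<^sup>2 \<le> (1/4) ^ i * 1"
      unfolding power2_eq_square using d(2)[of i] power_le_one[of "1/4::real" i]
      by (intro mult_mono) (auto intro: order_trans)
    then have "2 ^ i * (L2_norm (d i))\<^sup>2 \<le> 2 ^ i * ((1/4) ^ i * 1)"
      by (intro mult_left_mono) auto
    also have "\<dots> = (1/2) ^ i" by (simp add: power_mult_distrib[symmetric])
    finally show "(\<integral>\<^sup>+x. ennreal (2 ^ i * (cmod (d i x))\<^sup>2) \<partial>lborel) \<le> ennreal ((1/2) ^ i)"
      by (simp add: ennreal_leI)
  qed auto
  also have "\<dots> = ennreal (\<Sum>i. (1/2) ^ i)" by (intro suminf_ennreal2) (auto simp: summable_geometric)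
  also have "\<dots> < \<infinity>" by simp
  finally have "AE x in lborel. (\<Sum>i. ennreal (2 ^ i * (cmod (d i x))\<^sup>2)) \<noteq> \<infinity>"
    by (intro nn_integral_PInf_AE) auto
  then have conv: "AE x in lborel. convergent (\<lambda>i. F (R i) x)"
  proof eventually_elim
    case (elim x)
    define s where "s = enn2real (\<Sum>i. ennreal (2 ^ i * (cmod (d i x))\<^sup>2))"
    have s: "(\<Sum>i. ennreal (2 ^ i * (cmod (d i x))\<^sup>2)) = ennreal s"
      using elim by (simp add: s_def ennreal_enn2real top.not_eq_extremum)
    have di: "norm (d i x) \<le> sqrt s * (1 / sqrt 2) ^ i" for i
    proof -
      have "ennreal (2 ^ i * (cmod (d i x))\<^sup>2) \<le> ennreal s"
        using sum_le_suminf[of "\<lambda>i. ennreal (2 ^ i * (cmod (d i x))\<^sup>2)" "{i}"] s by simp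
      then have "2 ^ i * (cmod (d i x))\<^sup>2 \<le> s" by (simp add: s_def)
      then have "(cmod (d i x))\<^sup>2 \<le> s * (1/2) ^ i" by (simp add: field_simps power_one_over)
      then have "cmod (d i x) \<le> sqrt (s * (1/2) ^ i)" by (rule real_le_rsqrt)
      also have "\<dots> = sqrt s * (1 / sqrt 2) ^ i" by (simp add: real_sqrt_mult real_sqrt_power real_sqrt_divide)
      finally show ?thesis .
    qed
    have "summable (\<lambda>i. sqrt s * (1 / sqrt 2) ^ i)" by (simp add: summable_geometric)
    from summable_comparison_test'[OF this di] have "summable (\<lambda>i. d i x)" .
    then have "convergent (\<lambda>n. (\<Sum>i<n. d i x) + F (R 0) x)"
      by (intro convergent_add convergent_const) (simp add: summable_iff_convergent)
    moreover have "(\<Sum>i<n. d i x) + F (R 0) x = F (R n) x" for n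
      unfolding d_def by (subst sum_lessThan_telescope) simp
    ultimately show ?case by simp
  qed
  define g where "g x = lim (\<lambda>i. F (R i) x)" for x
  have [measurable]: "g \<in> borel_measurable borel" unfolding g_def by measurable
  have key: "(\<lambda>x. F k x - g x) \<in> L2_borel \<and> L2_norm (\<lambda>x. F k x - g x) \<le> e"
    if N: "\<forall>j\<ge>N. \<forall>k\<ge>N. L2_norm (\<lambda>x. F j x - F k x) < e" and "k \<ge> N" "0 < e" for k N e
  proof -
    have "(\<integral>\<^sup>+x. ennreal ((cmod (F k x - g x))\<^sup>2) \<partial>lborel)
        = (\<integral>\<^sup>+x. liminf (\<lambda>i. ennreal ((cmod (F k x - F (R i) x))\<^sup>2)) \<partial>lborel)"
    proof (rule nn_integral_cong_AE)
      show "AE x in lborel. ennreal ((cmod (F k x - g x))\<^sup>2) = liminf (\<lambda>i. ennreal ((cmod (F k x - F (R i) x))\<^sup>2))"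
        using conv
      proof eventually_elim
        case (elim x)
        then have "(\<lambda>i. F (R i) x) \<longlonglongrightarrow> g x" by (simp add: g_def convergent_LIMSEQ_iff)
        then have "(\<lambda>i. ennreal ((cmod (F k x - F (R i) x))\<^sup>2)) \<longlonglongrightarrow> ennreal ((cmod (F k x - g x))\<^sup>2)"
          by (intro tendsto_intros)
        from lim_imp_Liminf[OF sequentially_bot this] show ?case by (rule sym)
      qed
    qed
    also have "\<dots> \<le> liminf (\<lambda>i. \<integral>\<^sup>+x. ennreal ((cmod (F k x - F (R i) x))\<^sup>2) \<partial>lborel)"
      by (intro nn_integral_liminf) auto
    also have "\<dots> \<le> liminf (\<lambda>i::nat. ennreal (e\<^sup>2))"
    proof (rule Liminf_mono)
      show "\<forall>\<^sub>F i in sequentially. (\<integral>\<^sup>+x. ennreal ((cmod (F k x - F (R i) x))\<^sup>2) \<partial>lborel) \<le> ennreal (e\<^sup>2)"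
        using eventually_ge_at_top[of N]
      proof eventually_elim
        case (elim i)
        have "i \<le> R i" by (simp add: R_def)
        then have "L2_norm (\<lambda>x. F k x - F (R i) x) \<le> e"
          using N that(2) elim by (simp add: less_imp_le)
        then show ?case
          by (subst nn_integral_L2[OF L2_borel_diff[OF F F]]) (auto intro!: ennreal_leI power_mono)
      qed
    qed
    finally have "(\<integral>\<^sup>+x. ennreal ((cmod (F k x - g x))\<^sup>2) \<partial>lborel) \<le> ennreal (e\<^sup>2)"
      by (simp add: Liminf_const)
    from L2_norm_le_iff_nn[OF _ _ this] that(3) show ?thesis by auto
  qed
  obtain N0 where "\<forall>j\<ge>N0. \<forall>k\<ge>N0. L2_norm (\<lambda>x. F j x - F k x) < 1" using C[of 1] by auto
  from key[OF this order_refl] have "(\<lambda>x. F N0 x - g x) \<in> L2_borel" by simp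
  from L2_borel_diff[OF F[of N0] this] have g: "g \<in> L2_borel" by simp
  have "(\<lambda>k. L2_norm (\<lambda>x. F k x - g x)) \<longlonglongrightarrow> 0"
  proof (rule LIMSEQ_I)
    fix e :: real assume "0 < e"
    then obtain N where N: "\<forall>j\<ge>N. \<forall>k\<ge>N. L2_norm (\<lambda>x. F j x - F k x) < e/2" using C[of "e/2"] by auto
    show "\<exists>no. \<forall>n\<ge>no. norm (L2_norm (\<lambda>x. F n x - g x) - 0) < e"
      using key[OF N] \<open>0 < e\<close> by (intro exI[of _ N]) force
  qed
  with g show ?thesis by (rule that)
qed

section \<open>Truncation to balls and density of continuous functions\<close>

definition ball_trunc :: "nat \<Rightarrow> ('a::euclidean_space \<Rightarrow> complex) \<Rightarrow> 'a \<Rightarrow> complex" where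
  "ball_trunc k f x = indicator (cball 0 (real k)) x * f x"

lemma ball_trunc_measurable [measurable]:
  "f \<in> borel_measurable borel \<Longrightarrow> ball_trunc k f \<in> borel_measurable borel"
  unfolding ball_trunc_def[abs_def] by (intro borel_measurable_times borel_measurable_indicator) auto

lemma norm_ball_trunc_le: "cmod (ball_trunc k f x) \<le> cmod (f x)"
  by (simp add: ball_trunc_def norm_mult indicator_def)

lemma L2_borel_ball_trunc: "f \<in> L2_borel \<Longrightarrow> ball_trunc k f \<in> L2_borel"
  by (rule L2_borelI_bound[where g="\<lambda>x. (cmod (f x))\<^sup>2"])
     (auto intro: L2_borel_integrable power_mono norm_ball_trunc_le)

lemma ball_trunc_tendsto: "(\<lambda>k. ball_trunc k f x) \<longlonglongrightarrow> f x"
proof (rule tendsto_eventually)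
  show "\<forall>\<^sub>F k in sequentially. ball_trunc k f x = f x"
    using eventually_ge_at_top[of "nat \<lceil>norm x\<rceil>"]
    by eventually_elim (auto simp: ball_trunc_def dist_norm nat_le_iff ceiling_le_iff)
qed

lemma L2_ball_trunc_tendsto:
  assumes f: "f \<in> L2_borel"
  shows "(\<lambda>k. L2_norm (\<lambda>x. ball_trunc k f x - f x)) \<longlonglongrightarrow> 0"
  using f L2_borel_integrable[OF f]
  by (intro L2_dominated_convergence(3)[where G="\<lambda>x. cmod (f x)"])
     (auto intro: norm_ball_trunc_le ball_trunc_tendsto)

lemma integrable_indicator_cball: "integrable lborel (\<lambda>x::'a::euclidean_space. indicator (cball c r) x :: real)"
  using emeasure_bounded_finite[of "cball c r"] by (intro integrable_real_indicator) (auto simp: top.not_eq_extremum)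

lemma integrable_of_L2_bounded_support:
  assumes f: "f \<in> L2_borel" and s: "\<And>x. f x \<noteq> 0 \<Longrightarrow> x \<in> cball 0 R"
  shows "integrable lborel f"
proof (rule Bochner_Integration.integrable_bound[where f="\<lambda>x. indicator (cball 0 R) x + (cmod (f x))\<^sup>2"])
  show "integrable lborel (\<lambda>x. indicator (cball 0 R) x + (cmod (f x))\<^sup>2)"
    using L2_borel_integrable[OF f] integrable_indicator_cball by (intro Bochner_Integration.integrable_add)
  have "cmod (f x) \<le> indicator (cball 0 R) x + (cmod (f x))\<^sup>2" for x
  proof (cases "f x = 0")
    case False
    have "2 * cmod (f x) \<le> (cmod (f x))\<^sup>2 + 1" using sum_squares_bound[of "cmod (f x)" 1] by simp
    then have "cmod (f x) \<le> 1 + (cmod (f x))\<^sup>2" using norm_ge_zero[of "f x"] by linarith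
    then show ?thesis using s[OF False] by simp
  qed simp
  then show "AE x in lborel. norm (f x) \<le> norm (indicator (cball 0 R) x + (cmod (f x))\<^sup>2)"
    by (auto simp: abs_of_nonneg)
qed (use f in auto)

lemma integrable_ball_trunc: "f \<in> L2_borel \<Longrightarrow> integrable lborel (ball_trunc k f)"
  by (rule integrable_of_L2_bounded_support[where R="real k"])
     (auto simp: L2_borel_ball_trunc, auto simp: ball_trunc_def indicator_def split: if_splits)

text \<open>A bounded truncation \<open>h k\<close> of \<open>f\<close> to a ball is almost
  everywhere a limit of continuous functions; clipping these in size and in space supplies a common
  dominating function, so dominated convergence upgrades the limit to L2.\<close>

lemma L2_dense_continuous:
  fixes f :: "'a::euclidean_space \<Rightarrow> complex"
  assumes f: "f \<in> L2_borel" and e: "0 < e"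
  obtains g M R where "continuous_on UNIV g" "\<And>x. g x \<noteq> 0 \<Longrightarrow> x \<in> cball 0 R" "\<And>x. cmod (g x) \<le> M"
    "L2_norm (\<lambda>x. g x - f x) < e"
proof -
  note [measurable] = L2_borel_measurable[OF f]
  define h where "h k x = (if cmod (f x) \<le> real k then ball_trunc k f x else 0)" for k x
  have hb: "cmod (h k x) \<le> cmod (f x)" for k x using norm_ball_trunc_le[of k f x] by (auto simp: h_def)
  have "(\<lambda>k. h k x) \<longlonglongrightarrow> f x" for x
  proof (rule Lim_transform_eventually[OF ball_trunc_tendsto[of f x]])
    show "\<forall>\<^sub>F k in sequentially. ball_trunc k f x = h k x"
      using eventually_ge_at_top[of "nat \<lceil>cmod (f x)\<rceil>"]
      by eventually_elim (auto simp: h_def nat_le_iff ceiling_le_iff)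
  qed
  then have hlim: "AE x in lborel. (\<lambda>k. h k x) \<longlonglongrightarrow> f x" by simp
  have [measurable]: "h k \<in> borel_measurable borel" for k unfolding h_def[abs_def] by measurable
  have hL: "h k \<in> L2_borel" for k
    by (rule L2_dominated_convergence(1)[OF _ _ L2_borel_integrable[OF f] hb _ hlim]) auto
  have "(\<lambda>k. L2_norm (\<lambda>x. h k x - f x)) \<longlonglongrightarrow> 0"
    by (rule L2_dominated_convergence(3)[OF _ _ L2_borel_integrable[OF f] hb _ hlim]) auto
  then obtain k where k: "L2_norm (\<lambda>x. h k x - f x) < e / 2"
    using e LIMSEQ_D[of "\<lambda>k. L2_norm (\<lambda>x. h k x - f x)" 0 "e/2"] by auto
  have "h k measurable_on UNIV"
    by (rule lebesgue_measurable_imp_measurable_on) (auto intro: measurable_completion)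
  then obtain N and G :: "nat \<Rightarrow> 'a \<Rightarrow> complex" where N: "negligible N" and "\<forall>n. continuous_on UNIV (G n)"
    and "\<forall>x. x \<notin> N \<longrightarrow> (\<lambda>n. G n x) \<longlonglongrightarrow> (if x \<in> UNIV then h k x else 0)"
    unfolding measurable_on_def by blast
  then have G: "\<And>n. continuous_on UNIV (G n)" and lim: "\<And>x. x \<notin> N \<Longrightarrow> (\<lambda>n. G n x) \<longlonglongrightarrow> h k x"
    by simp_all
  \<comment> \<open>The radial retraction onto the disc of radius k. For k = 0 the denominator can
    vanish, hence the separate case, in which \<open>h k\<close> is 0.\<close>
  define c :: "complex \<Rightarrow> complex" where "c z = of_real (real k / max (real k) (cmod z)) * z" for z
  \<comment> \<open>A tent cutoff: 1 on the ball of radius k, where \<open>h k\<close> lives, and 0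
    outside radius k + 1.\<close>
  define ct :: "'a \<Rightarrow> complex" where "ct x = of_real (max 0 (min 1 (real k + 1 - norm x)))" for x
  define M where "M = real k"
  define g where "g n x = (if k = 0 then 0 else ct x * c (G n x))" for n x
  have cb: "cmod (c z) \<le> real k" for z
  proof -
    have "cmod z / max (real k) (cmod z) \<le> 1" by (auto intro: divide_le_eq_1[THEN iffD2])
    from mult_left_mono[OF this, of "real k"] show ?thesis
      by (simp add: c_def norm_mult norm_divide abs_of_nonneg le_max_iff_disj)
  qed
  have ck: "c z = z" if "cmod z \<le> real k" "k \<noteq> 0" for z using that by (simp add: c_def max_absorb1)
  have cc: "continuous_on UNIV c" if "k \<noteq> 0" using that
    unfolding c_def by (intro continuous_intros) auto
  have cG: "continuous_on UNIV (\<lambda>x. c (G n x))" if "k \<noteq> 0" for n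
    using continuous_on_compose2[OF cc[OF that] G[of n]] by simp
  have gc: "continuous_on UNIV (g n)" for n
    unfolding g_def ct_def using cG[of n] by (cases "k = 0") (auto intro!: continuous_intros)
  have ctb: "cmod (ct x) \<le> indicator (cball 0 (real k + 1)) x" for x
    by (auto simp: ct_def indicator_def)
  have gb: "cmod (g n x) \<le> real k * indicator (cball 0 (real k + 1)) x" for n x
    using mult_mono[OF ctb[of x] cb[of "G n x"]] by (auto simp: g_def norm_mult mult.commute)
  have gb1: "cmod (g n x) \<le> real k" for n x
    using gb[of n x] by (rule order_trans) (simp add: indicator_def)
  have hb1: "cmod (h k x) \<le> real k * indicator (cball 0 (real k + 1)) x" for x
    using norm_ball_trunc_le[of k f x] by (auto simp: h_def ball_trunc_def indicator_def split: if_splits)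
  have [measurable]: "g n \<in> borel_measurable borel" for n by (rule borel_measurable_continuous_onI[OF gc])
  have AE: "AE x in lborel. (\<lambda>n. g n x) \<longlonglongrightarrow> h k x"
  proof -
    have "N \<in> null_sets lebesgue" using N by (simp add: negligible_iff_null_sets)
    then have "AE x in lebesgue. x \<notin> N" by (rule AE_not_in)
    then have "AE x in lborel. x \<notin> N" by (simp add: AE_completion_iff)
    then show ?thesis
    proof eventually_elim
      case (elim x)
      show ?case
      proof (cases "k = 0")
        case False
        have "(\<lambda>n. ct x * c (G n x)) \<longlonglongrightarrow> ct x * c (h k x)"
          by (intro tendsto_intros continuous_on_tendsto_compose[OF cc[OF False] lim[OF elim]]) auto
        moreover have "ct x * c (h k x) = h k x"
        proof (cases "h k x = 0")
          case True then show ?thesis by (simp add: c_def)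
        next
          case nz: False
          have "ct x = 1" using nz by (auto simp: h_def ball_trunc_def indicator_def ct_def split: if_splits)
          moreover have "c (h k x) = h k x"
            using order_trans[OF hb1[of x]] False by (intro ck) (simp_all add: indicator_def)
          ultimately show ?thesis by simp
        qed
        ultimately show ?thesis using False by (simp add: g_def)
      next
        case True
        then have "h k x = 0" using hb1[of x] by simp
        with True show ?thesis by (simp add: g_def)
      qed
    qed
  qed
  have "integrable lborel (\<lambda>x::'a. (real k * indicator (cball 0 (real k + 1)) x)\<^sup>2)"
  proof -
    have "(real k * indicator (cball 0 (real k + 1)) x)\<^sup>2 = (real k)\<^sup>2 * indicator (cball 0 (real k + 1)) x" for x :: 'a
      by (simp add: indicator_def)
    then show ?thesis using integrable_indicator_cball[of "0::'a" "real k + 1"] by simp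
  qed
  from L2_dominated_convergence(1,3)[OF _ _ this gb hb1 AE]
  have "(\<lambda>n. L2_norm (\<lambda>x. g n x - h k x)) \<longlonglongrightarrow> 0" and gL: "g n \<in> L2_borel" for n by auto
  then obtain n where n: "L2_norm (\<lambda>x. g n x - h k x) < e / 2"
    using e LIMSEQ_D[of "\<lambda>n. L2_norm (\<lambda>x. g n x - h k x)" 0 "e/2"] by auto
  show ?thesis
  proof (rule that[OF gc _ gb1])
    show "L2_norm (\<lambda>x. g n x - f x) < e"
      using L2_norm_triangle_diff[OF gL hL f, of n k] n k by linarith
    show "x \<in> cball 0 (real k + 1)" if "g n x \<noteq> 0" for x
      using that gb[of n x] by (cases "x \<in> cball 0 (real k + 1)") simp_all
  qed
qed

section \<open>The Fourier transform and Plancherel's theorem\<close>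

lemma integrable_pair_mult:
  fixes f :: "'a::euclidean_space \<Rightarrow> complex" and g :: "'b::euclidean_space \<Rightarrow> complex"
  assumes f: "integrable lborel f" and g: "integrable lborel g"
  shows "integrable (lborel \<Otimes>\<^sub>M lborel) (\<lambda>(x, y). f x * g y)"
proof (rule lborel_pair.Fubini_integrable)
  have [measurable]: "f \<in> borel_measurable borel" "g \<in> borel_measurable borel" using f g by auto
  show "(\<lambda>(x, y). f x * g y) \<in> borel_measurable (lborel \<Otimes>\<^sub>M lborel)" by measurable
  have "integrable lborel (\<lambda>x. cmod (f x) * (LINT y|lborel. cmod (g y)))"
    using f by auto
  then show "integrable lborel (\<lambda>x. LINT y|lborel. norm (case (x, y) of (x, y) \<Rightarrow> f x * g y))"
    by (simp add: norm_mult)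
  show "AE x in lborel. integrable lborel (\<lambda>y. case (x, y) of (x, y) \<Rightarrow> f x * g y)"
    using g by simp
qed

lemma cis_measurable [measurable]: "cis \<in> borel_measurable borel"
  by (intro borel_measurable_continuous_onI continuous_intros)

definition ft :: "('a::euclidean_space \<Rightarrow> complex) \<Rightarrow> 'a \<Rightarrow> complex" where
  "ft f \<xi> = (LINT x|lborel. cis (- (2 * pi * (x \<bullet> \<xi>))) * f x)"

lemma integrable_cis_mult:
  assumes f: "integrable lborel f" and [measurable]: "g \<in> borel_measurable borel"
  shows "integrable lborel (\<lambda>x. cis (g x) * f x)"
  by (rule Bochner_Integration.integrable_bound[OF f]) (use f in \<open>auto simp: norm_mult\<close>)

lemma ft_measurable [measurable]:
  assumes [measurable]: "f \<in> borel_measurable borel"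
  shows "ft f \<in> borel_measurable borel"
  unfolding ft_def[abs_def] by measurable

lemma norm_ft_le: "cmod (ft f \<xi>) \<le> (LINT x|lborel. cmod (f x))"
  using integral_norm_bound[of lborel "\<lambda>x. cis (- (2 * pi * (x \<bullet> \<xi>))) * f x"]
  by (simp add: ft_def norm_mult)

lemma ft_diff:
  assumes "integrable lborel f" "integrable lborel g"
  shows "ft (\<lambda>x. f x - g x) \<xi> = ft f \<xi> - ft g \<xi>"
  unfolding ft_def using assms by (simp add: right_diff_distrib integrable_cis_mult)

lemma ft_add:
  assumes "integrable lborel f" "integrable lborel g"
  shows "ft (\<lambda>x. f x + g x) \<xi> = ft f \<xi> + ft g \<xi>"
  unfolding ft_def using assms by (simp add: distrib_left integrable_cis_mult)

lemma ft_cmult: "ft (\<lambda>x. c * f x) \<xi> = c * ft f \<xi>"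
  unfolding ft_def by (simp add: mult.left_commute)

lemma ft_multiplication_formula:
  assumes f: "integrable lborel f" and g: "integrable lborel g"
  shows "(LINT \<xi>|lborel. ft f \<xi> * g \<xi>) = (LINT x|lborel. f x * ft g x)"
proof -
  have [measurable]: "f \<in> borel_measurable borel" "g \<in> borel_measurable borel" using f g by auto
  have i: "integrable (lborel \<Otimes>\<^sub>M lborel) (\<lambda>(\<xi>, x). cis (- (2 * pi * (x \<bullet> \<xi>))) * (g \<xi> * f x))"
    by (rule Bochner_Integration.integrable_bound[OF integrable_pair_mult[OF g f]])
      (auto simp: norm_mult case_prod_beta)
  have "(LINT \<xi>|lborel. ft f \<xi> * g \<xi>) = (LINT \<xi>|lborel. LINT x|lborel. cis (- (2 * pi * (x \<bullet> \<xi>))) * (g \<xi> * f x))"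
    unfolding ft_def integral_mult_left_zero[symmetric] by (simp only: mult_ac)
  also have "\<dots> = (LINT x|lborel. LINT \<xi>|lborel. cis (- (2 * pi * (x \<bullet> \<xi>))) * (g \<xi> * f x))"
    by (rule lborel_pair.Fubini_integral[symmetric]) (use i in simp)
  also have "\<dots> = (LINT x|lborel. f x * ft g x)"
    unfolding ft_def integral_mult_right_zero[symmetric] by (simp only: mult_ac inner_commute)
  finally show ?thesis .
qed

text \<open>The characteristic function of the standard normal law after the substitution x = 2 pi
  \<sigma> t, read as the Fourier transform of a Gaussian.\<close>

lemma integral_normal_exp_cis:
  assumes s: "0 < \<sigma>"
  shows "integrable lborel (\<lambda>t. complex_of_real (exp (- (2 * pi\<^sup>2 * \<sigma>\<^sup>2 * t\<^sup>2))) * cis (- (2 * pi * (z * t))))"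
    and "(LINT t|lborel. complex_of_real (exp (- (2 * pi\<^sup>2 * \<sigma>\<^sup>2 * t\<^sup>2))) * cis (- (2 * pi * (z * t))))
      = complex_of_real (normal_density 0 \<sigma> z)"
proof -
  define h where "h x = complex_of_real (std_normal_density x) * cis (- (z / \<sigma>) * x)" for x
  have h: "integrable lborel h"
    unfolding h_def by (rule Bochner_Integration.integrable_bound[of _ "std_normal_density"]) (auto simp: norm_mult)
  have "complex_of_real (exp (- ((- (z / \<sigma>))\<^sup>2) / 2)) = char std_normal_distribution (- (z / \<sigma>))"
    by (simp add: char_std_normal_distribution)
  also have "\<dots> = (LINT x|lborel. h x)"
    unfolding char_def h_def
    by (subst integral_density) (auto simp: scaleR_conv_of_real cis_conv_exp mult_ac)
  also have "\<dots> = \<bar>2 * pi * \<sigma>\<bar> *\<^sub>R (LINT t|lborel. h (0 + 2 * pi * \<sigma> * t))"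
    using s by (intro lborel_integral_real_affine) auto
  finally have *: "complex_of_real (exp (- ((z / \<sigma>)\<^sup>2) / 2)) = of_real (2 * pi * \<sigma>) * (LINT t|lborel. h (2 * pi * \<sigma> * t))"
    using s by (simp add: scaleR_conv_of_real abs_mult)
  have hh: "h (2 * pi * \<sigma> * t) = complex_of_real (1 / sqrt (2 * pi)) *
      (complex_of_real (exp (- (2 * pi\<^sup>2 * \<sigma>\<^sup>2 * t\<^sup>2))) * cis (- (2 * pi * (z * t))))" for t
    using s by (simp add: h_def std_normal_density_def power_mult_distrib field_simps)
  have "integrable lborel (\<lambda>t. complex_of_real (sqrt (2 * pi)) * h (0 + 2 * pi * \<sigma> * t))"
    using s by (intro integrable_mult_right lborel_integrable_real_affine h) auto
  then show "integrable lborel (\<lambda>t. complex_of_real (exp (- (2 * pi\<^sup>2 * \<sigma>\<^sup>2 * t\<^sup>2))) * cis (- (2 * pi * (z * t))))"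
    by (simp add: hh)
  define I where "I = (LINT t|lborel. complex_of_real (exp (- (2 * pi\<^sup>2 * \<sigma>\<^sup>2 * t\<^sup>2))) * cis (- (2 * pi * (z * t))))"
  have "(LINT t|lborel. h (2 * pi * \<sigma> * t)) = complex_of_real (1 / sqrt (2 * pi)) * I"
    unfolding hh I_def by (rule integral_mult_right_zero)
  with * have **: "complex_of_real (exp (- ((z / \<sigma>)\<^sup>2) / 2)) = of_real (2 * pi * \<sigma> * (1 / sqrt (2 * pi))) * I"
    by simp
  have c: "2 * pi * \<sigma> * (1 / sqrt (2 * pi)) = sqrt (2 * pi * \<sigma>\<^sup>2)"
  proof -
    have "2 * pi / sqrt (2 * pi) = sqrt (2 * pi)" by (rule real_div_sqrt) simp
    then show ?thesis using s by (simp add: real_sqrt_mult field_simps)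
  qed
  have "I = complex_of_real (exp (- ((z / \<sigma>)\<^sup>2) / 2) / sqrt (2 * pi * \<sigma>\<^sup>2))"
    using ** s unfolding c by (simp add: field_simps)
  also have "\<dots> = complex_of_real (normal_density 0 \<sigma> z)"
    by (simp add: normal_density_def power_divide)
  finally show "(LINT t|lborel. complex_of_real (exp (- (2 * pi\<^sup>2 * \<sigma>\<^sup>2 * t\<^sup>2))) * cis (- (2 * pi * (z * t))))
      = complex_of_real (normal_density 0 \<sigma> z)"
    unfolding I_def .
qed

text \<open>Lebesgue measure is the image of the product measure over the basis, so Fubini for
  finite products applies; this lifts the one-dimensional Gaussian facts to every dimension.\<close>

lemma lborel_product:
  fixes f :: "'a::euclidean_space \<Rightarrow> real \<Rightarrow> 'b::{real_normed_field,banach,second_countable_topology}"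
  assumes f: "\<And>b. b \<in> Basis \<Longrightarrow> integrable lborel (f b)"
  shows "integrable lborel (\<lambda>x. \<Prod>b\<in>Basis. f b (x \<bullet> b))"
    and "(LINT x|lborel. (\<Prod>b\<in>Basis. f b (x \<bullet> b))) = (\<Prod>b\<in>Basis. LINT t|lborel. f b t)"
proof -
  interpret product_sigma_finite "\<lambda>_::'a. lborel :: real measure" ..
  have [measurable]: "f b \<in> borel_measurable borel" if "b \<in> Basis" for b using f[OF that] by auto
  have m: "(\<lambda>x::'a. \<Prod>b\<in>Basis. f b (x \<bullet> b)) \<in> borel_measurable borel"
    by (intro borel_measurable_prod) measurable
  have m': "(\<lambda>g. \<Sum>b\<in>Basis. g b *\<^sub>R b) \<in> (\<Pi>\<^sub>M b\<in>Basis. lborel) \<rightarrow>\<^sub>M (borel :: 'a measure)"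
    by measurable
  have eq: "(\<Prod>b\<in>Basis. f b ((\<Sum>b'\<in>Basis. g b' *\<^sub>R b') \<bullet> b)) = (\<Prod>b\<in>Basis. f b (g b))" for g :: "'a \<Rightarrow> real"
    by (intro prod.cong) (auto simp: inner_sum_left_Basis)
  show "integrable lborel (\<lambda>x. \<Prod>b\<in>Basis. f b (x \<bullet> b))"
    unfolding lborel_eq[where 'a='a] by (subst integrable_distr_eq[OF m' m]) (auto simp: eq intro: product_integrable_prod f)
  show "(LINT x|lborel. (\<Prod>b\<in>Basis. f b (x \<bullet> b))) = (\<Prod>b\<in>Basis. LINT t|lborel. f b t)"
    unfolding lborel_eq[where 'a='a] by (subst integral_distr[OF m' m]) (auto simp: eq intro: product_integral_prod f)
qed

definition gauss :: "real \<Rightarrow> 'a::euclidean_space \<Rightarrow> real" where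
  "gauss \<sigma> z = (\<Prod>b\<in>Basis. normal_density 0 \<sigma> (z \<bullet> b))"

lemma gauss_measurable [measurable]: "gauss \<sigma> \<in> borel_measurable borel"
  unfolding gauss_def[abs_def] by measurable

lemma gauss_nonneg [simp]: "0 \<le> gauss \<sigma> z"
  by (simp add: gauss_def prod_nonneg)

lemma integrable_gauss: "0 < \<sigma> \<Longrightarrow> integrable lborel (gauss \<sigma> :: 'a::euclidean_space \<Rightarrow> real)"
  and integral_gauss: "0 < \<sigma> \<Longrightarrow> (LINT z|lborel. gauss \<sigma> (z :: 'a)) = 1"
  using lborel_product[where f="\<lambda>_::'a. normal_density 0 \<sigma>"]
  by (simp_all add: gauss_def[abs_def])

lemma gauss_minus: "gauss \<sigma> (- z) = gauss \<sigma> z"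
  by (simp add: gauss_def normal_density_def)

lemma gauss_scale:
  assumes "0 < \<sigma>"
  shows "\<sigma> ^ DIM('a) * gauss \<sigma> (\<sigma> *\<^sub>R z :: 'a::euclidean_space) = gauss 1 z"
proof -
  have "\<sigma> * normal_density 0 \<sigma> (\<sigma> * t) = normal_density 0 1 t" for t
    using assms by (simp add: normal_density_def real_sqrt_mult power_mult_distrib)
  then have "(\<Prod>b\<in>Basis. \<sigma> * normal_density 0 \<sigma> (\<sigma> * (z \<bullet> b))) = gauss 1 z"
    by (simp add: gauss_def)
  then show ?thesis by (simp add: gauss_def prod.distrib)
qed

lemma ft_gaussian:
  fixes z :: "'a::euclidean_space"
  assumes s: "0 < \<sigma>"
  shows "integrable lborel (\<lambda>\<xi>::'a. complex_of_real (exp (- (2 * pi\<^sup>2 * \<sigma>\<^sup>2 * (norm \<xi>)\<^sup>2))))"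
    and "ft (\<lambda>\<xi>. complex_of_real (exp (- (2 * pi\<^sup>2 * \<sigma>\<^sup>2 * (norm \<xi>)\<^sup>2)))) z = complex_of_real (gauss \<sigma> z)"
proof -
  have e: "(\<Prod>b\<in>Basis. complex_of_real (exp (- (2 * pi\<^sup>2 * \<sigma>\<^sup>2 * (\<xi> \<bullet> b)\<^sup>2))) * cis (- (2 * pi * (z \<bullet> b * (\<xi> \<bullet> b)))))
    = cis (- (2 * pi * (\<xi> \<bullet> z))) * complex_of_real (exp (- (2 * pi\<^sup>2 * \<sigma>\<^sup>2 * (norm \<xi>)\<^sup>2)))" for \<xi> z :: 'a
  proof -
    have "(\<Prod>b\<in>Basis. exp (- (2 * pi\<^sup>2 * \<sigma>\<^sup>2 * (\<xi> \<bullet> b)\<^sup>2))) = exp (- (2 * pi\<^sup>2 * \<sigma>\<^sup>2 * (norm \<xi>)\<^sup>2))"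
      unfolding power2_norm_eq_inner euclidean_inner[of \<xi> \<xi>]
      by (simp add: exp_sum[symmetric] sum_distrib_left sum_negf power2_eq_square)
    moreover have "(\<Prod>b\<in>Basis. cis (- (2 * pi * (z \<bullet> b * (\<xi> \<bullet> b))))) = cis (- (2 * pi * (\<xi> \<bullet> z)))"
      unfolding euclidean_inner[of \<xi> z]
      by (simp add: cis_conv_exp exp_sum[symmetric] sum_distrib_left sum_negf mult.commute)
    ultimately show ?thesis by (simp add: prod.distrib flip: of_real_prod)
  qed
  have "integrable lborel (\<lambda>\<xi>::'a. cis (- (2 * pi * (\<xi> \<bullet> 0))) * complex_of_real (exp (- (2 * pi\<^sup>2 * \<sigma>\<^sup>2 * (norm \<xi>)\<^sup>2))))"
    unfolding e[symmetric] by (rule lborel_product) (rule integral_normal_exp_cis(1)[OF s])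
  then show "integrable lborel (\<lambda>\<xi>::'a. complex_of_real (exp (- (2 * pi\<^sup>2 * \<sigma>\<^sup>2 * (norm \<xi>)\<^sup>2))))" by simp
  show "ft (\<lambda>\<xi>. complex_of_real (exp (- (2 * pi\<^sup>2 * \<sigma>\<^sup>2 * (norm \<xi>)\<^sup>2)))) z = complex_of_real (gauss \<sigma> z)"
    unfolding ft_def e[symmetric] gauss_def
    by (subst lborel_product(2)) (simp_all add: integral_normal_exp_cis[OF s])
qed

lemma ft_modulate: "ft (\<lambda>x. cis (2 * pi * (x \<bullet> y)) * f x) \<xi> = ft f (\<xi> - y)"
proof -
  have "cis (- (2 * pi * (x \<bullet> \<xi>))) * (cis (2 * pi * (x \<bullet> y)) * f x) = cis (- (2 * pi * (x \<bullet> (\<xi> - y)))) * f x" for x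
    by (simp only: mult.assoc[symmetric] cis_mult) (simp add: inner_diff_right algebra_simps)
  then show ?thesis unfolding ft_def by (simp only:)
qed

text \<open>Plancherel with a Gaussian damping factor. The damping makes the integrands integrable,
  so the multiplication formula may be applied to \<open>e \<xi> * cnj (ft f \<xi>)\<close>, whose
  transform is the conjugate of a Gaussian convolution of \<open>f\<close>.\<close>

lemma ft_gaussian_energy:
  fixes f :: "'a::euclidean_space \<Rightarrow> complex"
  assumes f: "integrable lborel f" and s: "0 < \<sigma>"
  shows "complex_of_real (LINT \<xi>|lborel. exp (- (2 * pi\<^sup>2 * \<sigma>\<^sup>2 * (norm \<xi>)\<^sup>2)) * (cmod (ft f \<xi>))\<^sup>2)
    = (LINT x|lborel. f x * cnj (LINT y|lborel. gauss \<sigma> (x - y) * f y))"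
    and "integrable lborel (\<lambda>\<xi>. exp (- (2 * pi\<^sup>2 * \<sigma>\<^sup>2 * (norm \<xi>)\<^sup>2)) * (cmod (ft f \<xi>))\<^sup>2)"
proof -
  have [measurable]: "f \<in> borel_measurable borel" using f by auto
  define e where "e \<xi> = complex_of_real (exp (- (2 * pi\<^sup>2 * \<sigma>\<^sup>2 * (norm \<xi>)\<^sup>2)))" for \<xi> :: 'a
  define B where "B = (LINT x|lborel. cmod (f x))"
  have B0: "0 \<le> B" by (simp add: B_def)
  have e: "integrable lborel e" and fte: "ft e z = complex_of_real (gauss \<sigma> z)" for z
    unfolding e_def using ft_gaussian[OF s] by auto
  have [measurable]: "e \<in> borel_measurable borel" using e by auto
  have eg: "integrable lborel (\<lambda>\<xi>. e \<xi> * cnj (ft f \<xi>))"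
  proof (rule Bochner_Integration.integrable_bound[of _ "\<lambda>\<xi>. e \<xi> * B"])
    show "AE \<xi> in lborel. norm (e \<xi> * cnj (ft f \<xi>)) \<le> norm (e \<xi> * complex_of_real B)"
      using norm_ft_le[of f] B0 by (auto simp: norm_mult B_def intro!: mult_left_mono)
  qed (use e in auto)
  have 1: "ft (\<lambda>\<xi>. e \<xi> * cnj (ft f \<xi>)) x = cnj (LINT y|lborel. gauss \<sigma> (x - y) * f y)" for x
  proof -
    have i: "integrable lborel (\<lambda>\<xi>. cis (2 * pi * (\<xi> \<bullet> x)) * e \<xi>)"
      by (rule integrable_cis_mult[OF e]) measurable
    have ce: "cnj (e \<xi>) = e \<xi>" for \<xi> by (simp add: e_def)
    have "ft (\<lambda>\<xi>. e \<xi> * cnj (ft f \<xi>)) x = cnj (LINT \<xi>|lborel. ft f \<xi> * (cis (2 * pi * (\<xi> \<bullet> x)) * e \<xi>))"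
      unfolding ft_def[of "\<lambda>\<xi>. e \<xi> * cnj (ft f \<xi>)"] Bochner_Integration.integral_cnj[symmetric]
      by (simp add: ce cis_cnj mult_ac)
    also have "(LINT \<xi>|lborel. ft f \<xi> * (cis (2 * pi * (\<xi> \<bullet> x)) * e \<xi>)) = (LINT y|lborel. f y * gauss \<sigma> (y - x))"
      by (subst ft_multiplication_formula[OF f i]) (simp add: ft_modulate fte)
    also have "\<dots> = (LINT y|lborel. gauss \<sigma> (x - y) * f y)"
      using gauss_minus[of \<sigma> "x - _"] by (simp add: mult.commute)
    finally show ?thesis .
  qed
  have 2: "ft f \<xi> * (e \<xi> * cnj (ft f \<xi>)) = complex_of_real (exp (- (2 * pi\<^sup>2 * \<sigma>\<^sup>2 * (norm \<xi>)\<^sup>2)) * (cmod (ft f \<xi>))\<^sup>2)" for \<xi>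
    by (simp add: e_def mult_ac flip: complex_norm_square)
  have "integrable lborel (\<lambda>\<xi>. ft f \<xi> * (e \<xi> * cnj (ft f \<xi>)))"
  proof (rule Bochner_Integration.integrable_bound[of _ "\<lambda>\<xi>. B * (e \<xi> * cnj (ft f \<xi>))"])
    show "AE \<xi> in lborel. norm (ft f \<xi> * (e \<xi> * cnj (ft f \<xi>))) \<le> norm (complex_of_real B * (e \<xi> * cnj (ft f \<xi>)))"
      using norm_ft_le[of f] B0 by (auto simp: norm_mult B_def intro!: mult_right_mono)
  qed (use eg in auto)
  then show "integrable lborel (\<lambda>\<xi>. exp (- (2 * pi\<^sup>2 * \<sigma>\<^sup>2 * (norm \<xi>)\<^sup>2)) * (cmod (ft f \<xi>))\<^sup>2)"
    unfolding 2 complex_of_real_integrable_eq .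
  show "complex_of_real (LINT \<xi>|lborel. exp (- (2 * pi\<^sup>2 * \<sigma>\<^sup>2 * (norm \<xi>)\<^sup>2)) * (cmod (ft f \<xi>))\<^sup>2)
    = (LINT x|lborel. f x * cnj (LINT y|lborel. gauss \<sigma> (x - y) * f y))"
    unfolding integral_complex_of_real[symmetric] 2[symmetric]
    by (subst ft_multiplication_formula[OF f eg]) (simp add: 1)
qed

lemma norm_integral_le:
  fixes f :: "'b \<Rightarrow> 'c::{banach, second_countable_topology}"
  assumes g: "integrable M g" and le: "\<And>x. norm (f x) \<le> g x"
  shows "norm (integral\<^sup>L M f) \<le> integral\<^sup>L M g"
proof (cases "integrable M f")
  case True
  have "norm (integral\<^sup>L M f) \<le> (LINT x|M. norm (f x))" by (rule integral_norm_bound)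
  also have "\<dots> \<le> integral\<^sup>L M g" using True g le by (intro integral_mono) auto
  finally show ?thesis .
next
  case False
  have "0 \<le> g x" for x using norm_ge_zero[of "f x"] le[of x] by linarith
  then have "0 \<le> integral\<^sup>L M g" by simp
  with False show ?thesis by (simp add: not_integrable_integral_eq)
qed

text \<open>Cauchy-Schwarz for the measure with density |c|. Stating it in \<open>ennreal\<close>
  lets it be used before integrability is known: an infinite second factor makes the claim trivial
  unless the integral of |c| is 0.\<close>

lemma norm_integral_square_le:
  fixes c f :: "'b \<Rightarrow> complex"
  assumes c: "integrable M c" and [measurable]: "f \<in> borel_measurable M"
  shows "ennreal ((cmod (LINT \<omega>|M. c \<omega> * f \<omega>))\<^sup>2)
    \<le> ennreal (LINT \<omega>|M. cmod (c \<omega>)) * (\<integral>\<^sup>+\<omega>. ennreal (cmod (c \<omega>) * (cmod (f \<omega>))\<^sup>2) \<partial>M)"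
    and "(\<integral>\<^sup>+\<omega>. ennreal (cmod (c \<omega>) * (cmod (f \<omega>))\<^sup>2) \<partial>M) < \<infinity> \<Longrightarrow> integrable M (\<lambda>\<omega>. c \<omega> * f \<omega>)"
proof -
  have [measurable]: "c \<in> borel_measurable M" using c by auto
  define A where "A = (LINT \<omega>|M. cmod (c \<omega>))"
  have A0: "0 \<le> A" by (simp add: A_def)
  have fin: "integrable M (\<lambda>\<omega>. c \<omega> * f \<omega>) \<and> ennreal ((cmod (LINT \<omega>|M. c \<omega> * f \<omega>))\<^sup>2)
      \<le> ennreal A * (\<integral>\<^sup>+\<omega>. ennreal (cmod (c \<omega>) * (cmod (f \<omega>))\<^sup>2) \<partial>M)"
    if "(\<integral>\<^sup>+\<omega>. ennreal (cmod (c \<omega>) * (cmod (f \<omega>))\<^sup>2) \<partial>M) < \<infinity>"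
  proof -
    have i2: "integrable M (\<lambda>\<omega>. cmod (c \<omega>) * (cmod (f \<omega>))\<^sup>2)"
      using that by (simp add: integrable_iff_bounded)
    define B where "B = (LINT \<omega>|M. cmod (c \<omega>) * (cmod (f \<omega>))\<^sup>2)"
    have B: "(\<integral>\<^sup>+\<omega>. ennreal (cmod (c \<omega>) * (cmod (f \<omega>))\<^sup>2) \<partial>M) = ennreal B"
      using i2 by (simp add: B_def nn_integral_eq_integral)
    have B0: "0 \<le> B" by (simp add: B_def)
    have p: "2 * (cmod (c \<omega>) * cmod (f \<omega>)) \<le> t * cmod (c \<omega>) + cmod (c \<omega>) * (cmod (f \<omega>))\<^sup>2 / t" if t: "0 < t" for t \<omega>
    proof -
      have "0 \<le> (sqrt t - cmod (f \<omega>) / sqrt t)\<^sup>2" by simp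
      also have "\<dots> = t + (cmod (f \<omega>))\<^sup>2 / t - 2 * cmod (f \<omega>)"
        using t by (simp add: power2_diff power_divide)
      finally have "2 * cmod (f \<omega>) \<le> t + (cmod (f \<omega>))\<^sup>2 / t" by simp
      from mult_left_mono[OF this, of "cmod (c \<omega>)"] show ?thesis by (simp add: algebra_simps)
    qed
    have i: "integrable M (\<lambda>\<omega>. cmod (c \<omega>) * cmod (f \<omega>))"
    proof (rule Bochner_Integration.integrable_bound[of _ "\<lambda>\<omega>. cmod (c \<omega>) + cmod (c \<omega>) * (cmod (f \<omega>))\<^sup>2"])
      have "cmod (c \<omega>) * cmod (f \<omega>) \<le> cmod (c \<omega>) + cmod (c \<omega>) * (cmod (f \<omega>))\<^sup>2" for \<omega>
      proof -
        have "0 \<le> cmod (c \<omega>) * cmod (f \<omega>)" by simp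
        moreover have "2 * (cmod (c \<omega>) * cmod (f \<omega>)) \<le> cmod (c \<omega>) + cmod (c \<omega>) * (cmod (f \<omega>))\<^sup>2"
          using p[of 1 \<omega>] by simp
        ultimately show ?thesis by linarith
      qed
      then show "AE \<omega> in M. norm (cmod (c \<omega>) * cmod (f \<omega>)) \<le> norm (cmod (c \<omega>) + cmod (c \<omega>) * (cmod (f \<omega>))\<^sup>2)"
        by (auto simp: abs_of_nonneg)
    qed (use c i2 in auto)
    have S: "(LINT \<omega>|M. cmod (c \<omega>) * cmod (f \<omega>)) \<le> sqrt A * sqrt B"
    proof (rule le_mult_of_weighted_le)
      fix t :: real assume t: "0 < t"
      have "2 * (LINT \<omega>|M. cmod (c \<omega>) * cmod (f \<omega>)) = (LINT \<omega>|M. 2 * (cmod (c \<omega>) * cmod (f \<omega>)))" by simp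
      also have "\<dots> \<le> (LINT \<omega>|M. t * cmod (c \<omega>) + cmod (c \<omega>) * (cmod (f \<omega>))\<^sup>2 / t)"
        using i i2 c by (intro integral_mono p t) auto
      also have "\<dots> = t * A + B / t" using i2 c by (simp add: A_def B_def)
      finally show "2 * (LINT \<omega>|M. cmod (c \<omega>) * cmod (f \<omega>)) \<le> t * (sqrt A)\<^sup>2 + (sqrt B)\<^sup>2 / t"
        using A0 B0 by simp
    qed (use A0 B0 in auto)
    have "cmod (LINT \<omega>|M. c \<omega> * f \<omega>) \<le> (LINT \<omega>|M. cmod (c \<omega> * f \<omega>))" by (rule integral_norm_bound)
    with S have "cmod (LINT \<omega>|M. c \<omega> * f \<omega>) \<le> sqrt A * sqrt B" by (simp add: norm_mult)
    then have "(cmod (LINT \<omega>|M. c \<omega> * f \<omega>))\<^sup>2 \<le> (sqrt A * sqrt B)\<^sup>2" by (intro power_mono) auto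
    also have "\<dots> = A * B" using A0 B0 by (simp add: power_mult_distrib)
    finally have "ennreal ((cmod (LINT \<omega>|M. c \<omega> * f \<omega>))\<^sup>2) \<le> ennreal A * ennreal B"
      using A0 B0 by (simp add: ennreal_leI flip: ennreal_mult)
    moreover have "integrable M (\<lambda>\<omega>. c \<omega> * f \<omega>)"
      using i by (subst integrable_norm_iff[symmetric]) (auto simp: norm_mult)
    ultimately show ?thesis by (simp add: B)
  qed
  then show "(\<integral>\<^sup>+\<omega>. ennreal (cmod (c \<omega>) * (cmod (f \<omega>))\<^sup>2) \<partial>M) < \<infinity> \<Longrightarrow> integrable M (\<lambda>\<omega>. c \<omega> * f \<omega>)"
    by blast
  show "ennreal ((cmod (LINT \<omega>|M. c \<omega> * f \<omega>))\<^sup>2)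
    \<le> ennreal (LINT \<omega>|M. cmod (c \<omega>)) * (\<integral>\<^sup>+\<omega>. ennreal (cmod (c \<omega>) * (cmod (f \<omega>))\<^sup>2) \<partial>M)"
  proof (cases "(\<integral>\<^sup>+\<omega>. ennreal (cmod (c \<omega>) * (cmod (f \<omega>))\<^sup>2) \<partial>M) < \<infinity>")
    case True
    with fin show ?thesis by (simp add: A_def)
  next
    case False
    then have top: "(\<integral>\<^sup>+\<omega>. ennreal (cmod (c \<omega>) * (cmod (f \<omega>))\<^sup>2) \<partial>M) = \<infinity>"
      by (simp add: less_top[symmetric])
    show ?thesis
    \<comment> \<open>In \<open>ennreal\<close> 0 times infinity is 0, so for A = 0 the left side
      must be shown to vanish.\<close>
    proof (cases "A = 0")
      case True
      then have "AE \<omega> in M. cmod (c \<omega>) = 0"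
        using integral_nonneg_eq_0_iff_AE[of M "\<lambda>\<omega>. cmod (c \<omega>)"] c by (simp add: A_def)
      then have "(LINT \<omega>|M. c \<omega> * f \<omega>) = (LINT \<omega>|M. 0)"
        by (intro integral_cong_AE) auto
      then show ?thesis by simp
    next
      case False
      with A0 show ?thesis unfolding top A_def[symmetric] by (simp add: ennreal_mult_top)
    qed
  qed
qed

lemma nn_integral_lborel_translate:
  fixes f :: "'a::euclidean_space \<Rightarrow> ennreal"
  assumes [measurable]: "f \<in> borel_measurable borel"
  shows "(\<integral>\<^sup>+x. f (x + c) \<partial>lborel) = (\<integral>\<^sup>+x. f x \<partial>lborel)"
proof -
  have "(\<integral>\<^sup>+x. f x \<partial>lborel) = (\<integral>\<^sup>+x. f x \<partial>distr lborel borel ((+) c))"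
    by (simp add: lborel_distr_plus)
  also have "\<dots> = (\<integral>\<^sup>+x. f (c + x) \<partial>lborel)"
    by (rule nn_integral_distr) auto
  finally show ?thesis by (simp add: add.commute)
qed

text \<open>Young's inequality for superpositions of translates by \<open>z \<omega>\<close> with
  weight \<open>c \<omega>\<close>. This form covers both convolution with a Gaussian on the whole
  space and convolution along a single line, where the kernel is a singular measure.\<close>

lemma
  fixes c :: "'b::euclidean_space \<Rightarrow> complex" and z :: "'b \<Rightarrow> 'a::euclidean_space"
  assumes c: "integrable lborel c" and [measurable]: "z \<in> borel_measurable borel" and f: "f \<in> L2_borel"
  shows L2_conv: "(\<lambda>x. LINT \<omega>|lborel. c \<omega> * f (x + z \<omega>)) \<in> L2_borel"
    and L2_norm_conv: "L2_norm (\<lambda>x. LINT \<omega>|lborel. c \<omega> * f (x + z \<omega>)) \<le> (LINT \<omega>|lborel. cmod (c \<omega>)) * L2_norm f"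
    and AE_integrable_conv: "AE x in lborel. integrable lborel (\<lambda>\<omega>. c \<omega> * f (x + z \<omega>))"
proof -
  have [measurable]: "c \<in> borel_measurable borel" "f \<in> borel_measurable borel" using c f by auto
  define A where "A = (LINT \<omega>|lborel. cmod (c \<omega>))"
  have A0: "0 \<le> A" by (simp add: A_def)
  have nnA: "(\<integral>\<^sup>+\<omega>. ennreal (cmod (c \<omega>)) \<partial>lborel) = ennreal A"
    using c by (simp add: A_def nn_integral_eq_integral)
  have "(\<integral>\<^sup>+x. (\<integral>\<^sup>+\<omega>. ennreal (cmod (c \<omega>) * (cmod (f (x + z \<omega>)))\<^sup>2) \<partial>lborel) \<partial>lborel)
      = (\<integral>\<^sup>+\<omega>. (\<integral>\<^sup>+x. ennreal (cmod (c \<omega>) * (cmod (f (x + z \<omega>)))\<^sup>2) \<partial>lborel) \<partial>lborel)"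
    by (rule lborel_pair.Fubini'[symmetric]) measurable
  also have "\<dots> = (\<integral>\<^sup>+\<omega>. ennreal (cmod (c \<omega>)) * (\<integral>\<^sup>+x. ennreal ((cmod (f (x + z \<omega>)))\<^sup>2) \<partial>lborel) \<partial>lborel)"
    by (simp add: ennreal_mult nn_integral_cmult)
  also have "\<dots> = (\<integral>\<^sup>+\<omega>. ennreal (cmod (c \<omega>)) * ennreal ((L2_norm f)\<^sup>2) \<partial>lborel)"
    using nn_integral_lborel_translate[of "\<lambda>x. ennreal ((cmod (f x))\<^sup>2)"] nn_integral_L2[OF f] by simp
  also have "\<dots> = ennreal (A * (L2_norm f)\<^sup>2)"
    by (simp add: nn_integral_multc nnA ennreal_mult A0)
  finally have eq: "(\<integral>\<^sup>+x. (\<integral>\<^sup>+\<omega>. ennreal (cmod (c \<omega>) * (cmod (f (x + z \<omega>)))\<^sup>2) \<partial>lborel) \<partial>lborel)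
     = ennreal (A * (L2_norm f)\<^sup>2)" .
  have "AE x in lborel. (\<integral>\<^sup>+\<omega>. ennreal (cmod (c \<omega>) * (cmod (f (x + z \<omega>)))\<^sup>2) \<partial>lborel) \<noteq> \<infinity>"
    by (rule nn_integral_PInf_AE) (simp_all add: eq)
  then show "AE x in lborel. integrable lborel (\<lambda>\<omega>. c \<omega> * f (x + z \<omega>))"
    by eventually_elim (rule norm_integral_square_le(2)[OF c], simp_all add: less_top[symmetric])
  have "(\<integral>\<^sup>+x. ennreal ((cmod (LINT \<omega>|lborel. c \<omega> * f (x + z \<omega>)))\<^sup>2) \<partial>lborel)
     \<le> (\<integral>\<^sup>+x. ennreal A * (\<integral>\<^sup>+\<omega>. ennreal (cmod (c \<omega>) * (cmod (f (x + z \<omega>)))\<^sup>2) \<partial>lborel) \<partial>lborel)"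
    unfolding A_def by (intro nn_integral_mono norm_integral_square_le(1)[OF c]) measurable
  also have "\<dots> = ennreal ((A * L2_norm f)\<^sup>2)"
  proof -
    have "A * (A * (L2_norm f)\<^sup>2) = (A * L2_norm f)\<^sup>2" by (simp add: power2_eq_square)
    then show ?thesis
      by (subst nn_integral_cmult) (measurable, simp add: eq A0 flip: ennreal_mult)
  qed
  finally have le: "(\<integral>\<^sup>+x. ennreal ((cmod (LINT \<omega>|lborel. c \<omega> * f (x + z \<omega>)))\<^sup>2) \<partial>lborel) \<le> ennreal ((A * L2_norm f)\<^sup>2)" .
  have m: "(\<lambda>x. LINT \<omega>|lborel. c \<omega> * f (x + z \<omega>)) \<in> borel_measurable borel" by measurable
  show "(\<lambda>x. LINT \<omega>|lborel. c \<omega> * f (x + z \<omega>)) \<in> L2_borel"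
    "L2_norm (\<lambda>x. LINT \<omega>|lborel. c \<omega> * f (x + z \<omega>)) \<le> (LINT \<omega>|lborel. cmod (c \<omega>)) * L2_norm f"
    using L2_norm_le_iff_nn[OF m _ le] A0 by (simp_all add: A_def)
qed

lemma lborel_integral_affine:
  fixes g :: "'a::euclidean_space \<Rightarrow> complex"
  assumes [measurable]: "g \<in> borel_measurable borel" and "c \<noteq> 0"
  shows "(LINT y|lborel. g y) = (LINT z|lborel. of_real (\<bar>c\<bar> ^ DIM('a)) * g (t + c *\<^sub>R z))"
  by (subst lborel_affine[OF \<open>c \<noteq> 0\<close>, of t])
     (simp add: integral_density integral_distr scaleR_conv_of_real)

text \<open>Moving \<sigma> from the kernel into the argument gives a superposition of translates
  with a fixed kernel, ready for \<open>L2_norm_conv\<close> and for dominated convergence as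
  \<sigma> tends to 0.\<close>

lemma gauss_conv_rescale:
  fixes f :: "'a::euclidean_space \<Rightarrow> complex"
  assumes [measurable]: "f \<in> borel_measurable borel" and s: "0 < \<sigma>"
  shows "(LINT y|lborel. gauss \<sigma> (x - y) * f y) = (LINT z|lborel. gauss 1 z * f (x - \<sigma> *\<^sub>R z))"
proof -
  have "(LINT y|lborel. gauss \<sigma> (x - y) * f y)
      = (LINT z|lborel. of_real (\<bar>- \<sigma>\<bar> ^ DIM('a)) * (gauss \<sigma> (x - (x + (- \<sigma>) *\<^sub>R z)) * f (x + (- \<sigma>) *\<^sub>R z)))"
    by (rule lborel_integral_affine) (use s in auto)
  also have "\<dots> = (LINT z|lborel. gauss 1 z * f (x - \<sigma> *\<^sub>R z))"
    using s by (simp add: gauss_scale[symmetric] mult.assoc)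
  finally show ?thesis .
qed

definition energy :: "real \<Rightarrow> ('a::euclidean_space \<Rightarrow> complex) \<Rightarrow> real" where
  "energy \<sigma> f = (LINT \<xi>|lborel. exp (- (2 * pi\<^sup>2 * \<sigma>\<^sup>2 * (norm \<xi>)\<^sup>2)) * (cmod (ft f \<xi>))\<^sup>2)"

text \<open>Cauchy-Schwarz for the pairing of \<open>f\<close> with its Gaussian convolution, whose
  norm is no larger since the kernel has mass 1.\<close>

lemma energy_le:
  assumes f: "f \<in> L2_borel" "integrable lborel f" and s: "0 < \<sigma>"
  shows "energy \<sigma> f \<le> (L2_norm f)\<^sup>2"
proof -
  have [measurable]: "f \<in> borel_measurable borel" using f by auto
  define g where "g x = (LINT z|lborel. complex_of_real (gauss 1 z) * f (x + (- \<sigma>) *\<^sub>R z))" for x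
  have c: "integrable lborel (\<lambda>z::'a. complex_of_real (gauss 1 z))"
    unfolding complex_of_real_integrable_eq by (rule integrable_gauss) simp
  have g: "g \<in> L2_borel" "L2_norm g \<le> L2_norm f"
    unfolding g_def[abs_def] using L2_conv[OF c _ f(1), of "\<lambda>z. (- \<sigma>) *\<^sub>R z"] L2_norm_conv[OF c _ f(1), of "\<lambda>z. (- \<sigma>) *\<^sub>R z"]
    by (simp_all add: integral_gauss)
  have "energy \<sigma> f = cmod (complex_of_real (energy \<sigma> f))" by (simp add: energy_def)
  also have "complex_of_real (energy \<sigma> f) = (LINT x|lborel. f x * cnj (g x))"
    unfolding energy_def ft_gaussian_energy(1)[OF f(2) s]
    by (subst gauss_conv_rescale) (use s in \<open>auto simp: g_def\<close>)
  also have "cmod \<dots> \<le> L2_norm f * L2_norm (\<lambda>x. cnj (g x))"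
    by (intro L2_norm_integral_mult_le f L2_borel_cnj g)
  also have "\<dots> \<le> (L2_norm f)\<^sup>2"
    using mult_left_mono[OF g(2), of "L2_norm f"] by (simp add: L2_norm_cnj power2_eq_square)
  finally show ?thesis .
qed

text \<open>For continuous \<open>f\<close> of bounded support the Gaussian convolutions converge
  pointwise and stay bounded by B, so the pairing in \<open>ft_gaussian_energy\<close> converges to
  the squared norm.\<close>

lemma energy_tendsto:
  fixes f :: "'a::euclidean_space \<Rightarrow> complex"
  assumes f: "continuous_on UNIV f" "\<And>x. f x \<noteq> 0 \<Longrightarrow> x \<in> cball 0 R" "\<And>x. cmod (f x) \<le> B"
  shows "f \<in> L2_borel" "integrable lborel f"
    and "(\<lambda>j. energy (1 / real (Suc j)) f) \<longlonglongrightarrow> (L2_norm f)\<^sup>2"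
proof -
  have [measurable]: "f \<in> borel_measurable borel" by (rule borel_measurable_continuous_onI[OF f(1)])
  show L2: "f \<in> L2_borel"
  proof (rule L2_borelI_bound[where g="\<lambda>x. B\<^sup>2 * indicator (cball 0 R) x"])
    show "(cmod (f x))\<^sup>2 \<le> B\<^sup>2 * indicator (cball 0 R) x" for x
      using power_mono[OF f(3)[of x], of 2] f(2)[of x] by (cases "f x = 0") auto
  qed (use integrable_indicator_cball in auto)
  show i: "integrable lborel f" by (rule integrable_of_L2_bounded_support[OF L2 f(2)])
  define \<sigma> where "\<sigma> j = 1 / real (Suc j)" for j
  have s: "0 < \<sigma> j" for j by (simp add: \<sigma>_def)
  have s0: "\<sigma> \<longlonglongrightarrow> 0" unfolding \<sigma>_def[abs_def] by (rule LIMSEQ_Suc[OF lim_1_over_n])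
  have B0: "0 \<le> B" using f(3)[of 0] norm_ge_zero order_trans by blast
  have c: "integrable lborel (\<lambda>z::'a. complex_of_real (gauss 1 z))"
    unfolding complex_of_real_integrable_eq by (rule integrable_gauss) simp
  have gb: "cmod (gauss 1 z * f y) \<le> gauss 1 z * B" for z y :: 'a
    using f(3) by (simp add: norm_mult mult_left_mono)
  have iB: "integrable lborel (\<lambda>z::'a. gauss 1 z * B)"
    by (intro integrable_mult_left integrable_gauss) simp
  have inner: "(\<lambda>j. LINT z|lborel. gauss 1 z * f (x - \<sigma> j *\<^sub>R z)) \<longlonglongrightarrow> (LINT z|lborel. gauss 1 (z::'a) * f x)" for x
  proof (rule integral_dominated_convergence[where w="\<lambda>z. gauss 1 z * B"])
    show "AE z in lborel. (\<lambda>j. gauss 1 z * f (x - \<sigma> j *\<^sub>R z)) \<longlonglongrightarrow> gauss 1 z * f x"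
    proof (intro AE_I2 tendsto_mult tendsto_const)
      fix z
      have "(\<lambda>j. x - \<sigma> j *\<^sub>R z) \<longlonglongrightarrow> x - 0 *\<^sub>R z" by (intro tendsto_intros s0)
      then show "(\<lambda>j. f (x - \<sigma> j *\<^sub>R z)) \<longlonglongrightarrow> f x"
        using f(1) by (intro continuous_on_tendsto_compose[OF f(1)]) auto
    qed
  qed (use gb iB in auto)
  have gx: "(LINT z|lborel. gauss 1 (z::'a) * f x) = f x" for x
  proof -
    have "(LINT z|lborel. complex_of_real (gauss 1 (z::'a)) * f x) = (LINT z|lborel. complex_of_real (gauss 1 (z::'a))) * f x"
      by (rule integral_mult_left_zero)
    then show ?thesis by (simp add: integral_gauss)
  qed
  have bd: "cmod (LINT z|lborel. gauss 1 z * f (x - \<sigma> j *\<^sub>R z)) \<le> B" for x j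
  proof -
    have "cmod (LINT z|lborel. gauss 1 z * f (x - \<sigma> j *\<^sub>R z)) \<le> (LINT z|lborel. gauss 1 (z::'a) * B)"
      by (rule norm_integral_le[OF iB gb])
    then show ?thesis by (simp add: integral_gauss)
  qed
  have "(\<lambda>j. LINT x|lborel. f x * cnj (LINT z|lborel. gauss 1 z * f (x - \<sigma> j *\<^sub>R z))) \<longlonglongrightarrow> (LINT x|lborel. f x * cnj (f x))"
  proof (rule integral_dominated_convergence[where w="\<lambda>x. cmod (f x) * B"])
    show "AE x in lborel. (\<lambda>j. f x * cnj (LINT z|lborel. gauss 1 z * f (x - \<sigma> j *\<^sub>R z))) \<longlonglongrightarrow> f x * cnj (f x)"
      by (intro AE_I2 tendsto_mult tendsto_const tendsto_cnj inner[unfolded gx])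
    show "AE x in lborel. norm (f x * cnj (LINT z|lborel. gauss 1 z * f (x - \<sigma> j *\<^sub>R z))) \<le> cmod (f x) * B" for j
      using bd by (auto simp: norm_mult intro!: mult_left_mono)
  qed (use i in auto)
  moreover have "(LINT x|lborel. f x * cnj (LINT z|lborel. gauss 1 z * f (x - \<sigma> j *\<^sub>R z))) = complex_of_real (energy (\<sigma> j) f)" for j
    unfolding energy_def ft_gaussian_energy(1)[OF i s] by (simp add: gauss_conv_rescale[OF _ s])
  moreover have "(LINT x|lborel. f x * cnj (f x)) = complex_of_real ((L2_norm f)\<^sup>2)"
    by (simp add: complex_norm_square[symmetric] L2_norm_def del: of_real_power)
  ultimately show "(\<lambda>j. energy (1 / real (Suc j)) f) \<longlonglongrightarrow> (L2_norm f)\<^sup>2"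
    unfolding \<sigma>_def[symmetric] by (simp only: tendsto_of_real_iff)
qed

lemma energy_LIMSEQ:
  fixes f :: "'a::euclidean_space \<Rightarrow> complex"
  assumes f: "integrable lborel f"
  shows "(\<lambda>j. ennreal (energy (1 / real (Suc j)) f)) \<longlonglongrightarrow> (\<integral>\<^sup>+\<xi>. ennreal ((cmod (ft f \<xi>))\<^sup>2) \<partial>lborel)"
proof -
  have [measurable]: "f \<in> borel_measurable borel" using f by auto
  define e where "e j \<xi> = exp (- (2 * pi\<^sup>2 * (1 / real (Suc j))\<^sup>2 * (norm \<xi>)\<^sup>2))" for j and \<xi> :: 'a
  have emono: "e i \<xi> \<le> e j \<xi>" if "i \<le> j" for i j \<xi>
  proof -
    have "(1 / real (Suc j))\<^sup>2 \<le> (1 / real (Suc i))\<^sup>2"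
      using that by (intro power_mono) (auto intro: divide_left_mono)
    then show ?thesis unfolding e_def by (auto intro!: mult_right_mono)
  qed
  have elim: "(\<lambda>j. e j \<xi>) \<longlonglongrightarrow> 1" for \<xi>
  proof -
    have "(\<lambda>j. e j \<xi>) \<longlonglongrightarrow> exp (- (2 * pi\<^sup>2 * 0\<^sup>2 * (norm \<xi>)\<^sup>2))"
      unfolding e_def by (intro tendsto_intros LIMSEQ_Suc[OF lim_1_over_n])
    then show ?thesis by simp
  qed
  have "(\<lambda>j. \<integral>\<^sup>+\<xi>. ennreal (e j \<xi> * (cmod (ft f \<xi>))\<^sup>2) \<partial>lborel) \<longlonglongrightarrow> (\<integral>\<^sup>+\<xi>. ennreal ((cmod (ft f \<xi>))\<^sup>2) \<partial>lborel)"
  proof (rule nn_integral_LIMSEQ)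
    show "incseq (\<lambda>j \<xi>. ennreal (e j \<xi> * (cmod (ft f \<xi>))\<^sup>2))"
      by (auto simp: incseq_def le_fun_def intro!: ennreal_leI mult_right_mono emono)
    show "(\<lambda>j. ennreal (e j \<xi> * (cmod (ft f \<xi>))\<^sup>2)) \<longlonglongrightarrow> ennreal ((cmod (ft f \<xi>))\<^sup>2)" for \<xi>
      using tendsto_mult_right[OF elim[of \<xi>], of "(cmod (ft f \<xi>))\<^sup>2"] by (intro tendsto_ennrealI) simp
  qed (simp add: e_def)
  moreover have "(\<integral>\<^sup>+\<xi>. ennreal (e j \<xi> * (cmod (ft f \<xi>))\<^sup>2) \<partial>lborel) = ennreal (energy (1 / real (Suc j)) f)" for j
    unfolding energy_def e_def by (rule nn_integral_eq_integral[OF ft_gaussian_energy(2)[OF f]]) auto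
  ultimately show ?thesis by simp
qed

lemma L2_ft:
  assumes f: "f \<in> L2_borel" "integrable lborel f"
  shows "ft f \<in> L2_borel" "L2_norm (ft f) \<le> L2_norm f"
proof -
  have "(\<integral>\<^sup>+\<xi>. ennreal ((cmod (ft f \<xi>))\<^sup>2) \<partial>lborel) \<le> ennreal ((L2_norm f)\<^sup>2)"
    by (rule LIMSEQ_le_const2[OF energy_LIMSEQ[OF f(2)]]) (auto intro!: ennreal_leI energy_le f)
  from L2_norm_le_iff_nn[OF _ _ this] show "ft f \<in> L2_borel" "L2_norm (ft f) \<le> L2_norm f"
    using f by auto
qed

lemma L2_norm_ft_continuous:
  assumes f: "continuous_on UNIV f" "\<And>x. f x \<noteq> 0 \<Longrightarrow> x \<in> cball 0 R" "\<And>x. cmod (f x) \<le> B"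
  shows "L2_norm (ft f) = L2_norm f"
proof -
  note f' = energy_tendsto[OF f]
  have "(\<integral>\<^sup>+\<xi>. ennreal ((cmod (ft f \<xi>))\<^sup>2) \<partial>lborel) = ennreal ((L2_norm f)\<^sup>2)"
    by (rule LIMSEQ_unique[OF energy_LIMSEQ[OF f'(2)] tendsto_ennrealI[OF f'(3)]])
  then have "ennreal ((L2_norm (ft f))\<^sup>2) = ennreal ((L2_norm f)\<^sup>2)"
    by (simp add: nn_integral_L2[OF L2_ft(1)[OF f'(1,2)]])
  then show ?thesis by simp
qed

text \<open>One inequality is \<open>L2_ft\<close>; the other holds for continuous functions of
  bounded support and survives approximation because of the first.\<close>

lemma L2_norm_ft:
  assumes f: "f \<in> L2_borel" "integrable lborel f"
  shows "L2_norm (ft f) = L2_norm f"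
proof (rule antisym[OF L2_ft(2)[OF f]], rule field_le_epsilon)
  fix e :: real assume "0 < e"
  then have e: "0 < e / 2" by simp
  from L2_dense_continuous[OF f(1) e] obtain g B R where
    g: "continuous_on UNIV g" "\<And>x. g x \<noteq> 0 \<Longrightarrow> x \<in> cball 0 R" "\<And>x. cmod (g x) \<le> B"
    and d: "L2_norm (\<lambda>x. g x - f x) < e / 2" by metis
  note g' = energy_tendsto(1,2)[OF g]
  have "L2_norm f \<le> L2_norm g + e / 2" using L2_norm_diff_abs[OF g'(1) f(1)] d by linarith
  also have "L2_norm g = L2_norm (ft g)" by (rule L2_norm_ft_continuous[OF g, symmetric])
  also have "\<dots> \<le> L2_norm (ft f) + L2_norm (\<lambda>\<xi>. ft g \<xi> - ft f \<xi>)"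
    using L2_norm_diff_abs[OF L2_ft(1)[OF g'] L2_ft(1)[OF f]] by linarith
  also have "(\<lambda>\<xi>. ft g \<xi> - ft f \<xi>) = ft (\<lambda>x. g x - f x)" using ft_diff[OF g'(2) f(2)] by auto
  also have "L2_norm (ft (\<lambda>x. g x - f x)) \<le> L2_norm (\<lambda>x. g x - f x)"
    using g' f by (intro L2_ft L2_borel_diff) auto
  finally show "L2_norm f \<le> L2_norm (ft f) + e" using d by linarith
qed

section \<open>The Fourier transform on L2: isometry, Parseval's identity, surjectivity\<close>

lemma L2_norm_zero [simp]: "L2_norm (\<lambda>_. 0) = 0"
  by (simp add: L2_norm_def)

lemma L2_norm_square: "complex_of_real ((L2_norm h)\<^sup>2) = (LINT x|lborel. h x * cnj (h x))"
  by (simp add: complex_norm_square[symmetric] L2_norm_def del: of_real_power)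

lemma ft_ball_trunc_limit_exists:
  assumes f: "f \<in> L2_borel"
  obtains g where "g \<in> L2_borel" "(\<lambda>k. L2_norm (\<lambda>\<xi>. ft (ball_trunc k f) \<xi> - g \<xi>)) \<longlonglongrightarrow> 0"
proof (rule L2_complete)
  note tr = L2_borel_ball_trunc[OF f] integrable_ball_trunc[OF f]
  show "ft (ball_trunc k f) \<in> L2_borel" for k by (rule L2_ft[OF tr])
  fix e :: real assume "0 < e"
  then obtain N where N: "\<And>k. k \<ge> N \<Longrightarrow> L2_norm (\<lambda>x. ball_trunc k f x - f x) < e / 2"
    using LIMSEQ_D[OF L2_ball_trunc_tendsto[OF f], of "e / 2"] by auto
  have "L2_norm (\<lambda>\<xi>. ft (ball_trunc j f) \<xi> - ft (ball_trunc k f) \<xi>) < e" if "j \<ge> N" "k \<ge> N" for j k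
  proof -
    have "(\<lambda>\<xi>. ft (ball_trunc j f) \<xi> - ft (ball_trunc k f) \<xi>) = ft (\<lambda>x. ball_trunc j f x - ball_trunc k f x)"
      using ft_diff[OF tr(2) tr(2)] by auto
    then have "L2_norm (\<lambda>\<xi>. ft (ball_trunc j f) \<xi> - ft (ball_trunc k f) \<xi>) \<le> L2_norm (\<lambda>x. ball_trunc j f x - ball_trunc k f x)"
      using tr by (simp add: L2_ft L2_borel_diff)
    also have "\<dots> \<le> L2_norm (\<lambda>x. ball_trunc j f x - f x) + L2_norm (\<lambda>x. ball_trunc k f x - f x)"
      using L2_norm_triangle_diff[OF tr(1) f tr(1), of j k] L2_norm_commute[of f "ball_trunc k f"] by simp
    finally show ?thesis using N[OF that(1)] N[OF that(2)] by linarith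
  qed
  then show "\<exists>N. \<forall>j\<ge>N. \<forall>k\<ge>N. L2_norm (\<lambda>\<xi>. ft (ball_trunc j f) \<xi> - ft (ball_trunc k f) \<xi>) < e" by blast
qed (rule that)

text \<open>The recipe of \<open>fourier_L2\<close> with Borel representatives;
  \<open>fourier_L2_eq_FT\<close> identifies the two almost everywhere.\<close>

definition FT :: "('a::euclidean_space \<Rightarrow> complex) \<Rightarrow> 'a \<Rightarrow> complex" where
  "FT f = (SOME g. g \<in> L2_borel \<and> (\<lambda>k. L2_norm (\<lambda>\<xi>. ft (ball_trunc k f) \<xi> - g \<xi>)) \<longlonglongrightarrow> 0)"

lemma
  assumes "f \<in> L2_borel"
  shows L2_FT: "FT f \<in> L2_borel"
    and FT_limit: "(\<lambda>k. L2_norm (\<lambda>\<xi>. ft (ball_trunc k f) \<xi> - FT f \<xi>)) \<longlonglongrightarrow> 0"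
proof -
  have "\<exists>g. g \<in> L2_borel \<and> (\<lambda>k. L2_norm (\<lambda>\<xi>. ft (ball_trunc k f) \<xi> - g \<xi>)) \<longlonglongrightarrow> 0"
    using ft_ball_trunc_limit_exists[OF assms] by blast
  from someI_ex[OF this] show "FT f \<in> L2_borel"
    "(\<lambda>k. L2_norm (\<lambda>\<xi>. ft (ball_trunc k f) \<xi> - FT f \<xi>)) \<longlonglongrightarrow> 0"
    by (simp_all add: FT_def)
qed

lemma FT_eqI:
  assumes "f \<in> L2_borel" "g \<in> L2_borel" "(\<lambda>k. L2_norm (\<lambda>\<xi>. ft (ball_trunc k f) \<xi> - g \<xi>)) \<longlonglongrightarrow> 0"
  shows "AE \<xi> in lborel. FT f \<xi> = g \<xi>"
  by (rule L2_limit_unique[OF L2_ft(1)[OF L2_borel_ball_trunc[OF assms(1)] integrable_ball_trunc[OF assms(1)]]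
    L2_FT[OF assms(1)] assms(2) FT_limit[OF assms(1)] assms(3)])

lemma L2_norm_FT:
  assumes f: "f \<in> L2_borel"
  shows "L2_norm (FT f) = L2_norm f"
proof -
  note tr = L2_borel_ball_trunc[OF f] integrable_ball_trunc[OF f]
  have 1: "(\<lambda>k. L2_norm (ft (ball_trunc k f))) \<longlonglongrightarrow> L2_norm (FT f)"
    by (rule L2_norm_tendsto[OF L2_ft(1)[OF tr] L2_FT[OF f] FT_limit[OF f]])
  have 2: "(\<lambda>k. L2_norm (ball_trunc k f)) \<longlonglongrightarrow> L2_norm f"
    by (rule L2_norm_tendsto[OF tr(1) f L2_ball_trunc_tendsto[OF f]])
  show ?thesis
    using LIMSEQ_unique[OF 1] 2 by (simp add: L2_norm_ft[OF tr])
qed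

lemma FT_add_cmult:
  assumes f: "f \<in> L2_borel" and g: "g \<in> L2_borel"
  shows "AE \<xi> in lborel. FT (\<lambda>x. f x + c * g x) \<xi> = FT f \<xi> + c * FT g \<xi>"
proof (rule FT_eqI)
  note L = L2_borel_add L2_borel_cmult L2_borel_diff L2_ft(1) L2_FT L2_borel_ball_trunc integrable_ball_trunc f g
  show "(\<lambda>x. f x + c * g x) \<in> L2_borel" "(\<lambda>\<xi>. FT f \<xi> + c * FT g \<xi>) \<in> L2_borel"
    by (auto intro!: L)
  define df where "df k \<xi> = ft (ball_trunc k f) \<xi> - FT f \<xi>" for k \<xi>
  define dg where "dg k \<xi> = ft (ball_trunc k g) \<xi> - FT g \<xi>" for k \<xi>
  have eq: "ft (ball_trunc k (\<lambda>x. f x + c * g x)) \<xi> - (FT f \<xi> + c * FT g \<xi>) = df k \<xi> + c * dg k \<xi>" for k \<xi>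
  proof -
    have "ball_trunc k (\<lambda>x. f x + c * g x) = (\<lambda>x. ball_trunc k f x + c * ball_trunc k g x)"
      by (auto simp: ball_trunc_def algebra_simps)
    then show ?thesis
      by (simp add: ft_add ft_cmult integrable_ball_trunc f g df_def dg_def algebra_simps)
  qed
  have dL: "df k \<in> L2_borel" "dg k \<in> L2_borel" for k
    unfolding df_def[abs_def] dg_def[abs_def] by (auto intro!: L)
  have "L2_norm (\<lambda>\<xi>. df k \<xi> + c * dg k \<xi>) \<le> L2_norm (df k) + cmod c * L2_norm (dg k)" for k
    using L2_norm_triangle[OF dL(1) L2_borel_cmult[OF dL(2)], of k c k] by (simp add: L2_norm_cmult)
  then have 1: "\<forall>\<^sub>F k in sequentially. norm (L2_norm (\<lambda>\<xi>. df k \<xi> + c * dg k \<xi>)) \<le> L2_norm (df k) + cmod c * L2_norm (dg k)"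
    by simp
  have "(\<lambda>k. L2_norm (df k) + cmod c * L2_norm (dg k)) \<longlonglongrightarrow> 0 + cmod c * 0"
    unfolding df_def dg_def by (intro tendsto_intros FT_limit f g)
  then have "(\<lambda>k. L2_norm (df k) + cmod c * L2_norm (dg k)) \<longlonglongrightarrow> 0" by simp
  from Lim_null_comparison[OF 1 this]
  show "(\<lambda>k. L2_norm (\<lambda>\<xi>. ft (ball_trunc k (\<lambda>x. f x + c * g x)) \<xi> - (FT f \<xi> + c * FT g \<xi>))) \<longlonglongrightarrow> 0"
    unfolding eq .
qed

lemma FT_diff:
  assumes "f \<in> L2_borel" "g \<in> L2_borel"
  shows "AE \<xi> in lborel. FT (\<lambda>x. f x - g x) \<xi> = FT f \<xi> - FT g \<xi>"
  using FT_add_cmult[OF assms, of "-1"] by simp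

lemma L2_norm_FT_diff:
  assumes "f \<in> L2_borel" "g \<in> L2_borel"
  shows "L2_norm (\<lambda>\<xi>. FT f \<xi> - FT g \<xi>) = L2_norm (\<lambda>x. f x - g x)"
proof -
  note [measurable] = L2_borel_measurable[OF L2_FT[OF assms(1)]] L2_borel_measurable[OF L2_FT[OF assms(2)]]
    L2_borel_measurable[OF L2_FT[OF L2_borel_diff[OF assms]]]
  have "L2_norm (\<lambda>\<xi>. FT f \<xi> - FT g \<xi>) = L2_norm (FT (\<lambda>x. f x - g x))"
    using FT_diff[OF assms] by (intro L2_norm_AE_cong) auto
  then show ?thesis by (simp add: L2_norm_FT L2_borel_diff assms)
qed

lemma FT_inj:
  assumes "AE \<xi> in lborel. FT f \<xi> = FT g \<xi>" and fg: "f \<in> L2_borel" "g \<in> L2_borel"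
  shows "AE x in lborel. f x = g x"
proof -
  note [measurable] = L2_borel_measurable[OF L2_FT[OF fg(1)]] L2_borel_measurable[OF L2_FT[OF fg(2)]]
  have "L2_norm (\<lambda>\<xi>. FT f \<xi> - FT g \<xi>) = L2_norm (\<lambda>_::'a. 0)"
    using assms(1) by (intro L2_norm_AE_cong) auto
  then have "L2_norm (\<lambda>x. f x - g x) = 0"
    using fg by (simp add: L2_norm_FT_diff)
  from L2_norm_eq_0[OF L2_borel_diff[OF fg] this] show ?thesis by simp
qed

lemma FT_eq_ft:
  assumes f: "f \<in> L2_borel" "integrable lborel f"
  shows "AE \<xi> in lborel. FT f \<xi> = ft f \<xi>"
proof (rule FT_eqI[OF f(1) L2_ft(1)[OF f]])
  note tr = L2_borel_ball_trunc[OF f(1)] integrable_ball_trunc[OF f(1)]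
  have "L2_norm (\<lambda>\<xi>. ft (ball_trunc k f) \<xi> - ft f \<xi>) \<le> L2_norm (\<lambda>x. ball_trunc k f x - f x)" for k
  proof -
    have "(\<lambda>\<xi>. ft (ball_trunc k f) \<xi> - ft f \<xi>) = ft (\<lambda>x. ball_trunc k f x - f x)"
      using ft_diff[OF tr(2) f(2)] by auto
    then show ?thesis using tr f by (simp add: L2_ft L2_borel_diff)
  qed
  then show "(\<lambda>k. L2_norm (\<lambda>\<xi>. ft (ball_trunc k f) \<xi> - ft f \<xi>)) \<longlonglongrightarrow> 0"
    by (intro Lim_null_comparison[OF _ L2_ball_trunc_tendsto[OF f(1)]]) auto
qed

lemma FT_multiplication_formula:
  assumes f: "f \<in> L2_borel" and g: "g \<in> L2_borel"
  shows "(LINT \<xi>|lborel. FT f \<xi> * g \<xi>) = (LINT x|lborel. f x * FT g x)"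
proof -
  note trf = L2_borel_ball_trunc[OF f] integrable_ball_trunc[OF f]
  note trg = L2_borel_ball_trunc[OF g] integrable_ball_trunc[OF g]
  have 1: "(LINT \<xi>|lborel. ft (ball_trunc k f) \<xi> * g \<xi>) = (LINT x|lborel. ball_trunc k f x * FT g x)" for k
  proof (rule LIMSEQ_unique)
    show "(\<lambda>j. LINT \<xi>|lborel. ft (ball_trunc k f) \<xi> * ball_trunc j g \<xi>) \<longlonglongrightarrow> (LINT \<xi>|lborel. ft (ball_trunc k f) \<xi> * g \<xi>)"
      using L2_integral_mult_tendsto[OF trg(1) g L2_ft(1)[OF trf] L2_ball_trunc_tendsto[OF g], of k]
      by (simp add: mult.commute)
    show "(\<lambda>j. LINT \<xi>|lborel. ft (ball_trunc k f) \<xi> * ball_trunc j g \<xi>) \<longlonglongrightarrow> (LINT x|lborel. ball_trunc k f x * FT g x)"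
      unfolding ft_multiplication_formula[OF trf(2) trg(2)]
      using L2_integral_mult_tendsto[OF L2_ft(1)[OF trg] L2_FT[OF g] trf(1) FT_limit[OF g], of k]
      by (simp add: mult.commute)
  qed
  show ?thesis
    using L2_integral_mult_tendsto[OF L2_ft(1)[OF trf] L2_FT[OF f] g FT_limit[OF f]]
      L2_integral_mult_tendsto[OF trf(1) f L2_FT[OF g] L2_ball_trunc_tendsto[OF f]]
    unfolding 1 by (rule LIMSEQ_unique)
qed

lemma L2_norm_add_cmult_square:
  assumes f: "f \<in> L2_borel" and g: "g \<in> L2_borel"
  shows "complex_of_real ((L2_norm (\<lambda>x. f x + c * g x))\<^sup>2) = complex_of_real ((L2_norm f)\<^sup>2) + complex_of_real ((cmod c * L2_norm g)\<^sup>2)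
    + cnj c * (LINT x|lborel. f x * cnj (g x)) + c * cnj (LINT x|lborel. f x * cnj (g x))"
proof -
  note sq = L2_norm_square
  note i = L2_integrable_mult[OF f L2_borel_cnj[OF f]] L2_integrable_mult[OF g L2_borel_cnj[OF g]]
    L2_integrable_mult[OF f L2_borel_cnj[OF g]] L2_integrable_mult[OF g L2_borel_cnj[OF f]]
  have fl: "cnj (LINT x|lborel. f x * cnj (g x)) = (LINT x|lborel. g x * cnj (f x))"
    by (subst Bochner_Integration.integral_cnj[symmetric]) (simp add: mult.commute)
  have "(LINT x|lborel. (f x + c * g x) * cnj (f x + c * g x)) = (LINT x|lborel. f x * cnj (f x) + (c * cnj c) * (g x * cnj (g x))
     + cnj c * (f x * cnj (g x)) + c * (g x * cnj (f x)))"
    by (intro Bochner_Integration.integral_cong) (auto simp: algebra_simps)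
  also have "\<dots> = (LINT x|lborel. f x * cnj (f x)) + (c * cnj c) * (LINT x|lborel. g x * cnj (g x))
     + cnj c * (LINT x|lborel. f x * cnj (g x)) + c * (LINT x|lborel. g x * cnj (f x))"
    using i by simp
  finally show ?thesis unfolding sq fl power_mult_distrib of_real_mult
    by (simp add: complex_norm_square[symmetric] sq)
qed

text \<open>Polarisation: the isometry applied to f + c g compares the cross terms, and c = 1 and c
  = i determine the real and the imaginary part.\<close>

lemma FT_Parseval:
  assumes f: "f \<in> L2_borel" and g: "g \<in> L2_borel"
  shows "(LINT \<xi>|lborel. FT f \<xi> * cnj (FT g \<xi>)) = (LINT x|lborel. f x * cnj (g x))"
proof -
  define I J where "I = (LINT \<xi>|lborel. FT f \<xi> * cnj (FT g \<xi>))" and "J = (LINT x|lborel. f x * cnj (g x))"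
  have *: "cnj c * I + c * cnj I = cnj c * J + c * cnj J" for c
  proof -
    note [measurable] = L2_borel_measurable[OF L2_FT[OF f]] L2_borel_measurable[OF L2_FT[OF g]]
      L2_borel_measurable[OF L2_FT[OF L2_borel_add[OF f L2_borel_cmult[OF g, of c]]]]
    have "L2_norm (\<lambda>\<xi>. FT f \<xi> + c * FT g \<xi>) = L2_norm (FT (\<lambda>x. f x + c * g x))"
      using FT_add_cmult[OF f g, of c] by (intro L2_norm_AE_cong) auto
    also have "\<dots> = L2_norm (\<lambda>x. f x + c * g x)" by (intro L2_norm_FT L2_borel_add L2_borel_cmult f g)
    finally have "complex_of_real ((L2_norm (\<lambda>\<xi>. FT f \<xi> + c * FT g \<xi>))\<^sup>2) = complex_of_real ((L2_norm (\<lambda>x. f x + c * g x))\<^sup>2)"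
      by simp
    then show ?thesis
      unfolding L2_norm_add_cmult_square[OF f g] L2_norm_add_cmult_square[OF L2_FT[OF f] L2_FT[OF g]]
      by (simp add: L2_norm_FT f g I_def J_def)
  qed
  from *[of 1] *[of \<i>] have "I = J" by (simp add: complex_eq_iff)
  then show ?thesis by (simp add: I_def J_def)
qed

text \<open>The candidate is the conjugate of the transform of the conjugate of \<open>g\<close>. It
  has the norm of \<open>g\<close>, and by the multiplication formula its transform pairs with
  \<open>g\<close> to the squared norm of \<open>g\<close>; expanding the squared norm of
  \<open>FT h\<close> minus \<open>g\<close> then gives 0.\<close>

lemma FT_surj:
  assumes g: "g \<in> L2_borel"
  obtains h where "h \<in> L2_borel" "AE \<xi> in lborel. FT h \<xi> = g \<xi>"
proof
  define gb where "gb x = cnj (g x)" for x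
  define h where "h x = cnj (FT gb x)" for x
  have gb: "gb \<in> L2_borel" unfolding gb_def[abs_def] by (rule L2_borel_cnj[OF g])
  show h: "h \<in> L2_borel" unfolding h_def[abs_def] by (intro L2_borel_cnj L2_FT gb)
  have n: "L2_norm h = L2_norm g"
    unfolding h_def[abs_def] L2_norm_cnj by (simp add: L2_norm_FT[OF gb]) (simp add: gb_def[abs_def] L2_norm_cnj)
  have "(LINT \<xi>|lborel. FT h \<xi> * cnj (g \<xi>)) = (LINT x|lborel. h x * cnj (h x))"
    using FT_multiplication_formula[OF h gb] by (simp add: gb_def h_def)
  also have "\<dots> = complex_of_real ((L2_norm g)\<^sup>2)"
    by (simp only: L2_norm_square[symmetric] n)
  finally have "complex_of_real ((L2_norm (\<lambda>\<xi>. FT h \<xi> + (-1) * g \<xi>))\<^sup>2) = 0"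
    unfolding L2_norm_add_cmult_square[OF L2_FT[OF h] g] by (simp add: L2_norm_FT[OF h] n)
  then have "L2_norm (\<lambda>\<xi>. FT h \<xi> - g \<xi>) = 0" by simp
  from L2_norm_eq_0[OF L2_borel_diff[OF L2_FT[OF h] g] this] show "AE \<xi> in lborel. FT h \<xi> = g \<xi>" by simp
qed

section \<open>Superpositions of translates as Fourier multipliers\<close>

lemma ft_conv:
  fixes c :: "'b::euclidean_space \<Rightarrow> complex" and z :: "'b \<Rightarrow> 'a::euclidean_space"
  assumes c: "integrable lborel c" and [measurable]: "z \<in> borel_measurable borel" and f: "integrable lborel f"
  shows "integrable lborel (\<lambda>x. LINT \<omega>|lborel. c \<omega> * f (x + z \<omega>))"
    and "ft (\<lambda>x. LINT \<omega>|lborel. c \<omega> * f (x + z \<omega>)) \<xi> = (LINT \<omega>|lborel. c \<omega> * cis (2 * pi * (z \<omega> \<bullet> \<xi>))) * ft f \<xi>"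
proof -
  have [measurable]: "c \<in> borel_measurable borel" "f \<in> borel_measurable borel" using c f by auto
  have tr: "integrable lborel (\<lambda>x. f (x + v))" "(LINT x|lborel. f (x + v)) = (LINT x|lborel. f x)"
    if f: "integrable lborel f" for f :: "'a \<Rightarrow> complex" and v
  proof -
    have [measurable]: "f \<in> borel_measurable borel" using f by auto
    have "integrable (distr lborel borel ((+) v)) f" using f by (simp add: lborel_distr_plus)
    then show "integrable lborel (\<lambda>x. f (x + v))" by (subst (asm) integrable_distr_eq) (auto simp: add.commute)
    have "(LINT x|lborel. f x) = (LINT x|distr lborel borel ((+) v). f x)" by (simp add: lborel_distr_plus)
    also have "\<dots> = (LINT x|lborel. f (v + x))" by (rule integral_distr) auto
    finally show "(LINT x|lborel. f (x + v)) = (LINT x|lborel. f x)" by (simp add: add.commute)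
  qed
  have i: "integrable (lborel \<Otimes>\<^sub>M lborel) (\<lambda>(\<omega>, x). c \<omega> * f (x + z \<omega>))"
  proof (rule lborel_pair.Fubini_integrable)
    have "(LINT x|lborel. norm (c \<omega> * f (x + z \<omega>))) = cmod (c \<omega>) * (LINT x|lborel. cmod (f x))" for \<omega>
    proof -
      have "(LINT x|lborel. cmod (f (x + z \<omega>))) = (LINT x|lborel. cmod (f x))"
        using tr(2)[of "\<lambda>x. complex_of_real (cmod (f x))" "z \<omega>"] f
        by (simp add: complex_of_real_integrable_eq)
      then show ?thesis by (simp add: norm_mult)
    qed
    then show "integrable lborel (\<lambda>\<omega>. LINT x|lborel. norm (case (\<omega>, x) of (\<omega>, x) \<Rightarrow> c \<omega> * f (x + z \<omega>)))"
      using c by simp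
    show "AE \<omega> in lborel. integrable lborel (\<lambda>x. case (\<omega>, x) of (\<omega>, x) \<Rightarrow> c \<omega> * f (x + z \<omega>))"
      using tr(1)[OF f] by simp
  qed measurable
  show "integrable lborel (\<lambda>x. LINT \<omega>|lborel. c \<omega> * f (x + z \<omega>))"
    using lborel_pair.integrable_snd[OF i] by simp
  have i2: "integrable (lborel \<Otimes>\<^sub>M lborel) (\<lambda>(\<omega>, x). cis (- (2 * pi * (x \<bullet> \<xi>))) * (c \<omega> * f (x + z \<omega>)))"
    by (rule Bochner_Integration.integrable_bound[OF i]) (auto simp: norm_mult case_prod_beta)
  have "ft (\<lambda>x. LINT \<omega>|lborel. c \<omega> * f (x + z \<omega>)) \<xi>
      = (LINT x|lborel. LINT \<omega>|lborel. cis (- (2 * pi * (x \<bullet> \<xi>))) * (c \<omega> * f (x + z \<omega>)))"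
    by (simp add: ft_def)
  also have "\<dots> = (LINT \<omega>|lborel. LINT x|lborel. cis (- (2 * pi * (x \<bullet> \<xi>))) * (c \<omega> * f (x + z \<omega>)))"
    by (rule lborel_pair.Fubini_integral[OF i2])
  also have "\<dots> = (LINT \<omega>|lborel. c \<omega> * cis (2 * pi * (z \<omega> \<bullet> \<xi>)) * ft f \<xi>)"
  proof (intro Bochner_Integration.integral_cong refl)
    fix \<omega>
    define F where "F x = cis (- (2 * pi * (x \<bullet> \<xi>))) * f x" for x
    have F: "integrable lborel F" unfolding F_def by (rule integrable_cis_mult[OF f]) measurable
    have "cis (- (2 * pi * (x \<bullet> \<xi>))) * (c \<omega> * f (x + z \<omega>)) = (c \<omega> * cis (2 * pi * (z \<omega> \<bullet> \<xi>))) * F (x + z \<omega>)" for x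
    proof -
      have "cis (- (2 * pi * (x \<bullet> \<xi>))) = cis (2 * pi * (z \<omega> \<bullet> \<xi>)) * cis (- (2 * pi * ((x + z \<omega>) \<bullet> \<xi>)))"
        by (simp add: cis_mult inner_add_left algebra_simps)
      then show ?thesis by (simp add: F_def)
    qed
    then have "(LINT x|lborel. cis (- (2 * pi * (x \<bullet> \<xi>))) * (c \<omega> * f (x + z \<omega>)))
        = (LINT x|lborel. (c \<omega> * cis (2 * pi * (z \<omega> \<bullet> \<xi>))) * F (x + z \<omega>))"
      by (simp only:)
    also have "\<dots> = (c \<omega> * cis (2 * pi * (z \<omega> \<bullet> \<xi>))) * (LINT x|lborel. F (x + z \<omega>))"
      by (rule integral_mult_right_zero)
    also have "(LINT x|lborel. F (x + z \<omega>)) = ft f \<xi>"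
      unfolding tr(2)[OF F] unfolding F_def[abs_def] ft_def ..
    finally show "(LINT x|lborel. cis (- (2 * pi * (x \<bullet> \<xi>))) * (c \<omega> * f (x + z \<omega>)))
        = c \<omega> * cis (2 * pi * (z \<omega> \<bullet> \<xi>)) * ft f \<xi>" .
  qed
  also have "\<dots> = (LINT \<omega>|lborel. c \<omega> * cis (2 * pi * (z \<omega> \<bullet> \<xi>))) * ft f \<xi>"
    by (rule integral_mult_left_zero)
  finally show "ft (\<lambda>x. LINT \<omega>|lborel. c \<omega> * f (x + z \<omega>)) \<xi> = (LINT \<omega>|lborel. c \<omega> * cis (2 * pi * (z \<omega> \<bullet> \<xi>))) * ft f \<xi>" .
qed

text \<open>Both sides are bounded on L2 by the integral of |c|, so the identity passes from
  truncations, where it is Fubini, to all of L2.\<close>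

lemma FT_conv:
  fixes c :: "'b::euclidean_space \<Rightarrow> complex" and z :: "'b \<Rightarrow> 'a::euclidean_space"
  assumes c: "integrable lborel c" and [measurable]: "z \<in> borel_measurable borel" and f: "f \<in> L2_borel"
  shows "AE \<xi> in lborel. FT (\<lambda>x. LINT \<omega>|lborel. c \<omega> * f (x + z \<omega>)) \<xi>
    = (LINT \<omega>|lborel. c \<omega> * cis (2 * pi * (z \<omega> \<bullet> \<xi>))) * FT f \<xi>"
proof -
  have [measurable]: "c \<in> borel_measurable borel" using c by auto
  define T where "T f = (\<lambda>x. LINT \<omega>|lborel. c \<omega> * f (x + z \<omega>))" for f :: "'a \<Rightarrow> complex"
  define m where "m \<xi> = (LINT \<omega>|lborel. c \<omega> * cis (2 * pi * (z \<omega> \<bullet> \<xi>)))" for \<xi>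
  define A where "A = (LINT \<omega>|lborel. cmod (c \<omega>))"
  have A0: "0 \<le> A" by (simp add: A_def)
  have [measurable]: "m \<in> borel_measurable borel" unfolding m_def[abs_def] by measurable
  have mb: "cmod (m \<xi>) \<le> A" for \<xi>
    using integral_norm_bound[of lborel "\<lambda>\<omega>. c \<omega> * cis (2 * pi * (z \<omega> \<bullet> \<xi>))"]
    by (simp add: m_def A_def norm_mult)
  note tr = L2_borel_ball_trunc[OF f] integrable_ball_trunc[OF f]
  have T: "T g \<in> L2_borel" "L2_norm (T g) \<le> A * L2_norm g" if "g \<in> L2_borel" for g
    unfolding T_def A_def by (intro L2_conv L2_norm_conv c that, measurable)+
  have mF: "(\<lambda>\<xi>. m \<xi> * FT f \<xi>) \<in> L2_borel" by (intro L2_borel_bounded_mult[OF L2_FT[OF f] _ mb]) measurable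
  have Ttr: "AE \<xi> in lborel. FT (T (ball_trunc k f)) \<xi> = m \<xi> * ft (ball_trunc k f) \<xi>" for k
    using FT_eq_ft[OF T(1)[OF tr(1)], of k] ft_conv[OF c _ tr(2), of z k] by (simp add: T_def m_def)
  have [measurable]: "FT (T (ball_trunc k f)) \<in> borel_measurable borel" "FT (T f) \<in> borel_measurable borel"
    "FT f \<in> borel_measurable borel" "f \<in> borel_measurable borel" "T f \<in> borel_measurable borel" for k
    by (intro L2_borel_measurable L2_FT T tr f)+
  have "AE \<xi> in lborel. FT (T f) \<xi> = m \<xi> * FT f \<xi>"
  proof (rule L2_limit_unique[where F="\<lambda>k. FT (T (ball_trunc k f))"])
    show "(\<lambda>k. L2_norm (\<lambda>\<xi>. FT (T (ball_trunc k f)) \<xi> - FT (T f) \<xi>)) \<longlonglongrightarrow> 0"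
    proof (rule Lim_null_comparison)
      have "(\<lambda>k. A * L2_norm (\<lambda>x. ball_trunc k f x - f x)) \<longlonglongrightarrow> A * 0"
        by (intro tendsto_intros L2_ball_trunc_tendsto f)
      then show "(\<lambda>k. A * L2_norm (\<lambda>x. ball_trunc k f x - f x)) \<longlonglongrightarrow> 0" by simp
      have "L2_norm (\<lambda>\<xi>. FT (T (ball_trunc k f)) \<xi> - FT (T f) \<xi>) \<le> A * L2_norm (\<lambda>x. ball_trunc k f x - f x)" for k
      proof -
        have [measurable]: "T (ball_trunc k f) \<in> borel_measurable borel" "T (\<lambda>x. ball_trunc k f x - f x) \<in> borel_measurable borel"
          by (intro L2_borel_measurable T L2_borel_diff tr f)+
        have "AE x in lborel. T (ball_trunc k f) x - T f x = T (\<lambda>x. ball_trunc k f x - f x) x"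
          using AE_integrable_conv[OF c _ tr(1), of z k] AE_integrable_conv[OF c _ f, of z]
          unfolding T_def by (simp, elim AE_mp) (auto simp: right_diff_distrib)
        then have "L2_norm (\<lambda>x. T (ball_trunc k f) x - T f x) = L2_norm (T (\<lambda>x. ball_trunc k f x - f x))"
          by (intro L2_norm_AE_cong) auto
        also have "\<dots> \<le> A * L2_norm (\<lambda>x. ball_trunc k f x - f x)" by (intro T L2_borel_diff tr f)
        finally show ?thesis by (simp add: L2_norm_FT_diff T tr f)
      qed
      then show "\<forall>\<^sub>F k in sequentially. norm (L2_norm (\<lambda>\<xi>. FT (T (ball_trunc k f)) \<xi> - FT (T f) \<xi>)) \<le> A * L2_norm (\<lambda>x. ball_trunc k f x - f x)"
        by simp
    qed
    show "(\<lambda>k. L2_norm (\<lambda>\<xi>. FT (T (ball_trunc k f)) \<xi> - m \<xi> * FT f \<xi>)) \<longlonglongrightarrow> 0"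
    proof (rule Lim_null_comparison)
      have "(\<lambda>k. A * L2_norm (\<lambda>\<xi>. ft (ball_trunc k f) \<xi> - FT f \<xi>)) \<longlonglongrightarrow> A * 0"
        by (intro tendsto_intros FT_limit f)
      then show "(\<lambda>k. A * L2_norm (\<lambda>\<xi>. ft (ball_trunc k f) \<xi> - FT f \<xi>)) \<longlonglongrightarrow> 0" by simp
      have "L2_norm (\<lambda>\<xi>. FT (T (ball_trunc k f)) \<xi> - m \<xi> * FT f \<xi>) \<le> A * L2_norm (\<lambda>\<xi>. ft (ball_trunc k f) \<xi> - FT f \<xi>)" for k
      proof -
        have "L2_norm (\<lambda>\<xi>. FT (T (ball_trunc k f)) \<xi> - m \<xi> * FT f \<xi>) = L2_norm (\<lambda>\<xi>. m \<xi> * (ft (ball_trunc k f) \<xi> - FT f \<xi>))"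
          using Ttr[of k] by (intro L2_norm_AE_cong) (auto simp: right_diff_distrib)
        also have "\<dots> \<le> A * L2_norm (\<lambda>\<xi>. ft (ball_trunc k f) \<xi> - FT f \<xi>)"
          by (intro L2_norm_bounded_mult mb A0 L2_borel_diff L2_FT L2_ft tr f) measurable
        finally show ?thesis .
      qed
      then show "\<forall>\<^sub>F k in sequentially. norm (L2_norm (\<lambda>\<xi>. FT (T (ball_trunc k f)) \<xi> - m \<xi> * FT f \<xi>)) \<le> A * L2_norm (\<lambda>\<xi>. ft (ball_trunc k f) \<xi> - FT f \<xi>)"
        by simp
    qed
  qed (intro L2_FT T tr f mF)+
  then show ?thesis by (simp add: T_def m_def)
qed

section \<open>Jensen's inequality with a remainder for Gaussian averages\<close>

text \<open>For r >= 1 the power lies below x itself; for r < 1 the claim is weighted AM-GM, that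
  is, convexity of exp between 0 and ln x.\<close>

lemma one_minus_powr_ge:
  assumes "0 < x" "x \<le> 1" "0 < r"
  shows "min 1 r * (1 - x) \<le> 1 - x powr (r::real)"
proof (cases "1 \<le> r")
  case True
  have "x powr r \<le> x powr 1" using assms True by (intro powr_mono') auto
  with assms True show ?thesis by simp
next
  case False
  have "exp ((1 - r) *\<^sub>R 0 + r *\<^sub>R ln x) \<le> (1 - r) * exp 0 + r * exp (ln x)"
    using assms False by (intro convex_onD[OF exp_convex]) auto
  then have "x powr r \<le> (1 - r) + r * x" using assms by (simp add: powr_def)
  with False show ?thesis by (simp add: algebra_simps)
qed

text \<open>Bernoulli's inequality with a quadratic remainder: the difference of the two sides
  vanishes at X = 1 and its derivative has the right sign on either side. The divisor
  \<open>max 1 X\<close> is forced for large X, since X^s may grow more slowly than X^2.\<close>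

lemma Bernoulli_gap:
  assumes s: "1 < s" and X: "0 < (X::real)"
  shows "(s * min 1 (s - 1) / 2) * (X - 1)\<^sup>2 / max 1 X \<le> X powr s - 1 - s * (X - 1)"
proof -
  define k where "k = s * min 1 (s - 1) / 2"
  have k0: "0 \<le> k" using s by (simp add: k_def)
  show ?thesis
  proof (cases "1 \<le> X")
    case True
    define f where "f X = X powr s - 1 - s * (X - 1) - k * (X - 2 + 1 / X)" for X
    have "f 1 \<le> f X"
    proof (rule DERIV_nonneg_imp_nondecreasing[OF True])
      fix y :: real assume y: "1 \<le> y" "y \<le> X"
      have "(f has_real_derivative s * y powr (s - 1) - s - k * (1 - 1 / y\<^sup>2)) (at y)"
        unfolding f_def using y by (auto intro!: derivative_eq_intros simp: power2_eq_square algebra_simps)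
      moreover have "0 \<le> s * y powr (s - 1) - s - k * (1 - 1 / y\<^sup>2)"
      proof -
        have ly: "0 \<le> ln y" using y by simp
        \<comment> \<open>Both terms are compared with ln y: y^(s-1) - 1 is at least (s - 1) ln y,
          and 1 - y^-2 is at most 2 ln y. The factor 1/2 in k balances this 2.\<close>
        have "1 + (s - 1) * ln y \<le> y powr (s - 1)" using y exp_ge_add_one_self[of "(s - 1) * ln y"] by (simp add: powr_def)
        then have 1: "s * ((s - 1) * ln y) \<le> s * (y powr (s - 1) - 1)" using s by (intro mult_left_mono) auto
        have "1 - 2 * ln y \<le> exp (- (2 * ln y))" using exp_ge_add_one_self[of "- (2 * ln y)"] by simp
        also have "exp (- (2 * ln y)) = 1 / y\<^sup>2" using y by (simp add: exp_minus exp_double inverse_eq_divide)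
        finally have "k * (1 - 1 / y\<^sup>2) \<le> k * (2 * ln y)" using k0 by (intro mult_left_mono) auto
        also have "\<dots> \<le> (s * (s - 1) / 2) * (2 * ln y)"
          unfolding k_def using s ly by (intro mult_right_mono divide_right_mono mult_left_mono) auto
        finally have "k * (1 - 1 / y\<^sup>2) \<le> s * (y powr (s - 1) - 1)" using 1 by simp
        then show ?thesis by (simp add: algebra_simps)
      qed
      ultimately show "\<exists>d. (f has_real_derivative d) (at y) \<and> 0 \<le> d" by blast
    qed
    moreover have "(X - 1)\<^sup>2 / X = X - 2 + 1 / X" using True by (simp add: power2_eq_square field_simps)
    ultimately show ?thesis using True unfolding k_def[symmetric] by (simp add: f_def max_absorb2 flip: times_divide_eq_right)
  next
    case False
    define f where "f X = X powr s - 1 - s * (X - 1) - k * (1 - X)\<^sup>2" for X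
    have X1: "X \<le> 1" using False by simp
    have "f 1 \<le> f X"
    proof (rule DERIV_nonpos_imp_nonincreasing[OF X1, of f])
      fix y :: real assume y: "X \<le> y" "y \<le> 1"
      have "(f has_real_derivative s * y powr (s - 1) - s + 2 * k * (1 - y)) (at y)"
        unfolding f_def using y X by (auto intro!: derivative_eq_intros simp: algebra_simps)
      moreover have "s * y powr (s - 1) - s + 2 * k * (1 - y) \<le> 0"
      proof -
        have "min 1 (s - 1) * (1 - y) \<le> 1 - y powr (s - 1)" using X y s by (intro one_minus_powr_ge) auto
        then have "s * (min 1 (s - 1) * (1 - y)) \<le> s * (1 - y powr (s - 1))" using s by (intro mult_left_mono) auto
        then show ?thesis by (simp add: k_def algebra_simps)
      qed
      ultimately show "\<exists>d. (f has_real_derivative d) (at y) \<and> d \<le> 0" by blast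
    qed
    moreover have "(X - 1)\<^sup>2 = (1 - X)\<^sup>2" by (simp add: power2_commute)
    ultimately show ?thesis using False unfolding k_def[symmetric] by (simp add: f_def max_absorb1)
  qed
qed

text \<open>
  The function \<open>(p, z) \<mapsto> |p|\<^sup>2 / z\<^sup>\<beta>\<close> is convex on \<open>\<complex> \<times> (0, \<infinity>)\<close>; for \<open>\<beta> < 1\<close> the gap to its tangent plane
  controls \<open>|p - p\<^sub>0|\<^sup>2\<close>, uniformly in \<open>z\<close>.
\<close>

definition perspective_const :: "real \<Rightarrow> real" where
  "perspective_const \<beta> = min 1 (1 / \<beta> - 1) / 4"

lemma perspective_const_pos: "0 < \<beta> \<Longrightarrow> \<beta> < 1 \<Longrightarrow> 0 < perspective_const \<beta>"
  by (simp add: perspective_const_def)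

lemma perspective_gap:
  fixes p p0 :: complex and z z0 :: real
  assumes \<beta>: "0 < \<beta>" "\<beta> < 1" and z: "0 < z" "0 < z0"
  shows "(cmod p0)\<^sup>2 / z0 powr \<beta> + 2 * Re (cnj p0 * (p - p0)) / z0 powr \<beta>
        - \<beta> * (cmod p0)\<^sup>2 * (z - z0) / (z0 powr \<beta> * z0)
        + perspective_const \<beta> * (cmod (p - p0))\<^sup>2 / (max z z0) powr \<beta>
      \<le> (cmod p)\<^sup>2 / z powr \<beta>"
proof -
  define s where "s = 1 / \<beta>"
  have s: "1 < s" using \<beta> by (simp add: s_def)
  define k where "k = \<beta> * (s * min 1 (s - 1) / 2)"
  define c where "c = perspective_const \<beta>"
  have ck: "2 * c = k" using \<beta> by (simp add: c_def k_def perspective_const_def s_def)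
  have c: "0 < c" "2 * c \<le> 1" "2 * c \<le> k"
    using perspective_const_pos[OF \<beta>] ck min.cobounded1[of 1 "1 / \<beta> - 1"]
    by (simp_all add: c_def) (simp add: perspective_const_def)
  have k0: "0 < k" using c ck by linarith
  define x where "x = z / z0"
  \<comment> \<open>Only the ratio x matters; in the variable X the convexity defect
    \<open>G\<close> of the power is a Bernoulli gap with exponent s = 1/\<beta>.\<close>
  define X where "X = x powr \<beta>"
  define Z where "Z = z0 powr \<beta>"
  have x: "0 < x" and X: "0 < X" and Z: "0 < Z" using z by (auto simp: x_def X_def Z_def)
  have Xs: "X powr s = x" using x \<beta> by (simp add: X_def powr_powr s_def)
  have zX: "z powr \<beta> = Z * X" using z by (simp add: Z_def X_def x_def powr_divide)
  have mX: "(max z z0) powr \<beta> = Z * max 1 X"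
  proof (cases "z \<le> z0")
    case True
    then have "x powr \<beta> \<le> 1 powr \<beta>" using z \<beta> x by (intro powr_mono2) (auto simp: x_def)
    with True show ?thesis by (simp add: X_def Z_def max_absorb2 max_absorb1)
  next
    case False
    then have "1 powr \<beta> \<le> x powr \<beta>" using z \<beta> x by (intro powr_mono2) (auto simp: x_def)
    with False show ?thesis by (simp add: zX X_def[symmetric] max_absorb2 max_absorb1)
  qed
  define G where "G = 1 + \<beta> * (x - 1) - X"
  have G: "k * ((X - 1)\<^sup>2 / max 1 X) \<le> G"
  proof -
    have "k * ((X - 1)\<^sup>2 / max 1 X) = \<beta> * ((s * min 1 (s - 1) / 2) * (X - 1)\<^sup>2 / max 1 X)" by (simp add: k_def)
    also have "\<dots> \<le> \<beta> * (X powr s - 1 - s * (X - 1))" using \<beta> by (intro mult_left_mono Bernoulli_gap s X) auto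
    also have "\<dots> = G" unfolding Xs G_def using \<beta> by (simp add: s_def field_simps)
    finally show ?thesis .
  qed
  \<comment> \<open>Completing the square: the gap to the tangent plane is a square plus a multiple
    of \<open>G\<close>, and both are nonnegative.\<close>
  have id: "(cmod p)\<^sup>2 / (Z * X) = (cmod p0)\<^sup>2 / Z + 2 * Re (cnj p0 * (p - p0)) / Z - \<beta> * (cmod p0)\<^sup>2 * (x - 1) / Z
      + ((cmod (p - p0 * of_real X))\<^sup>2 / (Z * X) + (cmod p0)\<^sup>2 / Z * G)"
  proof -
    have e: "(cmod (p - p0 * of_real X))\<^sup>2 = (cmod p)\<^sup>2 - 2 * X * Re (cnj p0 * p) + (cmod p0)\<^sup>2 * X\<^sup>2"
      unfolding cmod_power2 by (simp add: power2_eq_square algebra_simps)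
    have r: "Re (cnj p0 * (p - p0)) = Re (cnj p0 * p) - (cmod p0)\<^sup>2"
      unfolding cmod_power2 by (simp add: power2_eq_square algebra_simps)
    show ?thesis unfolding e r G_def using Z X by (simp add: divide_simps power2_eq_square) (simp add: algebra_simps)
  qed
  \<comment> \<open>Splitting p - p0 = (p - p0 X) + p0 (X - 1) costs a factor 2, which together with
    the 1/2 in k explains the 1/4 in \<open>perspective_const\<close>.\<close>
  have "c * (cmod (p - p0))\<^sup>2 / (Z * max 1 X) \<le> (cmod (p - p0 * of_real X))\<^sup>2 / (Z * X) + (cmod p0)\<^sup>2 / Z * G"
  proof -
    have e: "p - p0 * of_real X + p0 * of_real (X - 1) = p - p0" by (simp add: algebra_simps)
    have "(cmod (p - p0))\<^sup>2 \<le> 2 * (cmod (p - p0 * of_real X))\<^sup>2 + 2 * ((cmod p0)\<^sup>2 * (X - 1)\<^sup>2)"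
      using square_norm_add_le[of "p - p0 * of_real X" "p0 * of_real (X - 1)"]
      unfolding e by (simp add: norm_mult power_mult_distrib del: of_real_diff)
    then have "c * (cmod (p - p0))\<^sup>2 \<le> c * (2 * (cmod (p - p0 * of_real X))\<^sup>2 + 2 * ((cmod p0)\<^sup>2 * (X - 1)\<^sup>2))"
      using c by (intro mult_left_mono) auto
    also have "\<dots> = (2 * c) * (cmod (p - p0 * of_real X))\<^sup>2 + (2 * c) * ((cmod p0)\<^sup>2 * (X - 1)\<^sup>2)" by (simp add: algebra_simps)
    also have "\<dots> \<le> 1 * (cmod (p - p0 * of_real X))\<^sup>2 + k * ((cmod p0)\<^sup>2 * (X - 1)\<^sup>2)"
      using c by (intro add_mono mult_right_mono) auto
    finally have "c * (cmod (p - p0))\<^sup>2 / (Z * max 1 X) \<le> (1 * (cmod (p - p0 * of_real X))\<^sup>2 + k * ((cmod p0)\<^sup>2 * (X - 1)\<^sup>2)) / (Z * max 1 X)"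
      using Z by (intro divide_right_mono) auto
    also have "\<dots> = (cmod (p - p0 * of_real X))\<^sup>2 / (Z * max 1 X) + (cmod p0)\<^sup>2 / Z * (k * ((X - 1)\<^sup>2 / max 1 X))"
      by (simp add: add_divide_distrib)
    also have "\<dots> \<le> (cmod (p - p0 * of_real X))\<^sup>2 / (Z * X) + (cmod p0)\<^sup>2 / Z * G"
      using Z X by (intro add_mono divide_left_mono mult_left_mono G) auto
    finally show ?thesis .
  qed
  moreover have "(z - z0) / (z0 powr \<beta> * z0) = (x - 1) / Z" using z by (simp add: x_def Z_def divide_simps)
  ultimately show ?thesis
    unfolding c_def[symmetric] zX mX Z_def[symmetric] times_divide_eq_right[symmetric] using id by simp
qed

section \<open>Gaussian averages along a line\<close>

definition avg :: "'a::euclidean_space \<Rightarrow> real \<Rightarrow> ('a \<Rightarrow> 'b::{banach, second_countable_topology}) \<Rightarrow> 'a \<Rightarrow> 'b" where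
  "avg a \<rho> v x = (LINT t|lborel. std_normal_density t *\<^sub>R v (x + (\<rho> * t) *\<^sub>R a))"

lemma avg_measurable [measurable]:
  assumes [measurable]: "v \<in> borel_measurable borel"
  shows "avg a \<rho> v \<in> borel_measurable borel"
  unfolding avg_def[abs_def] by measurable

lemma avg_integrable:
  fixes v :: "'a::euclidean_space \<Rightarrow> 'b::{banach, second_countable_topology}"
  assumes [measurable]: "v \<in> borel_measurable borel" and b: "\<And>y. norm (v y) \<le> B"
  shows "integrable lborel (\<lambda>t. std_normal_density t *\<^sub>R v (x + (\<rho> * t) *\<^sub>R a))"
proof (rule Bochner_Integration.integrable_bound[of _ "\<lambda>t. std_normal_density t * B"])
  show "AE t in lborel. norm (std_normal_density t *\<^sub>R v (x + (\<rho> * t) *\<^sub>R a)) \<le> norm (std_normal_density t * B)"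
    using b order_trans[OF b abs_ge_self] by (intro AE_I2) (auto simp: abs_mult intro!: mult_left_mono)
qed auto

lemma avg_const [simp]: "avg a \<rho> (\<lambda>_. c) x = c"
  by (simp add: avg_def)

text \<open>Integrating over a standard normal variable, and not against a density of width \<rho>,
  makes scale 0 the identity; iterated averages use it to skip a direction.\<close>

lemma avg_0 [simp]: "avg a 0 v x = v x"
  by (simp add: avg_def)

lemma norm_avg_le:
  fixes v :: "'a::euclidean_space \<Rightarrow> 'b::{banach, second_countable_topology}"
  assumes b: "\<And>y. norm (v y) \<le> B"
  shows "norm (avg a \<rho> v x) \<le> B"
proof -
  have "norm (avg a \<rho> v x) \<le> (LINT t|lborel. std_normal_density t * B)"
    unfolding avg_def by (rule norm_integral_le) (auto intro!: mult_left_mono b)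
  then show ?thesis by simp
qed

lemma avg_mono:
  fixes v w :: "'a::euclidean_space \<Rightarrow> real"
  assumes [measurable]: "v \<in> borel_measurable borel" "w \<in> borel_measurable borel"
    and "\<And>y. \<bar>v y\<bar> \<le> B" "\<And>y. \<bar>w y\<bar> \<le> B'" "\<And>y. v y \<le> w y"
  shows "avg a \<rho> v x \<le> avg a \<rho> w x"
  unfolding avg_def using assms by (intro integral_mono avg_integrable) (auto intro: mult_left_mono)

lemma avg_bounds:
  fixes v :: "'a::euclidean_space \<Rightarrow> real"
  assumes [measurable]: "v \<in> borel_measurable borel" and b: "\<And>y. e \<le> v y" "\<And>y. v y \<le> B"
  shows "e \<le> avg a \<rho> v x" "avg a \<rho> v x \<le> B"
proof -
  have v: "\<bar>v y\<bar> \<le> \<bar>e\<bar> + \<bar>B\<bar>" for y using b[of y] by linarith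
  show "e \<le> avg a \<rho> v x" using avg_mono[of "\<lambda>_. e" v "\<bar>e\<bar>" "\<bar>e\<bar> + \<bar>B\<bar>" a \<rho> x] v b by simp
  show "avg a \<rho> v x \<le> B" using avg_mono[of v "\<lambda>_. B" "\<bar>e\<bar> + \<bar>B\<bar>" "\<bar>B\<bar>" a \<rho> x] v b by simp
qed

text \<open>Invariance of the integral is what lets the pointwise Jensen gaps telescope once they
  are integrated in x.\<close>

lemma nn_integral_avg:
  fixes v :: "'a::euclidean_space \<Rightarrow> real"
  assumes [measurable]: "v \<in> borel_measurable borel" and b: "\<And>y. 0 \<le> v y" "\<And>y. v y \<le> B"
  shows "(\<integral>\<^sup>+x. ennreal (avg a \<rho> v x) \<partial>lborel) = (\<integral>\<^sup>+x. ennreal (v x) \<partial>lborel)"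
proof -
  have "(\<integral>\<^sup>+x. ennreal (avg a \<rho> v x) \<partial>lborel) = (\<integral>\<^sup>+x. (\<integral>\<^sup>+t. ennreal (std_normal_density t * v (x + (\<rho> * t) *\<^sub>R a)) \<partial>lborel) \<partial>lborel)"
    unfolding avg_def using b avg_integrable[of v B]
    by (intro nn_integral_cong, subst nn_integral_eq_integral[symmetric]) (auto simp: abs_of_nonneg)
  also have "\<dots> = (\<integral>\<^sup>+t. (\<integral>\<^sup>+x. ennreal (std_normal_density t * v (x + (\<rho> * t) *\<^sub>R a)) \<partial>lborel) \<partial>lborel)"
    by (rule lborel_pair.Fubini') measurable
  also have "\<dots> = (\<integral>\<^sup>+t. ennreal (std_normal_density t) * (\<integral>\<^sup>+x. ennreal (v x) \<partial>lborel) \<partial>lborel)"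
    using nn_integral_lborel_translate[of "\<lambda>x. ennreal (v x)"] by (simp add: ennreal_mult' nn_integral_cmult)
  also have "\<dots> = (\<integral>\<^sup>+x. ennreal (v x) \<partial>lborel)"
    by (simp add: nn_integral_multc nn_integral_eq_integral)
  finally show ?thesis .
qed

lemma integral_conv_std_normal_density:
  "integrable lborel (\<lambda>t. std_normal_density t * std_normal_density (y - t))"
  "(LINT t|lborel. std_normal_density t * std_normal_density (y - t)) = normal_density 0 (sqrt 2) y"
proof -
  have nn: "(\<integral>\<^sup>+t. ennreal (std_normal_density t * std_normal_density (y - t)) \<partial>lborel) = ennreal (normal_density 0 (sqrt 2) y)"
    using fun_cong[OF conv_std_normal_density, of y] by (simp add: mult.commute)
  show "integrable lborel (\<lambda>t. std_normal_density t * std_normal_density (y - t))"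
    by (rule integrableI_nonneg) (auto simp: nn)
  show "(LINT t|lborel. std_normal_density t * std_normal_density (y - t)) = normal_density 0 (sqrt 2) y"
    by (rule integral_eq_nn_integral[THEN trans]) (auto simp: nn)
qed

text \<open>The sum of two independent standard normal variables is normal with deviation sqrt 2.
  This semigroup property fixes the ratio sqrt 2 of consecutive scales.\<close>

lemma avg_avg:
  fixes v :: "'a::euclidean_space \<Rightarrow> 'b::{banach, second_countable_topology}"
  assumes [measurable]: "v \<in> borel_measurable borel" and b: "\<And>y. norm (v y) \<le> B"
  shows "avg a \<rho> (avg a \<rho> v) x = avg a (sqrt 2 * \<rho>) v x"
proof -
  let ?n = std_normal_density
  have B0: "0 \<le> B" using b[of 0] norm_ge_zero order_trans by blast
  have "avg a \<rho> (avg a \<rho> v) x = (LINT t|lborel. LINT s|lborel. (?n t * ?n s) *\<^sub>R v (x + (\<rho> * t + \<rho> * s) *\<^sub>R a))"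
    unfolding avg_def by (simp add: scaleR_add_left add.assoc flip: integral_scaleR_right)
  also have "\<dots> = (LINT t|lborel. LINT y|lborel. (?n t * ?n (y - t)) *\<^sub>R v (x + (\<rho> * y) *\<^sub>R a))"
  proof (rule Bochner_Integration.integral_cong[OF refl])
    fix t
    show "(LINT s|lborel. (?n t * ?n s) *\<^sub>R v (x + (\<rho> * t + \<rho> * s) *\<^sub>R a)) = (LINT y|lborel. (?n t * ?n (y - t)) *\<^sub>R v (x + (\<rho> * y) *\<^sub>R a))"
      by (subst lborel_integral_real_affine[where c=1 and t="-t"]) (auto simp: algebra_simps)
  qed
  also have "\<dots> = (LINT y|lborel. LINT t|lborel. (?n t * ?n (y - t)) *\<^sub>R v (x + (\<rho> * y) *\<^sub>R a))"
  proof (rule lborel_pair.Fubini_integral[symmetric])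
    show "integrable (lborel \<Otimes>\<^sub>M lborel) (\<lambda>(t, y). (?n t * ?n (y - t)) *\<^sub>R v (x + (\<rho> * y) *\<^sub>R a))"
    proof (rule lborel_pair.Fubini_integrable)
      have i: "integrable lborel (\<lambda>y. ?n (y - t))" "(LINT y|lborel. ?n (y - t)) = 1" for t
        using lborel_integrable_real_affine[of ?n 1 "-t"] lborel_integral_real_affine[of 1 ?n "-t"] by auto
      have i2: "integrable lborel (\<lambda>y. (?n t * ?n (y - t)) *\<^sub>R v (x + (\<rho> * y) *\<^sub>R a))" for t
        by (rule Bochner_Integration.integrable_bound[of _ "\<lambda>y. (?n t * ?n (y - t)) * B"])
          (use b B0 i in \<open>auto simp: abs_mult intro!: mult_left_mono\<close>)
      then show "AE t in lborel. integrable lborel (\<lambda>y. case (t, y) of (t, y) \<Rightarrow> (?n t * ?n (y - t)) *\<^sub>R v (x + (\<rho> * y) *\<^sub>R a))"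
        by simp
      show "integrable lborel (\<lambda>t. LINT y|lborel. norm (case (t, y) of (t, y) \<Rightarrow> (?n t * ?n (y - t)) *\<^sub>R v (x + (\<rho> * y) *\<^sub>R a)))"
      proof (rule Bochner_Integration.integrable_bound[of _ "\<lambda>t. ?n t * B"])
        have "norm (LINT y|lborel. norm ((?n t * ?n (y - t)) *\<^sub>R v (x + (\<rho> * y) *\<^sub>R a))) \<le> (LINT y|lborel. ?n t * ?n (y - t) * B)" for t
          by (rule norm_integral_le) (use b i in \<open>auto simp: abs_mult intro!: mult_left_mono\<close>)
        then show "AE t in lborel. norm (LINT y|lborel. norm (case (t, y) of (t, y) \<Rightarrow> (?n t * ?n (y - t)) *\<^sub>R v (x + (\<rho> * y) *\<^sub>R a))) \<le> norm (?n t * B)"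
          using B0 by (simp add: i abs_mult)
      qed auto
    qed measurable
  qed
  also have "\<dots> = (LINT y|lborel. normal_density 0 (sqrt 2) y *\<^sub>R v (x + (\<rho> * y) *\<^sub>R a))"
    by (simp add: integral_conv_std_normal_density)
  also have "\<dots> = \<bar>sqrt 2\<bar> *\<^sub>R (LINT t|lborel. normal_density 0 (sqrt 2) (0 + sqrt 2 * t) *\<^sub>R v (x + (\<rho> * (0 + sqrt 2 * t)) *\<^sub>R a))"
    by (rule lborel_integral_real_affine) simp
  also have "\<dots> = avg a (sqrt 2 * \<rho>) v x"
  proof -
    have n: "sqrt 2 * normal_density 0 (sqrt 2) (sqrt 2 * t) = ?n t" for t
      by (simp add: normal_density_def power_mult_distrib real_sqrt_mult field_simps)
    have "\<bar>sqrt 2\<bar> *\<^sub>R (LINT t|lborel. normal_density 0 (sqrt 2) (0 + sqrt 2 * t) *\<^sub>R v (x + (\<rho> * (0 + sqrt 2 * t)) *\<^sub>R a))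
      = (LINT t|lborel. (sqrt 2 * normal_density 0 (sqrt 2) (sqrt 2 * t)) *\<^sub>R v (x + (sqrt 2 * \<rho> * t) *\<^sub>R a))"
      by (simp add: mult_ac flip: integral_scaleR_right)
    then show ?thesis unfolding avg_def n .
  qed
  finally show ?thesis .
qed

text \<open>A shifted narrow Gaussian lies below a multiple of a centred wider one: in units of
  \<rho> the shift is at most D, and doubling the variance absorbs it at the price of exp (D^2 /
  2).\<close>

lemma avg_Harnack:
  fixes v :: "'a::euclidean_space \<Rightarrow> real"
  assumes [measurable]: "v \<in> borel_measurable borel" and b: "\<And>y. 0 \<le> v y" "\<And>y. v y \<le> B"
    and \<rho>: "0 < \<rho>" "sqrt 2 * \<rho> \<le> \<rho>'" and d: "\<bar>d\<bar> \<le> D * \<rho>"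
  shows "avg a \<rho> v (x + d *\<^sub>R a) \<le> (\<rho>' / \<rho>) * exp (D\<^sup>2 / 2) * avg a \<rho>' v x"
proof -
  let ?n = std_normal_density
  have r: "0 < \<rho>'" using \<rho> by (meson mult_pos_pos order_less_le_trans real_sqrt_gt_zero zero_less_numeral)
  have sh: "?n (- (d / \<rho>) + \<rho>' / \<rho> * t) \<le> exp (D\<^sup>2 / 2) * ?n t" for t
  proof -
    \<comment> \<open>The factor 1/2 lost here is recovered from
      \<open>sqrt 2 * \<rho> \<le> \<rho>'\<close>, which gives u^2 >= 2 t^2 for u =
      (\<rho>'/\<rho>) t.\<close>
    have h: "u\<^sup>2 / 2 - e\<^sup>2 \<le> (- e + u)\<^sup>2" for u e :: real
    proof -
      have "0 \<le> (u - 2 * e)\<^sup>2 / 2" by simp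
      then show ?thesis by (simp add: power2_eq_square algebra_simps)
    qed
    have "2 \<le> (\<rho>' / \<rho>)\<^sup>2"
      using power_mono[of "sqrt 2" "\<rho>' / \<rho>" 2] \<rho> by (simp add: pos_le_divide_eq)
    then have "t\<^sup>2 * 2 \<le> t\<^sup>2 * (\<rho>' / \<rho>)\<^sup>2" by (intro mult_left_mono) auto
    moreover have "(\<rho>' / \<rho> * t)\<^sup>2 = t\<^sup>2 * (\<rho>' / \<rho>)\<^sup>2" by (simp only: power_mult_distrib mult.commute)
    ultimately have 1: "t\<^sup>2 \<le> (\<rho>' / \<rho> * t)\<^sup>2 / 2" by linarith
    have "\<bar>d / \<rho>\<bar> \<le> D" using d \<rho> by (simp add: divide_le_eq)
    then have "\<bar>d / \<rho>\<bar>\<^sup>2 \<le> D\<^sup>2" by (rule power_mono) simp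
    then have 2: "(d / \<rho>)\<^sup>2 \<le> D\<^sup>2" unfolding power2_abs .
    have "t\<^sup>2 - D\<^sup>2 \<le> (- (d / \<rho>) + \<rho>' / \<rho> * t)\<^sup>2" using 1 2 h[of "\<rho>' / \<rho> * t" "d / \<rho>"] by linarith
    then have "exp (- ((- (d / \<rho>) + \<rho>' / \<rho> * t)\<^sup>2) / 2) \<le> exp (D\<^sup>2 / 2 + - (t\<^sup>2) / 2)" by simp
    then show ?thesis unfolding exp_add std_normal_density_def by (simp add: divide_simps mult.commute)
  qed
  have pt: "?n (- (d / \<rho>) + \<rho>' / \<rho> * t) * v (x + d *\<^sub>R a + (\<rho> * (- (d / \<rho>) + \<rho>' / \<rho> * t)) *\<^sub>R a)
      \<le> exp (D\<^sup>2 / 2) * (?n t * v (x + (\<rho>' * t) *\<^sub>R a))" for t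
  proof -
    have "\<rho> * (- (d / \<rho>) + \<rho>' / \<rho> * t) = \<rho>' * t - d" using \<rho> by (simp add: field_simps)
    then have eq: "x + d *\<^sub>R a + (\<rho> * (- (d / \<rho>) + \<rho>' / \<rho> * t)) *\<^sub>R a = x + (\<rho>' * t) *\<^sub>R a"
      by (simp only:) (simp add: algebra_simps)
    show ?thesis using mult_right_mono[OF sh[of t] b(1)] unfolding eq by (simp only: mult.assoc)
  qed
  have i: "integrable lborel (\<lambda>t. ?n t * v (x + (\<rho>' * t) *\<^sub>R a))"
    using avg_integrable[of v B x \<rho>' a] b by (simp add: abs_of_nonneg)
  have "avg a \<rho> v (x + d *\<^sub>R a) = \<bar>\<rho>' / \<rho>\<bar> *\<^sub>R (LINT t|lborel. ?n (- (d / \<rho>) + \<rho>' / \<rho> * t) *\<^sub>R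
      v (x + d *\<^sub>R a + (\<rho> * (- (d / \<rho>) + \<rho>' / \<rho> * t)) *\<^sub>R a))"
    unfolding avg_def by (rule lborel_integral_real_affine) (use \<rho> r in auto)
  also have "\<dots> \<le> (\<rho>' / \<rho>) * (LINT t|lborel. exp (D\<^sup>2 / 2) * (?n t * v (x + (\<rho>' * t) *\<^sub>R a)))"
  proof -
    have "(LINT t|lborel. ?n (- (d / \<rho>) + \<rho>' / \<rho> * t) *\<^sub>R v (x + d *\<^sub>R a + (\<rho> * (- (d / \<rho>) + \<rho>' / \<rho> * t)) *\<^sub>R a))
      \<le> norm (LINT t|lborel. ?n (- (d / \<rho>) + \<rho>' / \<rho> * t) *\<^sub>R v (x + d *\<^sub>R a + (\<rho> * (- (d / \<rho>) + \<rho>' / \<rho> * t)) *\<^sub>R a))" by simp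
    also have "\<dots> \<le> (LINT t|lborel. exp (D\<^sup>2 / 2) * (?n t * v (x + (\<rho>' * t) *\<^sub>R a)))"
      by (rule norm_integral_le) (use i pt b in \<open>auto simp: abs_mult abs_of_nonneg\<close>)
    finally have le: "(LINT t|lborel. ?n (- (d / \<rho>) + \<rho>' / \<rho> * t) *\<^sub>R v (x + d *\<^sub>R a + (\<rho> * (- (d / \<rho>) + \<rho>' / \<rho> * t)) *\<^sub>R a))
      \<le> (LINT t|lborel. exp (D\<^sup>2 / 2) * (?n t * v (x + (\<rho>' * t) *\<^sub>R a)))" .
    have "\<bar>\<rho>' / \<rho>\<bar> = \<rho>' / \<rho>" "0 \<le> \<rho>' / \<rho>" using \<rho> r by auto
    then show ?thesis using mult_left_mono[OF le] by (simp only: real_scaleR_def)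
  qed
  also have "\<dots> = (\<rho>' / \<rho>) * exp (D\<^sup>2 / 2) * avg a \<rho>' v x" by (simp add: avg_def)
  finally show ?thesis .
qed

text \<open>The closed intervals overlap at 0, where the two values cancel, so the function is odd
  at every point. Mean zero makes it blind to constants; bounded support makes the associated
  convolutions local.\<close>

definition haar :: "real \<Rightarrow> real" where
  "haar t = indicator {0..1} t - indicator {-1..0} t"

lemma haar_measurable [measurable]: "haar \<in> borel_measurable borel"
  unfolding haar_def[abs_def] by measurable

lemma abs_haar_le: "\<bar>haar t\<bar> \<le> indicator {-1..1} t"
  by (auto simp: haar_def indicator_def)

lemma integrable_haar: "integrable lborel haar"
  unfolding haar_def[abs_def] by (intro Bochner_Integration.integrable_diff integrable_real_indicator) auto

lemma integral_haar: "(LINT t|lborel. haar t) = 0"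
  unfolding haar_def by (subst Bochner_Integration.integral_diff) auto

lemma integral_abs_haar_le: "(LINT t|lborel. \<bar>haar t\<bar>) \<le> 2"
proof -
  have "norm (LINT t|lborel. \<bar>haar t\<bar>) \<le> (LINT t|lborel. indicator {-1..1} (t::real))"
    by (rule norm_integral_le) (auto intro: abs_haar_le)
  then show ?thesis by simp
qed

definition haar_op :: "'a::euclidean_space \<Rightarrow> real \<Rightarrow> ('a \<Rightarrow> complex) \<Rightarrow> 'a \<Rightarrow> complex" where
  "haar_op a \<rho> u x = (LINT t|lborel. of_real (haar t) * u (x + (\<rho> * t) *\<^sub>R a))"

lemma haar_op_measurable [measurable]:
  assumes [measurable]: "u \<in> borel_measurable borel"
  shows "haar_op a \<rho> u \<in> borel_measurable borel"
  unfolding haar_op_def[abs_def] by measurable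

text \<open>Since \<open>haar\<close> has mean zero, any constant P may be subtracted;
  Cauchy-Schwarz with total mass at most 2 does the rest. In the application P is the Gaussian
  average of \<open>p\<close>.\<close>

lemma haar_op_square_le:
  fixes p :: "'a::euclidean_space \<Rightarrow> complex"
  assumes [measurable]: "p \<in> borel_measurable borel" and b: "\<And>y. cmod (p y) \<le> B"
  shows "(cmod (haar_op a \<rho> p x))\<^sup>2 \<le> 2 * (LINT t|lborel. indicator {-1..1} t * (cmod (p (x + (\<rho> * t) *\<^sub>R a) - P))\<^sup>2)"
proof -
  define g where "g t = p (x + (\<rho> * t) *\<^sub>R a) - P" for t
  have [measurable]: "g \<in> borel_measurable borel" unfolding g_def[abs_def] by measurable
  have B0: "0 \<le> B" using b[of 0] norm_ge_zero order_trans by blast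
  have gb: "cmod (g t) \<le> B + cmod P" for t
    unfolding g_def using norm_triangle_ineq4[of "p (x + (\<rho> * t) *\<^sub>R a)" P] b[of "x + (\<rho> * t) *\<^sub>R a"] by linarith
  have ih: "integrable lborel (\<lambda>t. complex_of_real (haar t))" using integrable_haar by (simp only: complex_of_real_integrable_eq)
  have ip: "integrable lborel (\<lambda>t. complex_of_real (haar t) * p (x + (\<rho> * t) *\<^sub>R a))"
    by (rule Bochner_Integration.integrable_bound[of _ "\<lambda>t. haar t * B"])
      (use integrable_haar b B0 in \<open>auto simp: norm_mult abs_mult intro!: mult_left_mono\<close>)
  have "(LINT t|lborel. complex_of_real (haar t) * P) = (LINT t|lborel. complex_of_real (haar t)) * P"
    by (rule integral_mult_left_zero)
  then have z: "(LINT t|lborel. complex_of_real (haar t) * P) = 0" by (simp add: integral_haar)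
  have eq: "haar_op a \<rho> p x = (LINT t|lborel. of_real (haar t) * g t)"
    unfolding haar_op_def g_def right_diff_distrib
    by (subst Bochner_Integration.integral_diff) (use ip ih z in auto)
  have i2: "integrable lborel (\<lambda>t. indicator {-1..1} t * (cmod (g t))\<^sup>2)"
    by (rule Bochner_Integration.integrable_bound[of _ "\<lambda>t. indicator {-1..1} t * (B + cmod P)\<^sup>2"])
      (use gb in \<open>auto intro!: power_mono integrable_mult_left integrable_real_indicator split: split_indicator\<close>)
  have "ennreal ((cmod (LINT t|lborel. of_real (haar t) * g t))\<^sup>2)
    \<le> ennreal (LINT t|lborel. cmod (of_real (haar t))) * (\<integral>\<^sup>+t. ennreal (cmod (of_real (haar t)) * (cmod (g t))\<^sup>2) \<partial>lborel)"
    by (rule norm_integral_square_le(1)[OF ih]) measurable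
  also have "\<dots> \<le> ennreal 2 * (\<integral>\<^sup>+t. ennreal (indicator {-1..1} t * (cmod (g t))\<^sup>2) \<partial>lborel)"
    using integral_abs_haar_le abs_haar_le by (intro mult_mono nn_integral_mono ennreal_leI mult_right_mono) auto
  also have "\<dots> = ennreal (2 * (LINT t|lborel. indicator {-1..1} t * (cmod (g t))\<^sup>2))"
    using i2 by (subst nn_integral_eq_integral) (auto simp: ennreal_mult)
  finally have "(cmod (LINT t|lborel. of_real (haar t) * g t))\<^sup>2 \<le> 2 * (LINT t|lborel. indicator {-1..1} t * (cmod (g t))\<^sup>2)"
    by (simp add: ennreal_le_iff)
  then show ?thesis unfolding eq by (simp add: g_def)
qed

text \<open>\<open>perspective_gap\<close> is integrated against the Gaussian with the tangent plane
  taken at the averages of \<open>p\<close> and \<open>z\<close>, where the linear terms cancel. The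
  remainder is kept only for |t| <= 1: there the density is at least its value at 1 and
  \<open>z\<close> is at most M, so it controls the Haar oscillation of \<open>p\<close>. The factor
  1/2 comes from \<open>haar_op_square_le\<close>.\<close>

lemma avg_perspective_gap:
  fixes a x :: "'a::euclidean_space" and p :: "'a \<Rightarrow> complex" and z :: "'a \<Rightarrow> real"
  assumes \<beta>: "0 < \<beta>" "\<beta> < 1"
    and [measurable]: "p \<in> borel_measurable borel" "z \<in> borel_measurable borel"
    and pb: "\<And>y. cmod (p y) \<le> B" and e: "0 < e" and zb: "\<And>y. e \<le> z y" "\<And>y. z y \<le> B'"
    and zM: "\<And>t. \<bar>t\<bar> \<le> 1 \<Longrightarrow> z (x + (\<rho> * t) *\<^sub>R a) \<le> M" and ZM: "avg a \<rho> z x \<le> M"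
  shows "(cmod (avg a \<rho> p x))\<^sup>2 / (avg a \<rho> z x) powr \<beta>
      + perspective_const \<beta> * std_normal_density 1 / 2 * ((cmod (haar_op a \<rho> p x))\<^sup>2 / M powr \<beta>)
    \<le> avg a \<rho> (\<lambda>y. (cmod (p y))\<^sup>2 / z y powr \<beta>) x"
proof -
  let ?n = std_normal_density
  define c where "c = perspective_const \<beta>"
  have c: "0 < c" unfolding c_def by (rule perspective_const_pos[OF \<beta>])
  note gap = perspective_gap[OF \<beta>, folded c_def]
  have n1: "0 < ?n 1" by (rule normal_density_pos) simp
  have nt: "?n 1 \<le> ?n t" if "\<bar>t\<bar> \<le> 1" for t
  proof -
    have "t\<^sup>2 \<le> 1" using that by (simp add: abs_square_le_1)
    then show ?thesis by (simp add: std_normal_density_def divide_right_mono)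
  qed
  define P where "P = avg a \<rho> p x"
  define Z where "Z = avg a \<rho> z x"
  define pt where "pt t = p (x + (\<rho> * t) *\<^sub>R a)" for t
  define zt where "zt t = z (x + (\<rho> * t) *\<^sub>R a)" for t
  have [measurable]: "pt \<in> borel_measurable borel" "zt \<in> borel_measurable borel"
    unfolding pt_def[abs_def] zt_def[abs_def] by measurable
  have z0: "0 < z y" for y using e zb(1)[of y] by linarith
  have zt0: "0 < zt t" for t by (simp add: zt_def z0)
  have Z: "e \<le> Z" "0 < Z" using avg_bounds[of z e B' a \<rho> x] zb e by (auto simp: Z_def)
  have M: "0 < M" using Z ZM by (simp add: Z_def)
  have B0: "0 \<le> B" using pb[of 0] norm_ge_zero order_trans by blast
  have ip: "integrable lborel (\<lambda>t. ?n t *\<^sub>R pt t)" unfolding pt_def by (rule avg_integrable[OF _ pb]) measurable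
  have iz: "integrable lborel (\<lambda>t. ?n t * zt t)"
    using avg_integrable[of z B' x \<rho> a] zb z0 by (simp add: zt_def abs_of_pos)
  have qb: "(cmod (p y))\<^sup>2 / z y powr \<beta> \<le> B\<^sup>2 / e powr \<beta>" for y
    using pb[of y] e zb(1)[of y] \<beta> by (intro frac_le power_mono powr_mono2) auto
  have iq: "integrable lborel (\<lambda>t. ?n t * ((cmod (pt t))\<^sup>2 / zt t powr \<beta>))"
    using avg_integrable[of "\<lambda>y. (cmod (p y))\<^sup>2 / z y powr \<beta>" "B\<^sup>2 / e powr \<beta>" x \<rho> a] qb by (simp add: pt_def zt_def)
  define A where "A = (cmod P)\<^sup>2 / Z powr \<beta>"
  define K where "K = \<beta> * (cmod P)\<^sup>2 / (Z powr \<beta> * Z)"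
  define H where "H t = indicator {-1..1} t * (cmod (pt t - P))\<^sup>2" for t :: real
  have iH: "integrable lborel H"
  proof (rule Bochner_Integration.integrable_bound[of _ "\<lambda>t. indicator {-1..1} t * (B + cmod P)\<^sup>2"])
    have "cmod (pt t - P) \<le> B + cmod P" for t
      unfolding pt_def using norm_triangle_ineq4[of "p (x + (\<rho> * t) *\<^sub>R a)" P] pb[of "x + (\<rho> * t) *\<^sub>R a"] by linarith
    then show "AE t in lborel. norm (H t) \<le> norm (indicator {-1..1} t * (B + cmod P)\<^sup>2)"
      by (auto simp: H_def intro!: power_mono split: split_indicator)
    show "H \<in> borel_measurable lborel" unfolding H_def[abs_def] by measurable
  qed (intro integrable_mult_left integrable_real_indicator, auto)
  \<comment> \<open>The tangent-plane bound as a function of t, with the coefficients of the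
    density, of \<open>pt\<close> and of \<open>zt\<close> separated so that its integral can be
    read off.\<close>
  define L where "L t = ?n t * (A - 2 * (cmod P)\<^sup>2 / Z powr \<beta> + K * Z) + 2 / Z powr \<beta> * Re (cnj P * (?n t *\<^sub>R pt t)) - K * (?n t * zt t)
      + c * ?n 1 / M powr \<beta> * H t" for t
  have "L t \<le> ?n t * ((cmod (pt t))\<^sup>2 / zt t powr \<beta>)" for t
  proof -
    have "?n 1 / M powr \<beta> * H t \<le> ?n t * ((cmod (pt t - P))\<^sup>2 / (max (zt t) Z) powr \<beta>)"
    proof (cases "\<bar>t\<bar> \<le> 1")
      case True
      have mx: "max (zt t) Z \<le> M" using zM[OF True] ZM by (simp add: zt_def Z_def)
      have "?n 1 / M powr \<beta> * H t = ?n 1 * ((cmod (pt t - P))\<^sup>2 / M powr \<beta>)" using True by (simp add: H_def indicator_def abs_le_iff)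
      also have "\<dots> \<le> ?n t * ((cmod (pt t - P))\<^sup>2 / (max (zt t) Z) powr \<beta>)"
        using nt[OF True] mx Z(2) \<beta> M by (intro mult_mono frac_le powr_mono2) auto
      finally show ?thesis .
    next
      case False then have "H t = 0" by (auto simp: H_def indicator_def)
      then show ?thesis by simp
    qed
    then have 1: "c * (?n 1 / M powr \<beta> * H t) \<le> c * (?n t * ((cmod (pt t - P))\<^sup>2 / (max (zt t) Z) powr \<beta>))"
      using c by (intro mult_left_mono) auto
    have r: "Re (cnj P * (pt t - P)) = Re (cnj P * pt t) - (cmod P)\<^sup>2"
      unfolding cmod_power2 by (simp add: power2_eq_square algebra_simps)
    have "?n t * (A + 2 * Re (cnj P * (pt t - P)) / Z powr \<beta> - K * (zt t - Z) + c * (cmod (pt t - P))\<^sup>2 / (max (zt t) Z) powr \<beta>)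
        \<le> ?n t * ((cmod (pt t))\<^sup>2 / zt t powr \<beta>)"
      using gap[OF zt0[of t] Z(2), of P "pt t"] by (intro mult_left_mono) (auto simp: A_def K_def)
    moreover have "?n t * (A + 2 * Re (cnj P * (pt t - P)) / Z powr \<beta> - K * (zt t - Z) + c * (cmod (pt t - P))\<^sup>2 / (max (zt t) Z) powr \<beta>)
      = ?n t * (A - 2 * (cmod P)\<^sup>2 / Z powr \<beta> + K * Z) + 2 / Z powr \<beta> * Re (cnj P * (?n t *\<^sub>R pt t)) - K * (?n t * zt t)
        + c * (?n t * ((cmod (pt t - P))\<^sup>2 / (max (zt t) Z) powr \<beta>))"
      unfolding r by (simp add: algebra_simps diff_divide_distrib add_divide_distrib)
    ultimately show ?thesis using 1 by (simp add: L_def)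
  qed
  moreover have iL: "integrable lborel L"
    unfolding L_def using ip iz iH
    by (intro Bochner_Integration.integrable_add Bochner_Integration.integrable_diff integrable_mult_right integrable_mult_left integrable_Re) auto
  ultimately have "integral\<^sup>L lborel L \<le> (LINT t|lborel. ?n t * ((cmod (pt t))\<^sup>2 / zt t powr \<beta>))"
    using iq by (intro integral_mono) auto
  also have "\<dots> = avg a \<rho> (\<lambda>y. (cmod (p y))\<^sup>2 / z y powr \<beta>) x" by (simp add: avg_def pt_def zt_def)
  also have "integral\<^sup>L lborel L = A + c * ?n 1 / M powr \<beta> * integral\<^sup>L lborel H"
  proof -
    have P: "(LINT t|lborel. ?n t *\<^sub>R pt t) = P" and Z': "(LINT t|lborel. ?n t * zt t) = Z"
      by (simp_all add: P_def Z_def avg_def pt_def zt_def)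
    have ic: "integrable lborel (\<lambda>t. cnj P * (?n t *\<^sub>R pt t))" using ip by (rule integrable_mult_right)
    have "(LINT t|lborel. Re (cnj P * (?n t *\<^sub>R pt t))) = Re (LINT t|lborel. cnj P * (?n t *\<^sub>R pt t))"
      using ic by (rule integral_Re)
    also have "(LINT t|lborel. cnj P * (?n t *\<^sub>R pt t)) = cnj P * (LINT t|lborel. ?n t *\<^sub>R pt t)"
      by (rule integral_mult_right_zero)
    also have "\<dots> = cnj P * P" by (simp only: P)
    also have "Re (cnj P * P) = (cmod P)\<^sup>2" unfolding cmod_power2 by (simp add: power2_eq_square)
    finally have R: "(LINT t|lborel. Re (cnj P * (?n t *\<^sub>R pt t))) = (cmod P)\<^sup>2" .
    have "integral\<^sup>L lborel L = (A - 2 * (cmod P)\<^sup>2 / Z powr \<beta> + K * Z) + 2 / Z powr \<beta> * (cmod P)\<^sup>2 - K * Z + c * ?n 1 / M powr \<beta> * integral\<^sup>L lborel H"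
      unfolding L_def using ic iz iH integrable_Re[OF ic]
      using R by (simp add: Z' del: times_complex.sel)
    then show ?thesis by simp
  qed
  finally have main: "A + c * ?n 1 / M powr \<beta> * integral\<^sup>L lborel H \<le> avg a \<rho> (\<lambda>y. (cmod (p y))\<^sup>2 / z y powr \<beta>) x" .
  have "(cmod (haar_op a \<rho> p x))\<^sup>2 \<le> 2 * integral\<^sup>L lborel H"
    using haar_op_square_le[of p B a \<rho> x P] pb by (simp add: H_def[abs_def] pt_def)
  then have "c * ?n 1 / 2 / M powr \<beta> * (cmod (haar_op a \<rho> p x))\<^sup>2 \<le> c * ?n 1 / 2 / M powr \<beta> * (2 * integral\<^sup>L lborel H)"
    using c n1 by (intro mult_left_mono) auto
  then have "c * ?n 1 / 2 * ((cmod (haar_op a \<rho> p x))\<^sup>2 / M powr \<beta>) \<le> c * ?n 1 / M powr \<beta> * integral\<^sup>L lborel H"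
    by simp
  with main show ?thesis
    by (simp add: A_def P_def Z_def c_def)
qed

section \<open>The dual square function\<close>

text \<open>The exponent r / 2 makes r + 1 correspond to a factor sqrt 2, the step of
  \<open>avg_avg\<close>.\<close>

definition half_pow :: "real \<Rightarrow> real" where
  "half_pow r = 2 powr (r / 2)"

lemma half_pow_pos [simp]: "0 < half_pow r"
  by (simp add: half_pow_def)

lemma half_pow_nonneg [simp]: "0 \<le> half_pow r"
  by (simp add: half_pow_def)

lemma half_pow_measurable [measurable]: "half_pow \<in> borel_measurable borel"
  unfolding half_pow_def[abs_def] by measurable

lemma half_pow_add1: "half_pow (r + 1) = sqrt 2 * half_pow r"
  by (simp add: half_pow_def add_divide_distrib powr_add powr_half_sqrt)

lemma half_pow_add: "half_pow (r + s) = half_pow r * half_pow s"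
  by (simp add: half_pow_def add_divide_distrib powr_add)

lemma half_pow_mono: "r \<le> s \<Longrightarrow> half_pow r \<le> half_pow s"
  by (simp add: half_pow_def)

lemma half_pow_ratio: "half_pow r / half_pow s = half_pow (r - s)"
  by (simp add: half_pow_def powr_diff diff_divide_distrib)

text \<open>Cutting the line into unit intervals and moving them to [0, 1) turns the integral into
  one over [0, 1) of sums over integer shifts. Such sums are what telescoping bounds, for each
  starting scale r.\<close>

lemma nn_integral_le_of_unit_translates:
  fixes X :: "real \<Rightarrow> ennreal"
  assumes [measurable]: "X \<in> borel_measurable borel"
    and le: "\<And>r m. (\<Sum>j<m. X (r + real j)) \<le> F"
  shows "(\<integral>\<^sup>+r. X r \<partial>lborel) \<le> F"
proof -
  have bd: "(\<integral>\<^sup>+r. X r * indicator {- real n..<real n} r \<partial>lborel) \<le> F" for n :: nat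
  proof -
    have "X r * indicator {- real n..<real n} r \<le> (\<Sum>j<2 * n. X r * indicator {- real n + real j..<- real n + real j + 1} r)" for r
    proof (cases "r \<in> {- real n..<real n}")
      case True
      define j where "j = nat \<lfloor>r + real n\<rfloor>"
      have "0 \<le> \<lfloor>r + real n\<rfloor>" unfolding le_floor_iff using True by simp
      then have rj: "real j = of_int \<lfloor>r + real n\<rfloor>" unfolding j_def by (rule of_nat_nat)
      have j: "real j \<le> r + real n" "r + real n < real j + 1" unfolding rj by linarith+
      have "j < 2 * n" using j True by simp
      then have "X r * indicator {- real n + real j..<- real n + real j + 1} r \<le> (\<Sum>j<2 * n. X r * indicator {- real n + real j..<- real n + real j + 1} r)"
        by (intro member_le_sum) auto
      moreover have "r \<in> {- real n + real j..<- real n + real j + 1}" using j by auto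
      ultimately show ?thesis using True by simp
    qed simp
    then have "(\<integral>\<^sup>+r. X r * indicator {- real n..<real n} r \<partial>lborel)
      \<le> (\<integral>\<^sup>+r. (\<Sum>j<2 * n. X r * indicator {- real n + real j..<- real n + real j + 1} r) \<partial>lborel)"
      by (intro nn_integral_mono)
    also have "\<dots> = (\<Sum>j<2 * n. \<integral>\<^sup>+r. X r * indicator {- real n + real j..<- real n + real j + 1} r \<partial>lborel)"
      by (intro nn_integral_sum) auto
    also have "\<dots> = (\<Sum>j<2 * n. \<integral>\<^sup>+r. X (r - real n + real j) * indicator {0..<1} r \<partial>lborel)"
    proof (rule sum.cong[OF refl])
      fix j
      have "(\<integral>\<^sup>+r. X r * indicator {- real n + real j..<- real n + real j + 1} r \<partial>lborel)
         = (\<integral>\<^sup>+r. X (r + (real j - real n)) * indicator {- real n + real j..<- real n + real j + 1} (r + (real j - real n)) \<partial>lborel)"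
        by (rule nn_integral_lborel_translate[symmetric]) measurable
      also have "\<dots> = (\<integral>\<^sup>+r. X (r - real n + real j) * indicator {0..<1} r \<partial>lborel)"
        by (intro nn_integral_cong) (auto simp: indicator_def algebra_simps)
      finally show "(\<integral>\<^sup>+r. X r * indicator {- real n + real j..<- real n + real j + 1} r \<partial>lborel) = \<dots>" .
    qed
    also have "\<dots> = (\<integral>\<^sup>+r. (\<Sum>j<2 * n. X (r - real n + real j)) * indicator {0..<1} r \<partial>lborel)"
      by (subst nn_integral_sum[symmetric]) (auto simp: sum_distrib_right)
    also have "\<dots> \<le> (\<integral>\<^sup>+r. F * indicator {0..<1::real} r \<partial>lborel)"
      by (intro nn_integral_mono mult_right_mono le) auto
    also have "\<dots> = F" by (simp add: nn_integral_cmult_indicator)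
    finally show ?thesis .
  qed
  have "(\<lambda>n. \<integral>\<^sup>+r. X r * indicator {- real n..<real n} r \<partial>lborel) \<longlonglongrightarrow> (\<integral>\<^sup>+r. X r \<partial>lborel)"
  proof (rule nn_integral_LIMSEQ)
    show "incseq (\<lambda>n r. X r * indicator {- real n..<real n} r)"
      by (auto simp: incseq_def le_fun_def intro!: mult_left_mono indicator_leI)
    show "(\<lambda>n. X r * indicator {- real n..<real n} r) \<longlonglongrightarrow> X r" for r
    proof (rule tendsto_eventually)
      show "\<forall>\<^sub>F n in sequentially. X r * indicator {- real n..<real n} r = X r"
        using eventually_gt_at_top[of "nat \<lceil>\<bar>r\<bar>\<rceil>"]
      proof eventually_elim
        case (elim n)
        then have "\<bar>r\<bar> < real n" by linarith
        then show ?case by (auto simp: indicator_def)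
      qed
    qed
  qed auto
  then show ?thesis using bd by (intro LIMSEQ_le_const2) auto
qed

text \<open>The denominator is the gain in \<open>avg_perspective_gap\<close>; the numerator is the
  Harnack loss in passing to the weight at the integer index \<open>\<lfloor>r\<rfloor> + 3\<close>,
  a scale larger by a factor of at most \<open>half_pow 3\<close>.\<close>

definition dual_const :: "real \<Rightarrow> real" where
  "dual_const \<beta> = (half_pow 3 * exp (1 / 2)) powr \<beta> / (perspective_const \<beta> * std_normal_density 1 / 2)"

lemma dual_const_pos: "0 < \<beta> \<Longrightarrow> \<beta> < 1 \<Longrightarrow> 0 < dual_const \<beta>"
  unfolding dual_const_def using perspective_const_pos[of \<beta>] normal_density_pos[of 1 0 1] half_pow_pos[of 3]
  by (intro divide_pos_pos mult_pos_pos) (simp_all add: less_le)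

text \<open>Along r, r + 1, r + 2, ... the quantity \<open>G\<close> drops by at least a multiple of
  the oscillation \<open>X\<close>, starts below the right side and stays nonnegative; so the sums
  of \<open>X\<close> over unit steps are bounded uniformly in the starting scale.\<close>

lemma dual_square_function:
  fixes a :: "'a::euclidean_space" and u :: "'a \<Rightarrow> complex" and v :: "'a \<Rightarrow> real"
  assumes \<beta>: "0 < \<beta>" "\<beta> < 1"
    and [measurable]: "u \<in> borel_measurable borel" "v \<in> borel_measurable borel"
    and ub: "\<And>y. cmod (u y) \<le> B" and e: "0 < e" and vb: "\<And>y. e \<le> v y" "\<And>y. v y \<le> B'"
  shows "(\<integral>\<^sup>+r. (\<integral>\<^sup>+x. ennreal ((cmod (haar_op a (half_pow r) (avg a (half_pow r) u) x))\<^sup>2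
          / (avg a (half_pow (of_int \<lfloor>r\<rfloor> + 3)) v x) powr \<beta>) \<partial>lborel) \<partial>lborel)
      \<le> ennreal (dual_const \<beta>) * (\<integral>\<^sup>+x. ennreal ((cmod (u x))\<^sup>2 / v x powr \<beta>) \<partial>lborel)"
proof -
  define c where "c = perspective_const \<beta> * std_normal_density 1 / 2"
  have c: "0 < c" unfolding c_def using perspective_const_pos[OF \<beta>] normal_density_pos[of 1 0 1] by simp
  note gap = avg_perspective_gap[OF \<beta>, folded c_def]
  define K where "K = half_pow 3 * exp (1 / 2)"
  have K: "0 < K" by (simp add: K_def)
  define c' where "c' = c / K powr \<beta>"
  have c': "0 < c'" using c K by (simp add: c'_def)
  have C: "dual_const \<beta> = 1 / c'" by (simp add: dual_const_def c'_def c_def K_def)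
  define U where "U r = avg a (half_pow r) u" for r
  define V where "V r = avg a (half_pow r) v" for r
  define W where "W r = V (of_int \<lfloor>r\<rfloor> + 3)" for r :: real
  have Um [measurable]: "U r \<in> borel_measurable borel" and Vm [measurable]: "V r \<in> borel_measurable borel" for r
    unfolding U_def V_def by measurable
  have Ub: "cmod (U r y) \<le> B" for r y unfolding U_def by (rule norm_avg_le[OF ub])
  have Vb: "e \<le> V r y" "V r y \<le> B'" for r y unfolding V_def using avg_bounds[of v e B'] vb by auto
  have v0: "0 \<le> v y" for y using e vb(1)[of y] by linarith
  have V0: "0 < V r y" for r y using e Vb(1)[of r y] by linarith
  have U1: "avg a (half_pow r) (U r) = U (r + 1)" for r
    unfolding U_def half_pow_add1 by (rule ext, rule avg_avg[OF _ ub]) measurable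
  have V1: "avg a (half_pow r) (V r) = V (r + 1)" for r
    unfolding V_def half_pow_add1 by (rule ext, rule avg_avg[of v B']) (use vb v0 in \<open>auto simp: abs_of_nonneg\<close>)
  define F where "F = (\<integral>\<^sup>+x. ennreal ((cmod (u x))\<^sup>2 / v x powr \<beta>) \<partial>lborel)"
  define G where "G r = (\<integral>\<^sup>+x. ennreal ((cmod (U r x))\<^sup>2 / V r x powr \<beta>) \<partial>lborel)" for r
  define X where "X r = (\<integral>\<^sup>+x. ennreal ((cmod (haar_op a (half_pow r) (U r) x))\<^sup>2 / W r x powr \<beta>) \<partial>lborel)" for r
  have qb: "(cmod (p y))\<^sup>2 / z y powr \<beta> \<le> B\<^sup>2 / e powr \<beta>" if "cmod (p y) \<le> B" "e \<le> z y" for p :: "'a \<Rightarrow> complex" and z y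
    using that e \<beta> by (intro frac_le power_mono powr_mono2) auto
  \<comment> \<open>Jensen without remainder: the gap term is discarded, with the crude bound B' in
    the role of M.\<close>
  have start: "G r \<le> F" for r
  proof -
    have "G r \<le> (\<integral>\<^sup>+x. ennreal (avg a (half_pow r) (\<lambda>y. (cmod (u y))\<^sup>2 / v y powr \<beta>) x) \<partial>lborel)"
      unfolding G_def
    proof (intro nn_integral_mono ennreal_leI)
      fix x
      have "(cmod (U r x))\<^sup>2 / V r x powr \<beta> + c * ((cmod (haar_op a (half_pow r) u x))\<^sup>2 / B' powr \<beta>)
        \<le> avg a (half_pow r) (\<lambda>y. (cmod (u y))\<^sup>2 / v y powr \<beta>) x"
        unfolding U_def V_def by (rule gap[OF _ _ ub e vb]) (use vb Vb[of r x] in \<open>auto simp: V_def\<close>)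
      moreover have "0 \<le> c * ((cmod (haar_op a (half_pow r) u x))\<^sup>2 / B' powr \<beta>)" using c by simp
      ultimately show "(cmod (U r x))\<^sup>2 / V r x powr \<beta> \<le> avg a (half_pow r) (\<lambda>y. (cmod (u y))\<^sup>2 / v y powr \<beta>) x" by linarith
    qed
    also have "\<dots> = F" unfolding F_def by (rule nn_integral_avg[where B="B\<^sup>2 / e powr \<beta>"]) (use qb ub vb in auto)
    finally show ?thesis .
  qed
  have step: "ennreal c' * X r + G (r + 1) \<le> G r" for r
  proof -
    have fl: "r < of_int \<lfloor>r\<rfloor> + 1" "of_int \<lfloor>r\<rfloor> \<le> r" by linarith+
    \<comment> \<open>Needed for s = r and for s = r + 1, because the gap lemma asks for a common
      bound on the weight \<open>V r\<close> near x and on its average \<open>V (r + 1)\<close>. The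
      offset 3 makes \<open>sqrt 2 * half_pow s\<close> admissible for all these s.\<close>
    have H: "avg a (half_pow s) v (x + d *\<^sub>R a) \<le> K * W r x"
      if s: "r \<le> s" "s \<le> r + 1" and d: "\<bar>d\<bar> \<le> half_pow s" for s d x
    proof -
      have "sqrt 2 * half_pow s \<le> half_pow (of_int \<lfloor>r\<rfloor> + 3)"
        using half_pow_mono[of "s + 1" "of_int \<lfloor>r\<rfloor> + 3"] s fl by (simp add: half_pow_add1)
      from avg_Harnack[OF _ v0 vb(2) half_pow_pos this, where d=d and D=1 and a=a and x=x] d
      have "avg a (half_pow s) v (x + d *\<^sub>R a) \<le> half_pow (of_int \<lfloor>r\<rfloor> + 3) / half_pow s * exp (1 / 2) * W r x"
        by (simp add: W_def V_def)
      also have "\<dots> \<le> K * W r x"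
      proof -
        have "of_int \<lfloor>r\<rfloor> + 3 - s \<le> 3" using s fl by linarith
        then show ?thesis
          unfolding K_def half_pow_ratio using V0[of _ x] by (intro mult_right_mono half_pow_mono) (auto simp: W_def less_imp_le)
      qed
      finally show ?thesis .
    qed
    have pt: "(cmod (U (r + 1) x))\<^sup>2 / V (r + 1) x powr \<beta> + c' * ((cmod (haar_op a (half_pow r) (U r) x))\<^sup>2 / W r x powr \<beta>)
        \<le> avg a (half_pow r) (\<lambda>y. (cmod (U r y))\<^sup>2 / V r y powr \<beta>) x" for x
    proof -
      have 1: "V r (x + (half_pow r * t) *\<^sub>R a) \<le> K * W r x" if "\<bar>t\<bar> \<le> 1" for t
        unfolding V_def by (rule H) (use that in \<open>auto simp: abs_mult mult_left_le\<close>)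
      have 2: "avg a (half_pow r) (V r) x \<le> K * W r x"
        unfolding V1 using H[of "r + 1" 0 x] by (simp add: V_def less_imp_le)
      have "(K * W r x) powr \<beta> = K powr \<beta> * W r x powr \<beta>" using K V0 by (simp add: powr_mult W_def less_imp_le)
      with gap[OF Um[of r] Vm Ub e Vb 1 2] show ?thesis unfolding U1 V1 by (simp add: c'_def)
    qed
    have "ennreal c' * X r + G (r + 1)
      = (\<integral>\<^sup>+x. ennreal c' * ennreal ((cmod (haar_op a (half_pow r) (U r) x))\<^sup>2 / W r x powr \<beta>) + ennreal ((cmod (U (r + 1) x))\<^sup>2 / V (r + 1) x powr \<beta>) \<partial>lborel)"
      unfolding X_def G_def by (subst nn_integral_add) (auto simp: nn_integral_cmult W_def)
    also have "\<dots> \<le> (\<integral>\<^sup>+x. ennreal (avg a (half_pow r) (\<lambda>y. (cmod (U r y))\<^sup>2 / V r y powr \<beta>) x) \<partial>lborel)"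
    proof (intro nn_integral_mono)
      fix x
      show "ennreal c' * ennreal ((cmod (haar_op a (half_pow r) (U r) x))\<^sup>2 / W r x powr \<beta>) + ennreal ((cmod (U (r + 1) x))\<^sup>2 / V (r + 1) x powr \<beta>)
        \<le> ennreal (avg a (half_pow r) (\<lambda>y. (cmod (U r y))\<^sup>2 / V r y powr \<beta>) x)"
        using pt[of x] c' by (simp add: add.commute ennreal_leI flip: ennreal_mult ennreal_plus)
    qed
    also have "\<dots> = G r" unfolding G_def by (rule nn_integral_avg[where B="B\<^sup>2 / e powr \<beta>"]) (use qb Ub Vb in auto)
    finally show ?thesis .
  qed
  have chain: "ennreal c' * (\<Sum>j<m. X (r + real j)) + G (r + real m) \<le> G r" for r m
  proof (induction m)
    case (Suc m)
    have "ennreal c' * (\<Sum>j<Suc m. X (r + real j)) + G (r + real (Suc m))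
        = ennreal c' * (\<Sum>j<m. X (r + real j)) + (ennreal c' * X (r + real m) + G (r + real m + 1))"
      by (simp add: distrib_left add.assoc add.commute[of 1])
    also have "\<dots> \<le> ennreal c' * (\<Sum>j<m. X (r + real j)) + G (r + real m)"
      by (intro add_left_mono step)
    also note Suc
    finally show ?case .
  qed simp
  have "ennreal c' * (\<Sum>j<m. X (r + real j)) \<le> F" for r m
  proof -
    have "ennreal c' * (\<Sum>j<m. X (r + real j)) \<le> ennreal c' * (\<Sum>j<m. X (r + real j)) + G (r + real m)" by simp
    also note chain
    also note start
    finally show ?thesis .
  qed
  then have "(\<Sum>j<m. ennreal c' * X (r + real j)) \<le> F" for r m by (simp add: sum_distrib_left)
  moreover have Xm [measurable]: "X \<in> borel_measurable borel"
  proof -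
    have "(\<lambda>(r, x). (cmod (haar_op a (half_pow r) (U r) x))\<^sup>2 / W r x powr \<beta>) \<in> borel_measurable (borel \<Otimes>\<^sub>M borel)"
      unfolding haar_op_def U_def W_def V_def avg_def by measurable
    then show ?thesis unfolding X_def[abs_def] by measurable
  qed
  ultimately have "(\<integral>\<^sup>+r. ennreal c' * X r \<partial>lborel) \<le> F"
    by (intro nn_integral_le_of_unit_translates) auto
  then have le: "ennreal c' * (\<integral>\<^sup>+r. X r \<partial>lborel) \<le> F" by (simp add: nn_integral_cmult)
  have "(\<integral>\<^sup>+r. X r \<partial>lborel) = ennreal (1 / c') * (ennreal c' * (\<integral>\<^sup>+r. X r \<partial>lborel))"
    using c' by (simp add: mult.assoc[symmetric] flip: ennreal_mult)
  also have "\<dots> \<le> ennreal (1 / c') * F" by (intro mult_left_mono le) simp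
  finally show ?thesis
    by (simp add: X_def F_def U_def W_def V_def C)
qed

section \<open>Square functions for the sign multiplier\<close>

text \<open>The modulation at frequency b recentres the symbol on the hyperplane
  \<open>a \<bullet> \<xi> = b\<close>: it becomes a function of
  \<open>\<rho> * (a \<bullet> \<xi> - b)\<close>.\<close>

definition mod_conv :: "(real \<Rightarrow> real) \<Rightarrow> 'a::euclidean_space \<Rightarrow> real \<Rightarrow> real \<Rightarrow> ('a \<Rightarrow> complex) \<Rightarrow> 'a \<Rightarrow> complex" where
  "mod_conv \<phi> a b \<rho> f x = (LINT t|lborel. (of_real (\<phi> t) * cis (- (2 * pi * (b * (\<rho> * t))))) * f (x + (\<rho> * t) *\<^sub>R a))"

text \<open>The exponent is positive because \<open>mod_conv\<close> evaluates at
  \<open>x + (\<rho> * t) *\<^sub>R a\<close>, so the kernel acts by correlation.\<close>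

definition symbol :: "(real \<Rightarrow> real) \<Rightarrow> real \<Rightarrow> complex" where
  "symbol \<phi> z = (LINT t|lborel. of_real (\<phi> t) * cis (2 * pi * (t * z)))"

lemma mod_conv_kernel_integrable:
  assumes \<phi>: "integrable lborel \<phi>"
  shows "integrable lborel (\<lambda>t. of_real (\<phi> t) * cis (- (2 * pi * (b * (\<rho> * t)))))"
    and "(LINT t|lborel. cmod (of_real (\<phi> t) * cis (- (2 * pi * (b * (\<rho> * t)))))) = (LINT t|lborel. \<bar>\<phi> t\<bar>)"
proof -
  have [measurable]: "\<phi> \<in> borel_measurable borel" using \<phi> by auto
  show "integrable lborel (\<lambda>t. of_real (\<phi> t) * cis (- (2 * pi * (b * (\<rho> * t)))))"
    by (rule Bochner_Integration.integrable_bound[OF \<phi>]) (auto simp: norm_mult)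
qed (simp add: norm_mult)

lemma
  assumes \<phi>: "integrable lborel \<phi>" and f: "f \<in> L2_borel"
  shows L2_mod_conv: "mod_conv \<phi> a b \<rho> f \<in> L2_borel"
    and FT_mod_conv: "AE \<xi> in lborel. FT (mod_conv \<phi> a b \<rho> f) \<xi> = symbol \<phi> (\<rho> * (a \<bullet> \<xi> - b)) * FT f \<xi>"
proof -
  note i = mod_conv_kernel_integrable[OF \<phi>, of b \<rho>]
  have eq: "mod_conv \<phi> a b \<rho> f = (\<lambda>x. LINT t|lborel. (of_real (\<phi> t) * cis (- (2 * pi * (b * (\<rho> * t))))) * f (x + (\<rho> * t) *\<^sub>R a))"
    by (rule ext) (simp add: mod_conv_def)
  show "mod_conv \<phi> a b \<rho> f \<in> L2_borel" unfolding eq by (rule L2_conv[OF i(1) _ f]) measurable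
  have s: "(LINT t|lborel. (of_real (\<phi> t) * cis (- (2 * pi * (b * (\<rho> * t))))) * cis (2 * pi * (((\<rho> * t) *\<^sub>R a) \<bullet> \<xi>)))
    = symbol \<phi> (\<rho> * (a \<bullet> \<xi> - b))" for \<xi>
    unfolding symbol_def mult.assoc cis_mult by (simp add: algebra_simps)
  show "AE \<xi> in lborel. FT (mod_conv \<phi> a b \<rho> f) \<xi> = symbol \<phi> (\<rho> * (a \<bullet> \<xi> - b)) * FT f \<xi>"
    using FT_conv[OF i(1) _ f, of "\<lambda>t. (\<rho> * t) *\<^sub>R a"] unfolding eq s by simp
qed

text \<open>The transform of \<open>haar\<close> up to the factor i, hence real and odd. Division by
  zero gives the correct value 0 at the origin.\<close>

definition haar_symbol :: "real \<Rightarrow> real" where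
  "haar_symbol z = (1 - cos (2 * pi * z)) / (pi * z)"

lemma haar_symbol_measurable [measurable]: "haar_symbol \<in> borel_measurable borel"
  unfolding haar_symbol_def[abs_def] by measurable

lemma symbol_haar: "symbol haar z = \<i> * of_real (haar_symbol z)"
proof (cases "z = 0")
  case True
  then show ?thesis by (simp add: symbol_def haar_symbol_def integral_haar)
next
  case False
  define F where "F t = cis (2 * pi * (t * z)) / (2 * pi * \<i> * z)" for t
  have d: "(F has_vector_derivative cis (2 * pi * (t * z))) (at t within A)" for t A
  proof -
    have "((\<lambda>w. exp (\<i> * (2 * pi * z) * w) / (2 * pi * \<i> * z)) has_field_derivative exp (\<i> * (2 * pi * z) * of_real t)) (at (of_real t))"
      using False by (auto intro!: derivative_eq_intros simp: field_simps)
    from has_vector_derivative_real_field[OF this] show ?thesis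
      unfolding F_def cis_conv_exp by (simp add: mult_ac)
  qed
  have c: "continuous_on A (\<lambda>t. cis (2 * pi * (t * z)))" for A by (intro continuous_intros)
  have i: "has_bochner_integral lborel (\<lambda>t. indicator {u..v} t *\<^sub>R cis (2 * pi * (t * z))) (F v - F u)" if "u \<le> v" for u v
    using that by (intro has_bochner_integral_FTC_Icc d c)
  have "has_bochner_integral lborel (\<lambda>t. indicator {0..1} t *\<^sub>R cis (2 * pi * (t * z)) - indicator {-1..0} t *\<^sub>R cis (2 * pi * (t * z)))
      ((F 1 - F 0) - (F 0 - F (-1)))"
    by (intro has_bochner_integral_diff i) auto
  then have "symbol haar z = (F 1 - F 0) - (F 0 - F (-1))"
    unfolding symbol_def haar_def by (simp add: has_bochner_integral_iff scaleR_conv_of_real left_diff_distrib)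
  also have "\<dots> = (cis (2 * pi * z) + cis (- (2 * pi * z)) - 2) / (2 * pi * \<i> * z)"
    by (simp add: F_def diff_divide_distrib add_divide_distrib)
  also have "cis (2 * pi * z) + cis (- (2 * pi * z)) = of_real (2 * cos (2 * pi * z))"
    by (simp add: complex_eq_iff)
  also have "\<dots> - 2 = \<i> * of_real (haar_symbol z) * (2 * pi * \<i> * z)"
    using False by (simp add: complex_eq_iff haar_symbol_def)
  finally show ?thesis using False by simp
qed

lemma symbol_std_normal: "symbol std_normal_density z = of_real (exp (- (2 * pi\<^sup>2 * z\<^sup>2)))"
proof -
  have "symbol std_normal_density z = char std_normal_distribution (2 * pi * z)"
    unfolding char_def symbol_def
    by (subst integral_density) (auto simp: scaleR_conv_of_real cis_conv_exp mult_ac)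
  then show ?thesis by (simp add: char_std_normal_distribution power_mult_distrib)
qed

text \<open>Decay at both ends of the scale axis: linear at 0, reciprocal at infinity. The second
  constant is enlarged to 2 pi so that the two bounds merge into
  \<open>2 * pi * half_pow (- \<bar>r\<bar>)\<close>.\<close>

lemma abs_haar_symbol_le: "\<bar>haar_symbol z\<bar> \<le> 2 * pi * \<bar>z\<bar>" "\<bar>haar_symbol z\<bar> \<le> 2 * pi / \<bar>z\<bar>"
proof -
  have "\<bar>haar_symbol z\<bar> \<le> 2 * pi * \<bar>z\<bar> \<and> \<bar>haar_symbol z\<bar> \<le> 2 * pi / \<bar>z\<bar>"
  proof (cases "z = 0")
    case False
    have h: "\<bar>haar_symbol z\<bar> = (1 - cos (2 * pi * z)) / (pi * \<bar>z\<bar>)"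
      by (simp add: haar_symbol_def abs_mult)
    have "1 - cos (2 * pi * z) = 2 * (sin (pi * z))\<^sup>2" using cos_double_sin[of "pi * z"] by (simp add: mult.assoc)
    also have "\<dots> \<le> 2 * (pi * z)\<^sup>2"
      using power_mono[OF abs_sin_x_le_abs_x[of "pi * z"], of 2] by simp
    finally have "\<bar>haar_symbol z\<bar> \<le> 2 * (pi * z)\<^sup>2 / (pi * \<bar>z\<bar>)"
      unfolding h by (rule divide_right_mono) simp
    also have "\<dots> = 2 * pi * \<bar>z\<bar>" using False by (simp add: power2_eq_square field_simps abs_if)
    finally have 1: "\<bar>haar_symbol z\<bar> \<le> 2 * pi * \<bar>z\<bar>" .
    have "1 - cos (2 * pi * z) \<le> 2" using cos_ge_minus_one[of "2 * pi * z"] by linarith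
    then have "\<bar>haar_symbol z\<bar> \<le> 2 / (pi * \<bar>z\<bar>)" unfolding h by (rule divide_right_mono) simp
    also have "\<dots> \<le> 2 * pi / \<bar>z\<bar>"
    proof -
      have "1 * 1 \<le> pi * pi" using pi_ge_two by (intro mult_mono) auto
      then show ?thesis using False by (simp add: field_simps)
    qed
    finally show ?thesis using 1 by simp
  qed (simp add: haar_symbol_def)
  then show "\<bar>haar_symbol z\<bar> \<le> 2 * pi * \<bar>z\<bar>" "\<bar>haar_symbol z\<bar> \<le> 2 * pi / \<bar>z\<bar>" by auto
qed

lemma haar_symbol_half_pow_le: "\<bar>haar_symbol (half_pow r)\<bar> \<le> 2 * pi * half_pow (- \<bar>r\<bar>)"
proof -
  have "1 / half_pow r = half_pow (- r)" using half_pow_ratio[of 0 r] by (simp add: half_pow_def[of 0])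
  moreover have "2 * pi / half_pow r = 2 * pi * (1 / half_pow r)" by simp
  ultimately have "2 * pi / half_pow r = 2 * pi * half_pow (- r)" by (simp only:)
  then show ?thesis using abs_haar_symbol_le[of "half_pow r"] by (cases "0 \<le> r") simp_all
qed

lemma haar_symbol_sgn: "haar_symbol (x * sgn z) = haar_symbol x * sgn z"
  by (cases "z = 0"; cases "0 < z") (simp_all add: haar_symbol_def sgn_if)

text \<open>Dilation by |z| is a translation of the scale index by twice the binary logarithm of
  |z|; Lebesgue measure in r is thus a dilation-invariant measure on scales.\<close>

lemma half_pow_log:
  assumes "z \<noteq> 0"
  obtains l where "\<And>r. half_pow r * z = half_pow (r + l) * sgn z"
proof
  have "half_pow (2 * log 2 \<bar>z\<bar>) = \<bar>z\<bar>" using assms by (simp add: half_pow_def)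
  then show "half_pow r * z = half_pow (r + 2 * log 2 \<bar>z\<bar>) * sgn z" for r
    by (simp add: half_pow_add mult.assoc abs_mult_sgn)
qed

lemma half_pow_abs_power_integrable:
  assumes "0 < n"
  shows "integrable lborel (\<lambda>r. half_pow (- \<bar>r\<bar>) ^ n)"
proof -
  define l where "l = real n * ln 2 / 2"
  have l: "0 < l" using assms by (simp add: l_def)
  have e: "half_pow (- \<bar>r\<bar>) ^ n = exp (- (\<bar>r\<bar> * l))" for r
    by (simp add: half_pow_def powr_def l_def exp_of_nat_mult[symmetric])
  have i: "integrable lborel (exponential_density l)"
  proof -
    interpret prob_space "density lborel (exponential_density l)" by (rule prob_space_exponential_density[OF l])
    have "(\<integral>\<^sup>+x. ennreal (exponential_density l x) \<partial>lborel) = 1"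
      using emeasure_space_1 by (simp add: emeasure_density)
    then show ?thesis by (intro integrableI_nonneg) (auto simp: exponential_density_nonneg[OF l])
  qed
  have i2: "integrable lborel (\<lambda>r. exponential_density l (0 + (-1) * r))"
    by (rule lborel_integrable_real_affine[OF i]) simp
  show ?thesis
  proof (rule Bochner_Integration.integrable_bound[of _ "\<lambda>r. (exponential_density l r + exponential_density l (- r)) / l"])
    show "integrable lborel (\<lambda>r. (exponential_density l r + exponential_density l (- r)) / l)" using i i2 by simp
    show "AE r in lborel. norm (half_pow (- \<bar>r\<bar>) ^ n) \<le> norm ((exponential_density l r + exponential_density l (- r)) / l)"
      unfolding e using l by (intro AE_I2) (auto simp: exponential_density_def add_divide_distrib)
  qed measurable
qed

text \<open>Bounds the integral of the fourth power of \<open>haar_symbol\<close> over all scales: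
  the symbol of \<open>haar_sq\<close> is quadratic in it, and Plancherel squares once more.\<close>

definition square_const :: real where
  "square_const = (LINT r|lborel. (2 * pi * half_pow (- \<bar>r\<bar>)) ^ 4)"

lemma nn_integral_haar_symbol_le:
  "(\<integral>\<^sup>+r. ennreal (haar_symbol (half_pow r * z) ^ 4) \<partial>lborel) \<le> ennreal square_const"
proof (cases "z = 0")
  case False
  then obtain l where l: "\<And>r. half_pow r * z = half_pow (r + l) * sgn z" by (rule half_pow_log) blast
  have i: "integrable lborel (\<lambda>r. (2 * pi * half_pow (- \<bar>r\<bar>)) ^ 4)"
    unfolding power_mult_distrib by (intro integrable_mult_right half_pow_abs_power_integrable) simp
  have "haar_symbol (half_pow r * z) ^ 4 = haar_symbol (half_pow (r + l)) ^ 4" for r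
    using False unfolding l haar_symbol_sgn power_mult_distrib by (cases "z > 0") auto
  then have "(\<integral>\<^sup>+r. ennreal (haar_symbol (half_pow r * z) ^ 4) \<partial>lborel) = (\<integral>\<^sup>+r. ennreal (haar_symbol (half_pow (r + l)) ^ 4) \<partial>lborel)"
    by (simp only:)
  also have "\<dots> = (\<integral>\<^sup>+r. ennreal (haar_symbol (half_pow r) ^ 4) \<partial>lborel)"
    by (rule nn_integral_lborel_translate) measurable
  also have "\<dots> \<le> (\<integral>\<^sup>+r. ennreal ((2 * pi * half_pow (- \<bar>r\<bar>)) ^ 4) \<partial>lborel)"
  proof (intro nn_integral_mono ennreal_leI)
    fix r
    have "haar_symbol (half_pow r) ^ 4 = \<bar>haar_symbol (half_pow r)\<bar> ^ 4" by (simp add: power_even_abs)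
    also have "\<dots> \<le> (2 * pi * half_pow (- \<bar>r\<bar>)) ^ 4"
      by (rule power_mono[OF haar_symbol_half_pow_le]) simp
    finally show "haar_symbol (half_pow r) ^ 4 \<le> (2 * pi * half_pow (- \<bar>r\<bar>)) ^ 4" .
  qed
  also have "\<dots> = ennreal square_const"
    unfolding square_const_def by (rule nn_integral_eq_integral[OF i]) (simp add: less_imp_le)
  finally show ?thesis .
qed (simp add: haar_symbol_def)

definition reproducing_const :: real where
  "reproducing_const = (LINT r|lborel. haar_symbol (half_pow r) ^ 3 * exp (- (2 * pi\<^sup>2 * (half_pow r)\<^sup>2)))"

text \<open>By \<open>half_pow_log\<close> the integral over scales depends on z only through its
  sign, and the odd power 3 retains that sign. The version with absolute values serves Fubini's
  theorem later.\<close>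

lemma reproducing_formula:
  assumes "z \<noteq> 0"
  shows "integrable lborel (\<lambda>r. haar_symbol (half_pow r * z) ^ 3 * exp (- (2 * pi\<^sup>2 * (half_pow r * z)\<^sup>2)))"
    and "(LINT r|lborel. haar_symbol (half_pow r * z) ^ 3 * exp (- (2 * pi\<^sup>2 * (half_pow r * z)\<^sup>2))) = reproducing_const * sgn z"
    and "(LINT r|lborel. \<bar>haar_symbol (half_pow r * z) ^ 3 * exp (- (2 * pi\<^sup>2 * (half_pow r * z)\<^sup>2))\<bar>) = reproducing_const"
proof -
  define k where "k r = haar_symbol (half_pow r) ^ 3 * exp (- (2 * pi\<^sup>2 * (half_pow r)\<^sup>2))" for r
  have [measurable]: "k \<in> borel_measurable borel" unfolding k_def[abs_def] by measurable
  have k0: "0 \<le> k r" for r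
    unfolding k_def haar_symbol_def by (intro mult_nonneg_nonneg zero_le_power divide_nonneg_pos) auto
  have k: "integrable lborel k"
  proof (rule Bochner_Integration.integrable_bound[of _ "\<lambda>r. (2 * pi * half_pow (- \<bar>r\<bar>)) ^ 3"])
    show "integrable lborel (\<lambda>r. (2 * pi * half_pow (- \<bar>r\<bar>)) ^ 3)"
      unfolding power_mult_distrib by (intro integrable_mult_right half_pow_abs_power_integrable) simp
    have "\<bar>k r\<bar> \<le> (2 * pi * half_pow (- \<bar>r\<bar>)) ^ 3 * 1" for r
      unfolding k_def abs_mult power_abs by (intro mult_mono power_mono haar_symbol_half_pow_le) auto
    then show "AE r in lborel. norm (k r) \<le> norm ((2 * pi * half_pow (- \<bar>r\<bar>)) ^ 3)" by (auto simp: abs_of_nonneg less_imp_le)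
  qed measurable
  obtain l where l: "\<And>r. half_pow r * z = half_pow (r + l) * sgn z" using assms by (rule half_pow_log) blast
  have s: "(sgn z)\<^sup>2 = 1" "sgn z ^ 3 = sgn z" "\<bar>sgn z\<bar> = 1" using assms by (auto simp: sgn_if)
  have eq: "haar_symbol (half_pow r * z) ^ 3 * exp (- (2 * pi\<^sup>2 * (half_pow r * z)\<^sup>2)) = k (l + 1 * r) * sgn z" for r
    unfolding l haar_symbol_sgn power_mult_distrib s k_def by (simp add: add.commute)
  have ki: "integrable lborel (\<lambda>r. k (l + 1 * r))" by (rule lborel_integrable_real_affine[OF k]) simp
  have kI: "(LINT r|lborel. k (l + 1 * r)) = reproducing_const"
    using lborel_integral_real_affine[of 1 k l] by (simp add: reproducing_const_def k_def)
  show "integrable lborel (\<lambda>r. haar_symbol (half_pow r * z) ^ 3 * exp (- (2 * pi\<^sup>2 * (half_pow r * z)\<^sup>2)))"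
    unfolding eq using ki by simp
  show "(LINT r|lborel. haar_symbol (half_pow r * z) ^ 3 * exp (- (2 * pi\<^sup>2 * (half_pow r * z)\<^sup>2))) = reproducing_const * sgn z"
    unfolding eq using kI by simp
  show "(LINT r|lborel. \<bar>haar_symbol (half_pow r * z) ^ 3 * exp (- (2 * pi\<^sup>2 * (half_pow r * z)\<^sup>2))\<bar>) = reproducing_const"
    unfolding eq abs_mult s using kI k0 by (simp add: abs_of_nonneg)
qed

lemma reproducing_const_pos: "0 < reproducing_const"
proof -
  define k where "k r = haar_symbol (half_pow r) ^ 3 * exp (- (2 * pi\<^sup>2 * (half_pow r)\<^sup>2))" for r
  have k0: "0 \<le> k r" for r
    unfolding k_def haar_symbol_def by (intro mult_nonneg_nonneg zero_le_power divide_nonneg_pos) auto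
  have i: "integrable lborel k" using reproducing_formula(1)[of 1] by (simp add: k_def[abs_def])
  have "reproducing_const \<noteq> 0"
  proof
    assume "reproducing_const = 0"
    then have "integral\<^sup>L lborel k = 0" by (simp add: reproducing_const_def k_def[abs_def])
    then have "AE r in lborel. k r = 0" using integral_nonneg_eq_0_iff_AE[OF i] k0 by simp
    \<comment> \<open>Here \<open>half_pow r\<close> is less than 1/2, so the argument of the cosine
      lies strictly between 0 and pi.\<close>
    moreover have "k r \<noteq> 0" if "r \<in> {-4<..<-2}" for r
    proof -
      have h: "half_pow r < half_pow (- 2)" unfolding half_pow_def by (rule powr_less_mono) (use that in auto)
      moreover have "half_pow (-2) = 1/2" by (simp add: half_pow_def powr_minus)
      ultimately have "cos (2 * pi * half_pow r) < cos 0"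
        by (intro cos_monotone_0_pi) (auto simp: less_imp_le)
      then show ?thesis using half_pow_pos[of r] by (simp add: k_def haar_symbol_def del: half_pow_pos)
    qed
    ultimately have "AE r in lborel. r \<notin> {-4<..<-2::real}" by (auto elim: AE_mp)
    then have "{-4<..<-2::real} \<in> null_sets lborel" by (subst AE_iff_null_sets) auto
    then have "emeasure lborel {-4<..<-2::real} = 0" by (rule null_setsD1)
    then show False by simp
  qed
  moreover have "0 \<le> reproducing_const" using k0 by (simp add: reproducing_const_def k_def)
  ultimately show ?thesis by simp
qed

text \<open>Two Haar factors, because with the single one in \<open>haar_gauss\<close> they give an
  odd symbol; an even total could not reproduce a sign.\<close>

definition haar_sq :: "'a::euclidean_space \<Rightarrow> real \<Rightarrow> real \<Rightarrow> ('a \<Rightarrow> complex) \<Rightarrow> 'a \<Rightarrow> complex" where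
  "haar_sq a b r f = mod_conv haar a b (half_pow r) (mod_conv haar a b (half_pow r) f)"

lemma haar_sq_measurable_pair [measurable]:
  assumes [measurable]: "f \<in> borel_measurable borel"
  shows "(\<lambda>(r, x). haar_sq a b r f x) \<in> borel_measurable (borel \<Otimes>\<^sub>M borel)"
  unfolding haar_sq_def mod_conv_def by measurable

lemma
  assumes f: "f \<in> L2_borel"
  shows L2_haar_sq: "haar_sq a b r f \<in> L2_borel"
    and FT_haar_sq: "AE \<xi> in lborel. FT (haar_sq a b r f) \<xi> = - of_real ((haar_symbol (half_pow r * (a \<bullet> \<xi> - b)))\<^sup>2) * FT f \<xi>"
proof -
  note L = L2_mod_conv[OF integrable_haar]
  show "haar_sq a b r f \<in> L2_borel" unfolding haar_sq_def by (intro L f)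
  show "AE \<xi> in lborel. FT (haar_sq a b r f) \<xi> = - of_real ((haar_symbol (half_pow r * (a \<bullet> \<xi> - b)))\<^sup>2) * FT f \<xi>"
    using FT_mod_conv[OF integrable_haar f, of a b "half_pow r"] FT_mod_conv[OF integrable_haar L[OF f], of a b "half_pow r" a b "half_pow r"]
    unfolding haar_sq_def
  proof eventually_elim
    case (elim \<xi>)
    have "(\<i> * x) * ((\<i> * x) * y) = (\<i> * \<i>) * (x * x * y)" for x y by (simp only: mult_ac)
    then show ?case unfolding elim(2) elim(1) symbol_haar by (simp add: power2_eq_square)
  qed
qed

text \<open>Two Haar convolutions reach no further than \<open>2 * half_pow r\<close>, which is
  \<open>half_pow (r + 2)\<close>. This locality feeds the layer-cake argument.\<close>

lemma haar_sq_cong: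
  assumes "\<And>d. \<bar>d\<bar> \<le> half_pow (of_int \<lfloor>r\<rfloor> + 3) \<Longrightarrow> f (x + d *\<^sub>R a) = g (x + d *\<^sub>R a)"
  shows "haar_sq a b r f x = haar_sq a b r g x"
proof -
  have "r + 2 \<le> of_int \<lfloor>r\<rfloor> + 3" by linarith
  from half_pow_mono[OF this] have r: "2 * half_pow r \<le> half_pow (of_int \<lfloor>r\<rfloor> + 3)"
    by (simp add: half_pow_add[of r 2]) (simp add: half_pow_def)
  have ts: "f (x + (half_pow r * t) *\<^sub>R a + (half_pow r * s) *\<^sub>R a) = g (x + (half_pow r * t) *\<^sub>R a + (half_pow r * s) *\<^sub>R a)"
    if "\<bar>t\<bar> \<le> 1" "\<bar>s\<bar> \<le> 1" for t s
  proof -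
    have "\<bar>half_pow r * (t + s)\<bar> \<le> half_pow r * 2"
      unfolding abs_mult using that by (intro mult_mono) (auto simp: less_imp_le)
    then have "\<bar>half_pow r * (t + s)\<bar> \<le> half_pow (of_int \<lfloor>r\<rfloor> + 3)" using r by linarith
    from assms[OF this] show ?thesis by (simp add: algebra_simps)
  qed
  have h0: "haar t = 0" if "\<not> \<bar>t\<bar> \<le> 1" for t using that by (auto simp: haar_def indicator_def)
  have inner: "mod_conv haar a b (half_pow r) f (x + (half_pow r * t) *\<^sub>R a) = mod_conv haar a b (half_pow r) g (x + (half_pow r * t) *\<^sub>R a)"
    if t: "\<bar>t\<bar> \<le> 1" for t
    unfolding mod_conv_def
  proof (rule Bochner_Integration.integral_cong[OF refl])
    fix s
    show "of_real (haar s) * cis (- (2 * pi * (b * (half_pow r * s)))) * f (x + (half_pow r * t) *\<^sub>R a + (half_pow r * s) *\<^sub>R a)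
      = of_real (haar s) * cis (- (2 * pi * (b * (half_pow r * s)))) * g (x + (half_pow r * t) *\<^sub>R a + (half_pow r * s) *\<^sub>R a)"
      using ts[OF t, of s] h0[of s] by (cases "\<bar>s\<bar> \<le> 1") auto
  qed
  show ?thesis
    unfolding haar_sq_def mod_conv_def[of haar a b "half_pow r" "mod_conv haar a b (half_pow r) _" x]
  proof (rule Bochner_Integration.integral_cong[OF refl])
    fix t
    show "of_real (haar t) * cis (- (2 * pi * (b * (half_pow r * t)))) * mod_conv haar a b (half_pow r) f (x + (half_pow r * t) *\<^sub>R a)
      = of_real (haar t) * cis (- (2 * pi * (b * (half_pow r * t)))) * mod_conv haar a b (half_pow r) g (x + (half_pow r * t) *\<^sub>R a)"
      using inner[of t] h0[of t] by (cases "\<bar>t\<bar> \<le> 1") auto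
  qed
qed

text \<open>Plancherel in x, then Fubini: at each frequency the fourth power of the symbol,
  integrated over the scales, is at most \<open>square_const\<close>.\<close>

lemma haar_sq_square_function:
  assumes f: "f \<in> L2_borel"
  shows "(\<integral>\<^sup>+r. (\<integral>\<^sup>+x. ennreal ((cmod (haar_sq a b r f x))\<^sup>2) \<partial>lborel) \<partial>lborel)
    \<le> ennreal square_const * (\<integral>\<^sup>+x. ennreal ((cmod (f x))\<^sup>2) \<partial>lborel)"
proof -
  note [measurable] = L2_borel_measurable[OF f] L2_borel_measurable[OF L2_FT[OF f]]
  have "(\<integral>\<^sup>+x. ennreal ((cmod (haar_sq a b r f x))\<^sup>2) \<partial>lborel)
    = (\<integral>\<^sup>+\<xi>. ennreal (haar_symbol (half_pow r * (a \<bullet> \<xi> - b)) ^ 4) * ennreal ((cmod (FT f \<xi>))\<^sup>2) \<partial>lborel)" for r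
  proof -
    have "(\<integral>\<^sup>+x. ennreal ((cmod (haar_sq a b r f x))\<^sup>2) \<partial>lborel) = (\<integral>\<^sup>+\<xi>. ennreal ((cmod (FT (haar_sq a b r f) \<xi>))\<^sup>2) \<partial>lborel)"
      using L2_haar_sq[OF f, of a b r] by (simp add: nn_integral_L2 L2_FT L2_norm_FT)
    also have "\<dots> = (\<integral>\<^sup>+\<xi>. ennreal (haar_symbol (half_pow r * (a \<bullet> \<xi> - b)) ^ 4) * ennreal ((cmod (FT f \<xi>))\<^sup>2) \<partial>lborel)"
    proof (rule nn_integral_cong_AE)
      show "AE \<xi> in lborel. ennreal ((cmod (FT (haar_sq a b r f) \<xi>))\<^sup>2)
          = ennreal (haar_symbol (half_pow r * (a \<bullet> \<xi> - b)) ^ 4) * ennreal ((cmod (FT f \<xi>))\<^sup>2)"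
        using FT_haar_sq[OF f, of a b r]
      proof eventually_elim
        case (elim \<xi>)
        show ?case unfolding elim
          by (simp add: norm_mult norm_power power_mult_distrib ennreal_mult power_even_abs flip: power_mult)
      qed
    qed
    finally show ?thesis .
  qed
  then have "(\<integral>\<^sup>+r. (\<integral>\<^sup>+x. ennreal ((cmod (haar_sq a b r f x))\<^sup>2) \<partial>lborel) \<partial>lborel)
    = (\<integral>\<^sup>+r. (\<integral>\<^sup>+\<xi>. ennreal (haar_symbol (half_pow r * (a \<bullet> \<xi> - b)) ^ 4) * ennreal ((cmod (FT f \<xi>))\<^sup>2) \<partial>lborel) \<partial>lborel)"
    by (simp only:)
  also have "\<dots> = (\<integral>\<^sup>+\<xi>. (\<integral>\<^sup>+r. ennreal (haar_symbol (half_pow r * (a \<bullet> \<xi> - b)) ^ 4) * ennreal ((cmod (FT f \<xi>))\<^sup>2) \<partial>lborel) \<partial>lborel)"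
    by (rule lborel_pair.Fubini') measurable
  also have "\<dots> \<le> (\<integral>\<^sup>+\<xi>. ennreal square_const * ennreal ((cmod (FT f \<xi>))\<^sup>2) \<partial>lborel)"
    by (intro nn_integral_mono, subst nn_integral_multc) (auto intro!: mult_right_mono nn_integral_haar_symbol_le)
  also have "\<dots> = ennreal square_const * (\<integral>\<^sup>+x. ennreal ((cmod (f x))\<^sup>2) \<partial>lborel)"
    using f by (simp add: nn_integral_cmult nn_integral_L2 L2_FT L2_norm_FT)
  finally show ?thesis .
qed

text \<open>The condition 0 < l excludes the negative l, all of which \<open>ennreal\<close> sends
  to 0. The value c may be infinite, as weights and maximal functions may be.\<close>

lemma ennreal_layer_cake:
  "(\<integral>\<^sup>+l. (if 0 < l \<and> ennreal l < c then 1 else 0) \<partial>lborel) = c"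
proof -
  have "(\<integral>\<^sup>+l. (if 0 < l \<and> ennreal l < c then 1 else 0) \<partial>lborel) = (\<integral>\<^sup>+l. indicator {l. 0 < l \<and> ennreal l < c} l \<partial>lborel)"
    by (intro nn_integral_cong) (auto simp: indicator_def)
  also have "\<dots> = emeasure lborel {l. 0 < l \<and> ennreal l < c}"
    by (intro nn_integral_indicator) measurable
  also have "\<dots> = c"
  proof (cases c)
    case (real r)
    then have "{l. 0 < l \<and> ennreal l < c} = {0<..<r}" by (auto simp: ennreal_less_iff)
    with real show ?thesis by simp
  next
    case top
    then have "{l. 0 < l \<and> ennreal l < c} = {0<..}" by auto
    moreover have "emeasure lborel {0::real<..} = \<infinity>"
    proof (rule ccontr)
      assume "emeasure lborel {0::real<..} \<noteq> \<infinity>"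
      then obtain m where m: "emeasure lborel {0::real<..} = ennreal m" "0 \<le> m" by (cases "emeasure lborel {0::real<..}") auto
      have "emeasure lborel {0<..<m + 1} \<le> emeasure lborel {0::real<..}" by (intro emeasure_mono) auto
      then show False using m by (simp add: ennreal_le_iff)
    qed
    ultimately show ?thesis using top by simp
  qed
  finally show ?thesis .
qed

text \<open>
  Layer cake in the weight: where \<open>U \<lfloor>r\<rfloor> x > \<lambda>\<close>, compactness of the kernel allows \<open>f\<close> to be cut down to
  \<open>{W > \<lambda>}\<close> before the unweighted bound is applied.
\<close>

lemma haar_sq_weighted:
  fixes a :: "'a::euclidean_space" and U :: "int \<Rightarrow> 'a \<Rightarrow> ennreal" and W :: "'a \<Rightarrow> ennreal"
  assumes f: "f \<in> L2_borel" and [measurable]: "\<And>k. U k \<in> borel_measurable borel" "W \<in> borel_measurable borel"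
    and UW: "\<And>k x d. \<bar>d\<bar> \<le> half_pow (of_int k + 3) \<Longrightarrow> U k (x + d *\<^sub>R a) \<le> W x"
  shows "(\<integral>\<^sup>+r. (\<integral>\<^sup>+x. ennreal ((cmod (haar_sq a b r f x))\<^sup>2) * U \<lfloor>r\<rfloor> x \<partial>lborel) \<partial>lborel)
    \<le> ennreal square_const * (\<integral>\<^sup>+x. ennreal ((cmod (f x))\<^sup>2) * W x \<partial>lborel)"
proof -
  note [measurable] = L2_borel_measurable[OF f]
  define A where "A r x = ennreal ((cmod (haar_sq a b r f x))\<^sup>2)" for r x
  define I :: "real \<Rightarrow> ennreal \<Rightarrow> ennreal" where "I l c = (if 0 < l \<and> ennreal l < c then 1 else 0)" for l c
  have [measurable]: "(\<lambda>(r, x). A r x) \<in> borel_measurable (borel \<Otimes>\<^sub>M borel)" unfolding A_def by measurable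
  have [measurable]: "(\<lambda>(r::real, x). U \<lfloor>r\<rfloor> x) \<in> borel_measurable (borel \<Otimes>\<^sub>M borel)"
  proof -
    have 1: "(\<lambda>p :: real \<times> 'a. \<lfloor>fst p\<rfloor>) \<in> borel \<Otimes>\<^sub>M borel \<rightarrow>\<^sub>M count_space UNIV"
      by (rule measurable_compose[OF measurable_fst measurable_real_floor])
    have 2: "(\<lambda>p :: real \<times> 'a. U k (snd p)) \<in> borel_measurable (borel \<Otimes>\<^sub>M borel)" for k by measurable
    from measurable_compose_countable[OF 2 1]
    have "(\<lambda>p :: real \<times> 'a. U \<lfloor>fst p\<rfloor> (snd p)) \<in> borel_measurable (borel \<Otimes>\<^sub>M borel)" .
    then show ?thesis by (simp add: case_prod_beta)
  qed
  have [measurable]: "(\<lambda>(l, c). I l c) \<in> borel_measurable (borel \<Otimes>\<^sub>M borel)" unfolding I_def by measurable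
  define fl where "fl l x = (if 0 < l \<and> ennreal l < W x then 1 else 0) * f x" for l x
  have fl: "fl l \<in> L2_borel" for l
    unfolding fl_def[abs_def] by (rule L2_borel_bounded_mult[OF f, of _ 1]) auto
  have key: "A r x * I l (U \<lfloor>r\<rfloor> x) \<le> ennreal ((cmod (haar_sq a b r (fl l) x))\<^sup>2)" for r x l
  proof (cases "0 < l \<and> ennreal l < U \<lfloor>r\<rfloor> x")
    case True
    have "haar_sq a b r f x = haar_sq a b r (fl l) x"
    proof (rule haar_sq_cong)
      fix d assume "\<bar>d\<bar> \<le> half_pow (of_int \<lfloor>r\<rfloor> + 3)"
      \<comment> \<open>The hypothesis \<open>UW\<close> is used backwards, from x + d a to x, hence
        the shift by - d.\<close>
      then have "U \<lfloor>r\<rfloor> (x + d *\<^sub>R a + (- d) *\<^sub>R a) \<le> W (x + d *\<^sub>R a)" by (intro UW) simp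
      then have "ennreal l < W (x + d *\<^sub>R a)" using True by (auto intro: order_less_le_trans)
      with True show "f (x + d *\<^sub>R a) = fl l (x + d *\<^sub>R a)" by (simp add: fl_def)
    qed
    then show ?thesis by (simp add: A_def I_def)
  qed (auto simp: I_def)
  have "(\<integral>\<^sup>+r. (\<integral>\<^sup>+x. A r x * U \<lfloor>r\<rfloor> x \<partial>lborel) \<partial>lborel)
    = (\<integral>\<^sup>+r. (\<integral>\<^sup>+x. (\<integral>\<^sup>+l. A r x * I l (U \<lfloor>r\<rfloor> x) \<partial>lborel) \<partial>lborel) \<partial>lborel)"
    by (simp add: nn_integral_cmult I_def ennreal_layer_cake)
  also have "\<dots> = (\<integral>\<^sup>+r. (\<integral>\<^sup>+l. (\<integral>\<^sup>+x. A r x * I l (U \<lfloor>r\<rfloor> x) \<partial>lborel) \<partial>lborel) \<partial>lborel)"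
    by (intro nn_integral_cong lborel_pair.Fubini') measurable
  also have "\<dots> = (\<integral>\<^sup>+l. (\<integral>\<^sup>+r. (\<integral>\<^sup>+x. A r x * I l (U \<lfloor>r\<rfloor> x) \<partial>lborel) \<partial>lborel) \<partial>lborel)"
    by (rule lborel_pair.Fubini') measurable
  also have "\<dots> \<le> (\<integral>\<^sup>+l. ennreal square_const * (\<integral>\<^sup>+x. ennreal ((cmod (fl l x))\<^sup>2) \<partial>lborel) \<partial>lborel)"
  proof (intro nn_integral_mono)
    fix l
    have "(\<integral>\<^sup>+r. (\<integral>\<^sup>+x. A r x * I l (U \<lfloor>r\<rfloor> x) \<partial>lborel) \<partial>lborel)
      \<le> (\<integral>\<^sup>+r. (\<integral>\<^sup>+x. ennreal ((cmod (haar_sq a b r (fl l) x))\<^sup>2) \<partial>lborel) \<partial>lborel)"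
      by (intro nn_integral_mono key)
    also have "\<dots> \<le> ennreal square_const * (\<integral>\<^sup>+x. ennreal ((cmod (fl l x))\<^sup>2) \<partial>lborel)"
      by (rule haar_sq_square_function[OF fl])
    finally show "(\<integral>\<^sup>+r. (\<integral>\<^sup>+x. A r x * I l (U \<lfloor>r\<rfloor> x) \<partial>lborel) \<partial>lborel)
      \<le> ennreal square_const * (\<integral>\<^sup>+x. ennreal ((cmod (fl l x))\<^sup>2) \<partial>lborel)" .
  qed
  also have "\<dots> = (\<integral>\<^sup>+l. ennreal square_const * (\<integral>\<^sup>+x. ennreal ((cmod (f x))\<^sup>2) * I l (W x) \<partial>lborel) \<partial>lborel)"
    by (intro nn_integral_cong arg_cong2[where f="(*)"]) (auto simp: fl_def I_def)
  also have "\<dots> = ennreal square_const * (\<integral>\<^sup>+l. (\<integral>\<^sup>+x. ennreal ((cmod (f x))\<^sup>2) * I l (W x) \<partial>lborel) \<partial>lborel)"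
    by (rule nn_integral_cmult) measurable
  also have "(\<integral>\<^sup>+l. (\<integral>\<^sup>+x. ennreal ((cmod (f x))\<^sup>2) * I l (W x) \<partial>lborel) \<partial>lborel)
    = (\<integral>\<^sup>+x. (\<integral>\<^sup>+l. ennreal ((cmod (f x))\<^sup>2) * I l (W x) \<partial>lborel) \<partial>lborel)"
    by (rule lborel_pair.Fubini') measurable
  also have "\<dots> = (\<integral>\<^sup>+x. ennreal ((cmod (f x))\<^sup>2) * W x \<partial>lborel)"
    by (simp add: nn_integral_cmult I_def ennreal_layer_cake)
  finally show ?thesis by (simp add: A_def)
qed

section \<open>Iterated averages and half-spaces\<close>

text \<open>The head direction is averaged innermost, to match the induction: averages for the
  remaining half-spaces act on an average along the new normal.\<close>

fun iter_avg :: "'a::euclidean_space list \<Rightarrow> real list \<Rightarrow> ('a \<Rightarrow> real) \<Rightarrow> 'a \<Rightarrow> real" where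
  "iter_avg (a # as) (y # ys) v = iter_avg as ys (avg a y v)"
| "iter_avg _ _ v = v"

definition scales :: "real set" where
  "scales = insert 0 (range (\<lambda>k::int. half_pow (of_int k)))"

definition scale_tuples :: "nat \<Rightarrow> real list set" where
  "scale_tuples n = {ys. length ys = n \<and> set ys \<subseteq> scales}"

lemma countable_scale_tuples: "countable (scale_tuples n)"
proof -
  have "countable (lists scales)" unfolding scales_def by (intro countable_lists) auto
  moreover have "scale_tuples n \<subseteq> lists scales" by (auto simp: scale_tuples_def)
  ultimately show ?thesis by (rule countable_subset[rotated])
qed

lemma Cons_scale_tuples: "y \<in> scales \<Longrightarrow> ys \<in> scale_tuples n \<Longrightarrow> y # ys \<in> scale_tuples (Suc n)"
  by (auto simp: scale_tuples_def)

lemma iter_avg_measurable [measurable]: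
  "v \<in> borel_measurable borel \<Longrightarrow> iter_avg as ys v \<in> borel_measurable borel"
proof (induction as ys v rule: iter_avg.induct)
  case (1 a as y ys v)
  have "avg a y v \<in> borel_measurable borel" using 1(2) by measurable
  from 1(1)[OF this] show ?case by simp
qed auto

lemma iter_avg_bounds:
  assumes "v \<in> borel_measurable borel" "\<And>y. e \<le> v y" "\<And>y. v y \<le> B"
  shows "e \<le> iter_avg as ys v x" "iter_avg as ys v x \<le> B"
proof -
  have "e \<le> iter_avg as ys v x \<and> iter_avg as ys v x \<le> B" using assms
  proof (induction as ys v rule: iter_avg.induct)
    case (1 a as y ys v)
    have "avg a y v \<in> borel_measurable borel" using 1(2) by measurable
    from 1(1)[OF this avg_bounds[OF 1(2-4)]] show ?case by simp
  qed auto
  then show "e \<le> iter_avg as ys v x" "iter_avg as ys v x \<le> B" by auto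
qed

lemma iter_avg_mono:
  assumes "v \<in> borel_measurable borel" "\<And>y. 0 \<le> v y" "w \<in> borel_measurable borel" "\<And>y. w y \<le> B" "\<And>y. v y \<le> w y"
  shows "iter_avg as ys v x \<le> iter_avg as ys w x"
  using assms
proof (induction as ys v arbitrary: w rule: iter_avg.induct)
  case (1 a as y ys v)
  note [measurable] = 1(2) 1(4)
  have b: "v z \<le> B" "0 \<le> w z" for z using 1(3,5,6)[of z] by linarith+
  have "avg a y v z \<le> avg a y w z" for z
    using 1(3,5,6) b by (intro avg_mono[of v w B B]) (auto simp: abs_of_nonneg)
  then have "iter_avg as ys (avg a y v) x \<le> iter_avg as ys (avg a y w) x"
    by (intro 1(1)) (use avg_bounds(1)[of v 0 B] avg_bounds(2)[of w 0 B] 1(3,5) b in auto)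
  then show ?case by simp
qed auto

lemma iter_avg_translate: "iter_avg as ys (\<lambda>y. v (y + c)) x = iter_avg as ys v (x + c)"
proof (induction as ys v rule: iter_avg.induct)
  case (1 a as y ys v)
  have "avg a y (\<lambda>y. v (y + c)) = (\<lambda>z. avg a y v (z + c))" by (auto simp: avg_def algebra_simps)
  with 1 show ?case by simp
qed auto

lemma iter_avg_cmult: "iter_avg as ys (\<lambda>y. c * v y) x = c * iter_avg as ys v x"
proof (induction as ys v rule: iter_avg.induct)
  case (1 a as y ys v)
  have "avg a y (\<lambda>y. c * v y) = (\<lambda>z. c * avg a y v z)"
    unfolding avg_def by (rule ext) (simp add: mult.left_commute)
  with 1 show ?case by simp
qed auto

text \<open>A character whose frequency \<eta> lies on the hyperplane passes through
  \<open>mod_conv\<close> and removes its modulation. Absolute values do not see the character, so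
  the unmodulated estimates carry over to every b.\<close>

lemma mod_conv_modulated:
  assumes "\<eta> \<bullet> a = b"
  shows "mod_conv \<phi> a b \<rho> (\<lambda>x. cis (2 * pi * (\<eta> \<bullet> x)) * F x) x
    = cis (2 * pi * (\<eta> \<bullet> x)) * (LINT t|lborel. of_real (\<phi> t) * F (x + (\<rho> * t) *\<^sub>R a))"
proof -
  have "(of_real (\<phi> t) * cis (- (2 * pi * (b * (\<rho> * t))))) * (cis (2 * pi * (\<eta> \<bullet> (x + (\<rho> * t) *\<^sub>R a))) * F (x + (\<rho> * t) *\<^sub>R a))
      = cis (2 * pi * (\<eta> \<bullet> x)) * (of_real (\<phi> t) * F (x + (\<rho> * t) *\<^sub>R a))" for t
  proof -
    have "cis (- (2 * pi * (b * (\<rho> * t)))) * cis (2 * pi * (\<eta> \<bullet> (x + (\<rho> * t) *\<^sub>R a))) = cis (2 * pi * (\<eta> \<bullet> x))"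
      unfolding cis_mult inner_add_right inner_scaleR_right assms by (simp add: algebra_simps)
    then show ?thesis by (simp only: mult_ac)
  qed
  then show ?thesis unfolding mod_conv_def by (simp only: integral_mult_right_zero)
qed

definition haar_gauss :: "'a::euclidean_space \<Rightarrow> real \<Rightarrow> real \<Rightarrow> ('a \<Rightarrow> complex) \<Rightarrow> 'a \<Rightarrow> complex" where
  "haar_gauss a b r u = mod_conv haar a b (half_pow r) (mod_conv std_normal_density a b (half_pow r) u)"

lemma norm_haar_gauss:
  assumes "\<eta> \<bullet> a = b"
  shows "cmod (haar_gauss a b r u x) = cmod (haar_op a (half_pow r) (avg a (half_pow r) (\<lambda>x. cis (- (2 * pi * (\<eta> \<bullet> x))) * u x)) x)"
proof -
  define u' where "u' x = cis (- (2 * pi * (\<eta> \<bullet> x))) * u x" for x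
  have u: "u = (\<lambda>x. cis (2 * pi * (\<eta> \<bullet> x)) * u' x)" by (auto simp: u'_def mult.assoc[symmetric] cis_mult)
  have 1: "mod_conv std_normal_density a b (half_pow r) u = (\<lambda>x. cis (2 * pi * (\<eta> \<bullet> x)) * avg a (half_pow r) u' x)"
    unfolding u mod_conv_modulated[OF assms] avg_def by (simp add: scaleR_conv_of_real)
  show ?thesis
    unfolding haar_gauss_def 1 mod_conv_modulated[OF assms] u'_def[symmetric] by (simp add: norm_mult haar_op_def)
qed

lemma haar_gauss_measurable_pair [measurable]:
  assumes [measurable]: "f \<in> borel_measurable borel"
  shows "(\<lambda>(r, x). haar_gauss a b r f x) \<in> borel_measurable (borel \<Otimes>\<^sub>M borel)"
  unfolding haar_gauss_def mod_conv_def by measurable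

lemma
  assumes f: "f \<in> L2_borel"
  shows L2_haar_gauss: "haar_gauss a b r f \<in> L2_borel"
    and FT_haar_gauss: "AE \<xi> in lborel. FT (haar_gauss a b r f) \<xi> = \<i> * of_real (haar_symbol (half_pow r * (a \<bullet> \<xi> - b)))
      * of_real (exp (- (2 * pi\<^sup>2 * (half_pow r * (a \<bullet> \<xi> - b))\<^sup>2))) * FT f \<xi>"
proof -
  have n: "integrable lborel std_normal_density" by simp
  note Ln = L2_mod_conv[OF n f, of a b "half_pow r"]
  show "haar_gauss a b r f \<in> L2_borel" unfolding haar_gauss_def by (intro L2_mod_conv integrable_haar Ln)
  show "AE \<xi> in lborel. FT (haar_gauss a b r f) \<xi> = \<i> * of_real (haar_symbol (half_pow r * (a \<bullet> \<xi> - b)))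
      * of_real (exp (- (2 * pi\<^sup>2 * (half_pow r * (a \<bullet> \<xi> - b))\<^sup>2))) * FT f \<xi>"
    using FT_mod_conv[OF n f, of a b "half_pow r"] FT_mod_conv[OF integrable_haar Ln, of a b "half_pow r"]
    unfolding haar_gauss_def
  proof eventually_elim
    case (elim \<xi>)
    show ?case unfolding elim(2) elim(1) symbol_haar symbol_std_normal by (simp only: mult.assoc)
  qed
qed

lemma AE_off_hyperplane:
  assumes "a \<noteq> 0"
  shows "AE \<xi> in lborel. a \<bullet> \<xi> - b \<noteq> 0"
proof -
  have "negligible {\<xi>. a \<bullet> \<xi> = b}" using assms by (intro negligible_hyperplane) auto
  then have "{\<xi>. a \<bullet> \<xi> = b} \<in> null_sets lebesgue" by (simp add: negligible_iff_null_sets)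
  then have "AE \<xi> in lebesgue. \<xi> \<notin> {\<xi>. a \<bullet> \<xi> = b}" by (rule AE_not_in)
  then show ?thesis by (simp add: AE_completion_iff)
qed

text \<open>
  The sign multiplier is the superposition over scales of \<open>(haar_gauss)\<^sup>* haar_sq\<close>, which gives the
  estimate after pairing with \<open>u\<close>.
\<close>

lemma sgn_multiplier_pairing_le:
  assumes a: "a \<noteq> 0" and g: "g \<in> L2_borel" and u: "u \<in> L2_borel"
  shows "ennreal (reproducing_const * cmod (LINT \<xi>|lborel. of_real (sgn (a \<bullet> \<xi> - b)) * (FT g \<xi> * cnj (FT u \<xi>))))
    \<le> (\<integral>\<^sup>+r. (\<integral>\<^sup>+x. ennreal (cmod (haar_sq a b r g x) * cmod (haar_gauss a b r u x)) \<partial>lborel) \<partial>lborel)"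
proof -
  define \<zeta> where "\<zeta> \<xi> = a \<bullet> \<xi> - b" for \<xi>
  define k where "k r \<xi> = haar_symbol (half_pow r * \<zeta> \<xi>) ^ 3 * exp (- (2 * pi\<^sup>2 * (half_pow r * \<zeta> \<xi>)\<^sup>2))" for r \<xi>
  define P where "P \<xi> = FT g \<xi> * cnj (FT u \<xi>)" for \<xi>
  note [measurable] = L2_borel_measurable[OF g] L2_borel_measurable[OF u] L2_borel_measurable[OF L2_FT[OF g]] L2_borel_measurable[OF L2_FT[OF u]]
  have [measurable]: "\<zeta> \<in> borel_measurable borel" unfolding \<zeta>_def[abs_def] by measurable
  have [measurable]: "P \<in> borel_measurable borel" unfolding P_def[abs_def] by measurable
  have P: "integrable lborel P" unfolding P_def by (intro L2_integrable_mult L2_borel_cnj L2_FT g u)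
  have z: "AE \<xi> in lborel. \<zeta> \<xi> \<noteq> 0" unfolding \<zeta>_def by (rule AE_off_hyperplane[OF a])
  \<comment> \<open>The absolute integral over r is the same constant at almost every frequency, so
    Fubini's condition reduces to integrability of \<open>P\<close>.\<close>
  have i: "integrable (lborel \<Otimes>\<^sub>M lborel) (\<lambda>(\<xi>, r). of_real (k r \<xi>) * P \<xi>)"
  proof (rule lborel_pair.Fubini_integrable)
    show "(\<lambda>(\<xi>, r). complex_of_real (k r \<xi>) * P \<xi>) \<in> borel_measurable (lborel \<Otimes>\<^sub>M lborel)"
      unfolding k_def by measurable
    show "AE \<xi> in lborel. integrable lborel (\<lambda>r. case (\<xi>, r) of (\<xi>, r) \<Rightarrow> of_real (k r \<xi>) * P \<xi>)"
      using z
    proof eventually_elim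
      case (elim \<xi>)
      have "integrable lborel (\<lambda>r. complex_of_real (k r \<xi>))"
        unfolding complex_of_real_integrable_eq k_def by (rule reproducing_formula(1)[OF elim])
      then show ?case by simp
    qed
    have "(LINT r|lborel. norm (case (\<xi>, r) of (\<xi>, r) \<Rightarrow> complex_of_real (k r \<xi>) * P \<xi>)) = reproducing_const * cmod (P \<xi>)"
      if "\<zeta> \<xi> \<noteq> 0" for \<xi>
      using reproducing_formula(3)[OF that, folded k_def] by (simp add: norm_mult)
    then have eq: "AE \<xi> in lborel. reproducing_const * cmod (P \<xi>) = (LINT r|lborel. norm (case (\<xi>, r) of (\<xi>, r) \<Rightarrow> complex_of_real (k r \<xi>) * P \<xi>))"
      using z by (auto elim!: AE_mp)
    have "integrable lborel (\<lambda>\<xi>. reproducing_const * cmod (P \<xi>))" using P by simp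
    then show "integrable lborel (\<lambda>\<xi>. LINT r|lborel. norm (case (\<xi>, r) of (\<xi>, r) \<Rightarrow> complex_of_real (k r \<xi>) * P \<xi>))"
      by (rule integrable_cong_AE_imp) (use eq in \<open>auto simp: k_def\<close>)
  qed
  have "complex_of_real reproducing_const * (LINT \<xi>|lborel. of_real (sgn (\<zeta> \<xi>)) * P \<xi>)
      = (LINT \<xi>|lborel. of_real reproducing_const * (of_real (sgn (\<zeta> \<xi>)) * P \<xi>))"
    by (rule integral_mult_right_zero[symmetric])
  also have "\<dots> = (LINT \<xi>|lborel. LINT r|lborel. of_real (k r \<xi>) * P \<xi>)"
  proof (rule integral_cong_AE)
    show "AE \<xi> in lborel. of_real reproducing_const * (of_real (sgn (\<zeta> \<xi>)) * P \<xi>) = (LINT r|lborel. of_real (k r \<xi>) * P \<xi>)"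
      using z
    proof eventually_elim
      case (elim \<xi>)
      have "(LINT r|lborel. complex_of_real (k r \<xi>) * P \<xi>) = (LINT r|lborel. complex_of_real (k r \<xi>)) * P \<xi>"
        by (rule integral_mult_left_zero)
      also have "(LINT r|lborel. complex_of_real (k r \<xi>)) = of_real (reproducing_const * sgn (\<zeta> \<xi>))"
        unfolding integral_complex_of_real k_def reproducing_formula(2)[OF elim] ..
      finally show ?case by auto
    qed
  qed (unfold k_def, measurable)
  also have "\<dots> = (LINT r|lborel. LINT \<xi>|lborel. of_real (k r \<xi>) * P \<xi>)"
    by (rule lborel_pair.Fubini_integral[symmetric]) (use i in simp)
  finally have eq: "complex_of_real reproducing_const * (LINT \<xi>|lborel. of_real (sgn (\<zeta> \<xi>)) * P \<xi>)
     = (LINT r|lborel. LINT \<xi>|lborel. of_real (k r \<xi>) * P \<xi>)" .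
  have "ennreal (reproducing_const * cmod (LINT \<xi>|lborel. of_real (sgn (\<zeta> \<xi>)) * P \<xi>))
      = ennreal (norm (LINT r|lborel. LINT \<xi>|lborel. of_real (k r \<xi>) * P \<xi>))"
    unfolding eq[symmetric] using reproducing_const_pos by (simp add: norm_mult)
  also have "\<dots> \<le> (\<integral>\<^sup>+r. norm (LINT \<xi>|lborel. of_real (k r \<xi>) * P \<xi>) \<partial>lborel)"
    by (rule integral_norm_bound_ennreal) (use lborel_pair.integrable_snd[OF i] in simp)
  also have "\<dots> \<le> (\<integral>\<^sup>+r. (\<integral>\<^sup>+x. ennreal (cmod (haar_sq a b r g x) * cmod (haar_gauss a b r u x)) \<partial>lborel) \<partial>lborel)"
  proof (intro nn_integral_mono)
    fix r
    note S = L2_haar_sq[OF g, of a b r] and D = L2_haar_gauss[OF u, of a b r]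
    note [measurable] = L2_borel_measurable[OF L2_FT[OF S]] L2_borel_measurable[OF L2_FT[OF D]]
    \<comment> \<open>With t the Haar symbol and E the Gaussian, the two symbols are -t^2 and i t E;
      the first times the conjugate of the second is i t^3 E, and the factor -i removes the
      i.\<close>
    have "(LINT \<xi>|lborel. of_real (k r \<xi>) * P \<xi>) = (LINT \<xi>|lborel. - \<i> * (FT (haar_sq a b r g) \<xi> * cnj (FT (haar_gauss a b r u) \<xi>)))"
    proof (rule integral_cong_AE)
      show "AE \<xi> in lborel. of_real (k r \<xi>) * P \<xi> = - \<i> * (FT (haar_sq a b r g) \<xi> * cnj (FT (haar_gauss a b r u) \<xi>))"
        using FT_haar_sq[OF g, of a b r] FT_haar_gauss[OF u, of a b r]
      proof eventually_elim
        case (elim \<xi>)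
        define t E where "t = complex_of_real (haar_symbol (half_pow r * (a \<bullet> \<xi> - b)))"
          and "E = complex_of_real (exp (- (2 * pi\<^sup>2 * (half_pow r * (a \<bullet> \<xi> - b))\<^sup>2)))"
        have c: "cnj t = t" "cnj E = E" by (simp_all add: t_def E_def)
        have "complex_of_real (k r \<xi>) = t ^ 3 * E" by (simp add: k_def t_def E_def \<zeta>_def)
        moreover have "- \<i> * ((- t\<^sup>2 * FT g \<xi>) * cnj (\<i> * t * E * FT u \<xi>)) = t ^ 3 * E * (FT g \<xi> * cnj (FT u \<xi>))"
        proof -
          have "\<i> * (t * t * x * (\<i> * t * E * y)) = (\<i> * \<i>) * (t * t * t * E * (x * y))" for x y by (simp only: mult_ac)
          then show ?thesis by (simp add: c power2_eq_square power3_eq_cube)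
        qed
        ultimately show ?case unfolding elim P_def t_def[symmetric] E_def[symmetric] of_real_power by simp
      qed
    qed (unfold k_def, measurable)
    also have "\<dots> = - \<i> * (LINT \<xi>|lborel. FT (haar_sq a b r g) \<xi> * cnj (FT (haar_gauss a b r u) \<xi>))"
      by (rule integral_mult_right_zero)
    also have "\<dots> = - \<i> * (LINT x|lborel. haar_sq a b r g x * cnj (haar_gauss a b r u x))"
      unfolding FT_Parseval[OF S D] ..
    finally have "norm (LINT \<xi>|lborel. of_real (k r \<xi>) * P \<xi>) = norm (LINT x|lborel. haar_sq a b r g x * cnj (haar_gauss a b r u x))"
      by (simp add: norm_mult)
    then have "ennreal (norm (LINT \<xi>|lborel. of_real (k r \<xi>) * P \<xi>)) = ennreal (norm (LINT x|lborel. haar_sq a b r g x * cnj (haar_gauss a b r u x)))"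
      by simp
    also have "\<dots> \<le> (\<integral>\<^sup>+x. norm (haar_sq a b r g x * cnj (haar_gauss a b r u x)) \<partial>lborel)"
      by (rule integral_norm_bound_ennreal) (intro L2_integrable_mult L2_borel_cnj S D)
    finally show "ennreal (norm (LINT \<xi>|lborel. of_real (k r \<xi>) * P \<xi>)) \<le> (\<integral>\<^sup>+x. ennreal (cmod (haar_sq a b r g x) * cmod (haar_gauss a b r u x)) \<partial>lborel)"
      by (simp add: norm_mult)
  qed
  finally show ?thesis by (simp add: P_def \<zeta>_def)
qed

section \<open>Induction over the half-spaces\<close>

definition halfspaces :: "('a::euclidean_space \<times> real) list \<Rightarrow> 'a set" where
  "halfspaces hs = {\<xi>. \<forall>(a, b) \<in> set hs. a \<bullet> \<xi> \<le> b}"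

lemma halfspaces_Nil: "halfspaces [] = UNIV"
  by (simp add: halfspaces_def)

lemma halfspaces_Cons: "halfspaces ((a, b) # hs) = {\<xi>. a \<bullet> \<xi> \<le> b} \<inter> halfspaces hs"
  by (auto simp: halfspaces_def)

lemma halfspaces_measurable [measurable]: "halfspaces hs \<in> sets borel"
proof (induction hs)
  case (Cons h hs)
  obtain a b where h: "h = (a, b)" by (cases h)
  have "{\<xi>. a \<bullet> \<xi> \<le> b} \<in> sets borel" by (intro borel_closed closed_halfspace_le)
  with Cons show ?case unfolding h halfspaces_Cons by (rule sets.Int[rotated])
qed (simp add: halfspaces_Nil)

text \<open>\<open>W\<close> may be any measurable majorant of the iterated averages, which leaves
  the induction free to supply a different one at each scale. The bounds e and B on \<open>w\<close>
  keep integrals finite, and C does not depend on them.\<close>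

definition weighted_multiplier_bound :: "real \<Rightarrow> ('a::euclidean_space \<times> real) list \<Rightarrow> real \<Rightarrow> bool" where
  "weighted_multiplier_bound s hs C \<longleftrightarrow> (\<forall>f h w W e B.
    f \<in> L2_borel \<longrightarrow> h \<in> L2_borel \<longrightarrow> (AE \<xi> in lborel. FT h \<xi> = indicator (halfspaces hs) \<xi> * FT f \<xi>) \<longrightarrow>
    w \<in> borel_measurable borel \<longrightarrow> 0 < e \<longrightarrow> (\<forall>x. e \<le> w x) \<longrightarrow> (\<forall>x. w x \<le> B) \<longrightarrow> W \<in> borel_measurable borel \<longrightarrow>
    (\<forall>ys\<in>scale_tuples (length hs). \<forall>x. ennreal (iter_avg (map fst hs) ys (\<lambda>y. w y powr s) x powr (1 / s)) \<le> W x) \<longrightarrow>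
    (\<integral>\<^sup>+x. ennreal ((cmod (h x))\<^sup>2) * ennreal (w x) \<partial>lborel) \<le> ennreal C * (\<integral>\<^sup>+x. ennreal ((cmod (f x))\<^sup>2) * W x \<partial>lborel))"

lemma weighted_multiplier_boundD:
  assumes "weighted_multiplier_bound s hs C" "f \<in> L2_borel" "h \<in> L2_borel"
    "AE \<xi> in lborel. FT h \<xi> = indicator (halfspaces hs) \<xi> * FT f \<xi>"
    "w \<in> borel_measurable borel" "0 < e" "\<And>x. e \<le> w x" "\<And>x. w x \<le> B" "W \<in> borel_measurable borel"
    "\<And>ys x. ys \<in> scale_tuples (length hs) \<Longrightarrow> ennreal (iter_avg (map fst hs) ys (\<lambda>y. w y powr s) x powr (1 / s)) \<le> W x"
  shows "(\<integral>\<^sup>+x. ennreal ((cmod (h x))\<^sup>2) * ennreal (w x) \<partial>lborel) \<le> ennreal C * (\<integral>\<^sup>+x. ennreal ((cmod (f x))\<^sup>2) * W x \<partial>lborel)"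
  using assms(1)[unfolded weighted_multiplier_bound_def, rule_format, OF assms(2-9)] assms(10) by blast

lemma weighted_multiplier_bound_Nil:
  assumes "0 < s"
  shows "weighted_multiplier_bound s [] 1"
  unfolding weighted_multiplier_bound_def
proof (intro allI impI)
  fix f h :: "'a \<Rightarrow> complex" and w :: "'a \<Rightarrow> real" and W :: "'a \<Rightarrow> ennreal" and e B
  assume L: "f \<in> L2_borel" "h \<in> L2_borel" and F: "AE \<xi> in lborel. FT h \<xi> = indicator (halfspaces []) \<xi> * FT f \<xi>"
    and w: "0 < e" "\<forall>x. e \<le> w x"
    and W: "\<forall>ys\<in>scale_tuples (length ([] :: ('a \<times> real) list)). \<forall>x. ennreal (iter_avg (map fst []) ys (\<lambda>y. w y powr s) x powr (1 / s)) \<le> W x"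
  have "AE \<xi> in lborel. FT h \<xi> = FT f \<xi>" using F by (simp add: halfspaces_Nil)
  then have "AE x in lborel. h x = f x" by (rule FT_inj[OF _ L(2) L(1)])
  then have "(\<integral>\<^sup>+x. ennreal ((cmod (h x))\<^sup>2) * ennreal (w x) \<partial>lborel) = (\<integral>\<^sup>+x. ennreal ((cmod (f x))\<^sup>2) * ennreal (w x) \<partial>lborel)"
    by (intro nn_integral_cong_AE) auto
  also have "\<dots> \<le> (\<integral>\<^sup>+x. ennreal ((cmod (f x))\<^sup>2) * W x \<partial>lborel)"
  proof (intro nn_integral_mono mult_left_mono)
    fix x
    have "0 \<le> w x" using w(1) w(2)[rule_format, of x] by linarith
    then have "(w x powr s) powr (1 / s) = w x" using assms by (simp add: powr_powr)
    moreover have "ennreal ((w x powr s) powr (1 / s)) \<le> W x" using W by (auto simp: scale_tuples_def)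
    ultimately show "ennreal (w x) \<le> W x" by (simp only:)
  qed simp
  finally show "(\<integral>\<^sup>+x. ennreal ((cmod (h x))\<^sup>2) * ennreal (w x) \<partial>lborel) \<le> ennreal 1 * (\<integral>\<^sup>+x. ennreal ((cmod (f x))\<^sup>2) * W x \<partial>lborel)"
    by simp
qed

text \<open>Completing the square with weight t V; the free t is tuned later so that one term can be
  absorbed.\<close>

lemma ennreal_weighted_AM_GM:
  assumes "0 < t" "0 < V"
  shows "ennreal (\<bar>A\<bar> * \<bar>B\<bar>) \<le> ennreal (t / 2) * (ennreal (A\<^sup>2) * ennreal V) + ennreal (1 / (2 * t)) * ennreal (B\<^sup>2 / V)"
proof -
  have "0 \<le> (sqrt (t * V) * \<bar>A\<bar> - \<bar>B\<bar> / sqrt (t * V))\<^sup>2" by simp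
  also have "\<dots> = t * V * A\<^sup>2 + B\<^sup>2 / (t * V) - 2 * (\<bar>A\<bar> * \<bar>B\<bar>)"
    using assms by (simp add: power2_diff power_mult_distrib power_divide)
  finally have "\<bar>A\<bar> * \<bar>B\<bar> \<le> t / 2 * (A\<^sup>2 * V) + 1 / (2 * t) * (B\<^sup>2 / V)"
    using assms by (simp add: field_simps)
  then show ?thesis using assms by (simp add: ennreal_leI flip: ennreal_mult ennreal_plus)
qed

text \<open>The first factor is a1, where a1 / t is the coefficient with which the integral to be
  bounded recurs; t = 2 a1 makes it 1/2. The second factor collects what the induction hypothesis
  bounds: once directly, once through \<open>haar_sq_weighted\<close> with a Harnack loss.\<close>

definition step_const :: "real \<Rightarrow> real" where
  "step_const s = (1 / 4 + dual_const (1 / s) / (4 * reproducing_const))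
     * (1 + square_const * (sqrt 2 * exp (1 / 2)) powr (1 / s) / reproducing_const)"

lemma square_const_nonneg: "0 \<le> square_const"
  unfolding square_const_def by simp

lemma step_const_pos: "1 < s \<Longrightarrow> 0 < step_const s"
  unfolding step_const_def using dual_const_pos[of "1 / s"] reproducing_const_pos square_const_nonneg
  by (intro mult_pos_pos add_pos_pos add_pos_nonneg) auto

text \<open>Almost everywhere the indicator of the new half-space is half of 1 minus the sign of
  \<open>a \<bullet> \<xi> - b\<close>. With \<open>g\<close> the output for the remaining
  half-spaces, \<open>h\<close> is half of \<open>g\<close> minus half of its sign transform, and it
  is paired with a cut-off of w h. The \<open>g\<close> part is the induction hypothesis for
  \<open>w\<close>; in the sign part that hypothesis is applied to \<open>haar_sq\<close> of
  \<open>f\<close> and of \<open>g\<close> at each scale.\<close>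

lemma weighted_multiplier_bound_Cons:
  fixes a :: "'a::euclidean_space"
  assumes s: "1 < s" and a: "a \<noteq> 0" and IH: "weighted_multiplier_bound s hs C" and C: "0 < C"
  shows "weighted_multiplier_bound s ((a, b) # hs) (step_const s * C)"
  unfolding weighted_multiplier_bound_def
proof (intro allI impI)
  fix f h :: "'a \<Rightarrow> complex" and w :: "'a \<Rightarrow> real" and W :: "'a \<Rightarrow> ennreal" and e B :: real
  assume f: "f \<in> L2_borel" and h: "h \<in> L2_borel"
    and Fh: "AE \<xi> in lborel. FT h \<xi> = indicator (halfspaces ((a, b) # hs)) \<xi> * FT f \<xi>"
    and w [measurable]: "w \<in> borel_measurable borel" and e: "0 < e" and we: "\<forall>x. e \<le> w x" and wB: "\<forall>x. w x \<le> B"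
    and [measurable]: "W \<in> borel_measurable borel"
    and W: "\<forall>ys\<in>scale_tuples (length ((a, b) # hs)). \<forall>x. ennreal (iter_avg (map fst ((a, b) # hs)) ys (\<lambda>y. w y powr s) x powr (1 / s)) \<le> W x"
  note [measurable] = L2_borel_measurable[OF f] L2_borel_measurable[OF h]
  define \<beta> where "\<beta> = 1 / s"
  have \<beta>: "0 < \<beta>" "\<beta> < 1" using s by (auto simp: \<beta>_def)
  define as where "as = map fst hs"
  define v where "v y = w y powr s" for y
  define c where "c = reproducing_const"
  have c: "0 < c" unfolding c_def by (rule reproducing_const_pos)
  have w0: "0 < w x" for x using e we[rule_format, of x] by linarith
  have B0: "0 < B" using w0[of 0] wB[rule_format, of 0] by linarith
  have [measurable]: "v \<in> borel_measurable borel" unfolding v_def[abs_def] by measurable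
  have vb: "e powr s \<le> v y" "v y \<le> B powr s" for y
    unfolding v_def using e we[rule_format, of y] wB[rule_format, of y] s w0[of y]
    by (intro powr_mono2; linarith)+
  have es: "0 < e powr s" using e by simp
  have v0: "0 \<le> v y" for y using es vb(1)[of y] by linarith
  have v\<beta>: "v y powr \<beta> = w y" for y unfolding v_def \<beta>_def using w0[of y] s by (simp add: powr_powr)
  have W': "ennreal (iter_avg (a # as) ys v x powr \<beta>) \<le> W x" if "ys \<in> scale_tuples (Suc (length hs))" for ys x
    using W that unfolding as_def v_def[abs_def] \<beta>_def by simp

  have "(\<lambda>\<xi>. indicator (halfspaces hs) \<xi> * FT f \<xi>) \<in> L2_borel"
    by (rule L2_borel_bounded_mult[OF L2_FT[OF f], of _ 1]) (auto simp: indicator_def)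
  then obtain g where g: "g \<in> L2_borel" and Fg: "AE \<xi> in lborel. FT g \<xi> = indicator (halfspaces hs) \<xi> * FT f \<xi>"
    by (rule FT_surj)
  note [measurable] = L2_borel_measurable[OF g]
  have Fhg: "AE \<xi> in lborel. FT h \<xi> = (1 / 2) * FT g \<xi> - (1 / 2) * (of_real (sgn (a \<bullet> \<xi> - b)) * FT g \<xi>)"
    using Fh Fg AE_off_hyperplane[OF a, of b]
  proof eventually_elim
    case (elim \<xi>)
    show ?case
    proof (cases "a \<bullet> \<xi> < b")
      case True
      then have "sgn (a \<bullet> \<xi> - b) = -1" by simp
      with True elim show ?thesis by (simp add: halfspaces_Cons indicator_inter_arith)
    next
      case False
      with elim(3) have "sgn (a \<bullet> \<xi> - b) = 1" "\<not> a \<bullet> \<xi> \<le> b" by auto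
      with elim show ?thesis by (simp add: halfspaces_Cons)
    qed
  qed

  define R where "R = (\<integral>\<^sup>+x. ennreal ((cmod (f x))\<^sup>2) * W x \<partial>lborel)"
  define G where "G = (\<integral>\<^sup>+x. ennreal ((cmod (g x))\<^sup>2) * ennreal (w x) \<partial>lborel)"
  have G: "G \<le> ennreal C * R"
    unfolding G_def R_def
  proof (rule weighted_multiplier_boundD[OF IH f g Fg w e])
    fix ys x assume "ys \<in> scale_tuples (length hs)"
    \<comment> \<open>Scale 0 in the new direction: averages over the remaining directions alone are
      among those dominated by \<open>W\<close>.\<close>
    then have "0 # ys \<in> scale_tuples (Suc (length hs))" by (intro Cons_scale_tuples) (auto simp: scales_def)
    from W'[OF this] show "ennreal (iter_avg (map fst hs) ys (\<lambda>y. w y powr s) x powr (1 / s)) \<le> W x"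
      by (simp add: as_def v_def[abs_def] \<beta>_def avg_0[abs_def] fun_eq_iff)
  qed (use we wB in auto)

  \<comment> \<open>The s-th power of this weight is again an average of w^s, so the iterated
    averages that the induction hypothesis forms from \<open>V k\<close> are iterated averages of
    w^s with one more direction.\<close>
  define V where "V k x = avg a (half_pow (of_int k + 3)) v x powr \<beta>" for k :: int and x
  define K where "K = sqrt 2 * exp (1 / 2)"
  have K: "0 < K" by (simp add: K_def)
  have ab: "e powr s \<le> avg a \<rho> v x" "avg a \<rho> v x \<le> B powr s" for \<rho> x
    using avg_bounds[OF _ vb, where a=a and \<rho>=\<rho> and x=x] by simp_all
  have av0: "0 < avg a \<rho> v x" for \<rho> x using ab(1)[of \<rho> x] es by linarith
  have Vm [measurable]: "V k \<in> borel_measurable borel" for k unfolding V_def[abs_def] by measurable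
  have Vb: "e \<le> V k x" "V k x \<le> B" for k x
  proof -
    have "(e powr s) powr \<beta> \<le> V k x" "V k x \<le> (B powr s) powr \<beta>"
      unfolding V_def using ab[of "half_pow (of_int k + 3)" x] av0[of "half_pow (of_int k + 3)" x] es \<beta>
      by (intro powr_mono2; linarith)+
    then show "e \<le> V k x" "V k x \<le> B" using e B0 s by (simp_all add: powr_powr \<beta>_def)
  qed
  have V0: "0 < V k x" for k x using e Vb(1)[of k x] by linarith
  have Vs: "V k y powr s = avg a (half_pow (of_int k + 3)) v y" for k y
    unfolding V_def using av0[of _ y] s by (simp add: powr_powr \<beta>_def less_imp_le)
  \<comment> \<open>The smallest majorant that the induction hypothesis accepts for the weight
    \<open>V k\<close>.\<close>
  define U where "U k x = (SUP ys\<in>scale_tuples (length hs). ennreal (iter_avg as ys (\<lambda>y. V k y powr s) x powr \<beta>))" for k :: int and x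
  have [measurable]: "U k \<in> borel_measurable borel" for k
    unfolding U_def[abs_def] Vs by (intro borel_measurable_SUP countable_scale_tuples) measurable
  have UW: "U k (x + d *\<^sub>R a) \<le> ennreal (K powr \<beta>) * W x" if d: "\<bar>d\<bar> \<le> half_pow (of_int k + 3)" for k x d
    unfolding U_def Vs
  proof (rule SUP_least)
    fix ys assume ys: "ys \<in> scale_tuples (length hs)"
    define \<rho> where "\<rho> = half_pow (of_int k + 3)"
    \<comment> \<open>One index up is exactly the factor sqrt 2 that \<open>avg_Harnack\<close>
      requires, and it stays within \<open>scales\<close>.\<close>
    define \<rho>' where "\<rho>' = half_pow (of_int (k + 4))"
    have \<rho>: "0 < \<rho>" "\<rho>' = sqrt 2 * \<rho>" using half_pow_add1[of "of_int k + 3"] by (simp_all add: \<rho>_def \<rho>'_def add.assoc)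
    have sc: "\<rho>' \<in> scales" unfolding \<rho>'_def scales_def by (rule insertI2, rule rangeI)
    have H: "avg a \<rho> v (y + d *\<^sub>R a) \<le> K * avg a \<rho>' v y" for y
      using avg_Harnack[where v=v and B="B powr s" and \<rho>=\<rho> and \<rho>'=\<rho>' and d=d and D=1 and a=a and x=y] v0 vb \<rho> d
      by (simp add: K_def \<rho>_def half_pow_pos[THEN less_imp_neq, THEN not_sym])
    have "iter_avg as ys (avg a \<rho> v) (x + d *\<^sub>R a) = iter_avg as ys (\<lambda>y. avg a \<rho> v (y + d *\<^sub>R a)) x"
      by (rule iter_avg_translate[symmetric])
    also have "\<dots> \<le> iter_avg as ys (\<lambda>y. K * avg a \<rho>' v y) x"
      using av0 ab K H by (intro iter_avg_mono[where B="K * B powr s"]) (auto intro: less_imp_le)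
    also have "\<dots> = K * iter_avg (a # as) (\<rho>' # ys) v x" by (simp add: iter_avg_cmult)
    finally have le: "iter_avg as ys (avg a \<rho> v) (x + d *\<^sub>R a) \<le> K * iter_avg (a # as) (\<rho>' # ys) v x" .
    have i0: "0 \<le> iter_avg as ys (avg a \<rho> v) (x + d *\<^sub>R a)"
      using iter_avg_bounds(1)[of "avg a \<rho> v" 0 "B powr s"] av0 ab by (simp add: less_imp_le)
    have i1: "0 \<le> iter_avg (a # as) (\<rho>' # ys) v x"
      by (rule iter_avg_bounds(1)[of v 0 "B powr s"]) (use v0 vb in auto)
    have "iter_avg as ys (avg a \<rho> v) (x + d *\<^sub>R a) powr \<beta> \<le> (K * iter_avg (a # as) (\<rho>' # ys) v x) powr \<beta>"
      using le i0 \<beta> by (intro powr_mono2) auto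
    also have "\<dots> = K powr \<beta> * iter_avg (a # as) (\<rho>' # ys) v x powr \<beta>"
      using K i1 by (simp add: powr_mult)
    finally have "ennreal (iter_avg as ys (avg a \<rho> v) (x + d *\<^sub>R a) powr \<beta>) \<le> ennreal (K powr \<beta>) * ennreal (iter_avg (a # as) (\<rho>' # ys) v x powr \<beta>)"
      by (simp add: ennreal_leI flip: ennreal_mult)
    also have "\<dots> \<le> ennreal (K powr \<beta>) * W x"
      using ys sc by (intro mult_left_mono W' Cons_scale_tuples) auto
    finally show "ennreal (iter_avg as ys (avg a (half_pow (of_int k + 3)) v) (x + d *\<^sub>R a) powr \<beta>) \<le> ennreal (K powr \<beta>) * W x"
      by (simp add: \<rho>_def)
  qed

  define X where "X = (\<integral>\<^sup>+r. (\<integral>\<^sup>+x. ennreal ((cmod (haar_sq a b r g x))\<^sup>2) * ennreal (V \<lfloor>r\<rfloor> x) \<partial>lborel) \<partial>lborel)"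
  \<comment> \<open>At each scale the induction hypothesis passes from \<open>g\<close> to
    \<open>f\<close>, since \<open>haar_sq\<close> commutes with the multiplier;
    \<open>haar_sq_weighted\<close> then integrates over the scales.\<close>
  have X: "X \<le> ennreal C * (ennreal square_const * (ennreal (K powr \<beta>) * R))"
  proof -
    have "X \<le> (\<integral>\<^sup>+r. ennreal C * (\<integral>\<^sup>+x. ennreal ((cmod (haar_sq a b r f x))\<^sup>2) * U \<lfloor>r\<rfloor> x \<partial>lborel) \<partial>lborel)"
      unfolding X_def
    proof (intro nn_integral_mono)
      fix r
      show "(\<integral>\<^sup>+x. ennreal ((cmod (haar_sq a b r g x))\<^sup>2) * ennreal (V \<lfloor>r\<rfloor> x) \<partial>lborel)
        \<le> ennreal C * (\<integral>\<^sup>+x. ennreal ((cmod (haar_sq a b r f x))\<^sup>2) * U \<lfloor>r\<rfloor> x \<partial>lborel)"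
      proof (rule weighted_multiplier_boundD[OF IH L2_haar_sq[OF f] L2_haar_sq[OF g] _ Vm e Vb])
        show "AE \<xi> in lborel. FT (haar_sq a b r g) \<xi> = indicator (halfspaces hs) \<xi> * FT (haar_sq a b r f) \<xi>"
          using FT_haar_sq[OF f, of a b r] FT_haar_sq[OF g, of a b r] Fg
          by eventually_elim simp
        show "ennreal (iter_avg (map fst hs) ys (\<lambda>y. V \<lfloor>r\<rfloor> y powr s) x powr (1 / s)) \<le> U \<lfloor>r\<rfloor> x"
          if "ys \<in> scale_tuples (length hs)" for ys x
          unfolding U_def as_def \<beta>_def using that by (rule SUP_upper)
      qed measurable
    qed
    also have "\<dots> = ennreal C * (\<integral>\<^sup>+r. (\<integral>\<^sup>+x. ennreal ((cmod (haar_sq a b r f x))\<^sup>2) * U \<lfloor>r\<rfloor> x \<partial>lborel) \<partial>lborel)"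
    proof (rule nn_integral_cmult)
      have 1: "(\<lambda>p :: real \<times> 'a. \<lfloor>fst p\<rfloor>) \<in> borel \<Otimes>\<^sub>M borel \<rightarrow>\<^sub>M count_space UNIV"
        by (rule measurable_compose[OF measurable_fst measurable_real_floor])
      have 2: "(\<lambda>p :: real \<times> 'a. U k (snd p)) \<in> borel_measurable (borel \<Otimes>\<^sub>M borel)" for k by measurable
      from measurable_compose_countable[OF 2 1]
      have [measurable]: "(\<lambda>(r :: real, x :: 'a). U \<lfloor>r\<rfloor> x) \<in> borel_measurable (borel \<Otimes>\<^sub>M borel)" by (simp add: case_prod_beta)
      show "(\<lambda>r. \<integral>\<^sup>+x. ennreal ((cmod (haar_sq a b r f x))\<^sup>2) * U \<lfloor>r\<rfloor> x \<partial>lborel) \<in> borel_measurable lborel" by measurable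
    qed
    also have "\<dots> \<le> ennreal C * (ennreal square_const * (\<integral>\<^sup>+x. ennreal ((cmod (f x))\<^sup>2) * (ennreal (K powr \<beta>) * W x) \<partial>lborel))"
      by (intro mult_left_mono haar_sq_weighted f UW) auto
    also have "(\<integral>\<^sup>+x. ennreal ((cmod (f x))\<^sup>2) * (ennreal (K powr \<beta>) * W x) \<partial>lborel) = ennreal (K powr \<beta>) * R"
      unfolding R_def by (subst nn_integral_cmult[symmetric]) (auto simp: mult_ac)
    finally show ?thesis .
  qed

  show "(\<integral>\<^sup>+x. ennreal ((cmod (h x))\<^sup>2) * ennreal (w x) \<partial>lborel)
    \<le> ennreal (step_const s * C) * (\<integral>\<^sup>+x. ennreal ((cmod (f x))\<^sup>2) * W x \<partial>lborel)"
  proof (cases "R = \<infinity>")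
    case True
    then show ?thesis using step_const_pos[OF s] C unfolding R_def by (simp add: ennreal_mult_top)
  next
    case False
    then obtain R' where R': "R = ennreal R'" "0 \<le> R'" by (cases R) auto
    define a1 where "a1 = 1 / 4 + dual_const \<beta> / (4 * c)"
    have a1: "0 < a1" unfolding a1_def using dual_const_pos[OF \<beta>] c by (intro add_pos_pos) auto
    define t where "t = 2 * a1"
    have t: "0 < t" using a1 by (simp add: t_def)
    \<comment> \<open>A point of the hyperplane; it supplies the character that removes the
      modulation.\<close>
    obtain \<eta> where \<eta>: "\<eta> \<bullet> a = b"
    proof
      show "((b / (a \<bullet> a)) *\<^sub>R a) \<bullet> a = b" using a by simp
    qed
    \<comment> \<open>The cutoff makes \<open>u\<close> bounded, as
      \<open>dual_square_function\<close> requires; monotone convergence removes it at the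
      end.\<close>
    have trunc: "(\<integral>\<^sup>+x. ennreal ((cmod (h x))\<^sup>2) * ennreal (w x) * indicator {x. cmod (h x) \<le> real j \<and> norm x \<le> real j} x \<partial>lborel)
        \<le> ennreal (step_const s * C) * R" for j :: nat
    proof -
      define A where "A = {x. cmod (h x) \<le> real j \<and> norm x \<le> real j}"
      have [measurable]: "A \<in> sets borel" unfolding A_def by measurable
      define u where "u x = complex_of_real (indicator A x * w x) * h x" for x
      have um [measurable]: "u \<in> borel_measurable borel" unfolding u_def[abs_def] by measurable
      have ub: "cmod (u x) \<le> B * real j" for x
      proof (cases "x \<in> A")
        case True
        then have "cmod (u x) = w x * cmod (h x)" using w0[of x] by (simp add: u_def norm_mult)
        also have "\<dots> \<le> B * real j" using True wB w0[of x] by (intro mult_mono) (auto simp: A_def B0 less_imp_le)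
        finally show ?thesis .
      qed (use B0 in \<open>simp add: u_def\<close>)
      have u: "u \<in> L2_borel"
        unfolding u_def[abs_def]
        by (rule L2_borel_bounded_mult[OF h, of _ B]) (use w0 wB B0 in \<open>auto simp: indicator_def abs_of_pos norm_mult less_imp_le\<close>)
      \<comment> \<open>The integral of |h|^2 w over A, written through \<open>u\<close> because the
        dual estimate produces it in this form; it is finite since \<open>u\<close> is in L2 and
        \<open>w\<close> is at least e.\<close>
      define I where "I = (LINT x|lborel. (cmod (u x))\<^sup>2 / w x)"
      have ui: "integrable lborel (\<lambda>x. (cmod (u x))\<^sup>2 / w x)"
      proof (rule Bochner_Integration.integrable_bound[of _ "\<lambda>x. (cmod (u x))\<^sup>2 / e"])
        show "integrable lborel (\<lambda>x. (cmod (u x))\<^sup>2 / e)" using L2_borel_integrable[OF u] by simp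
        show "AE x in lborel. norm ((cmod (u x))\<^sup>2 / w x) \<le> norm ((cmod (u x))\<^sup>2 / e)"
          using e we w0 by (auto simp: abs_of_pos intro!: divide_left_mono)
      qed measurable
      have I0: "0 \<le> I" using w0 by (simp add: I_def less_imp_le)
      have nnI: "(\<integral>\<^sup>+x. ennreal ((cmod (u x))\<^sup>2 / w x) \<partial>lborel) = ennreal I"
        unfolding I_def using w0 by (intro nn_integral_eq_integral ui) (auto simp: less_imp_le)
      have uw: "(cmod (u x))\<^sup>2 / w x = (cmod (h x))\<^sup>2 * w x * indicator A x" for x
        using w0[of x] by (auto simp: u_def norm_mult power2_eq_square indicator_def)
      have hu: "(LINT x|lborel. h x * cnj (u x)) = complex_of_real I"
      proof -
        have "h x * cnj (u x) = complex_of_real ((cmod (u x))\<^sup>2 / w x)" for x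
        proof -
          have "h x * cnj (u x) = complex_of_real (indicator A x * w x) * (h x * cnj (h x))"
            by (simp add: u_def mult_ac)
          also have "h x * cnj (h x) = complex_of_real ((cmod (h x))\<^sup>2)" by (rule complex_norm_square[symmetric])
          finally show ?thesis unfolding uw by (simp only: of_real_mult mult_ac)
        qed
        then show ?thesis unfolding I_def by (simp only: integral_complex_of_real)
      qed
      define J1 where "J1 = (LINT x|lborel. g x * cnj (u x))"
      define J2 where "J2 = (LINT \<xi>|lborel. of_real (sgn (a \<bullet> \<xi> - b)) * (FT g \<xi> * cnj (FT u \<xi>)))"
      note [measurable] = L2_borel_measurable[OF L2_FT[OF g]] L2_borel_measurable[OF L2_FT[OF u]] L2_borel_measurable[OF L2_FT[OF h]]
      have P: "integrable lborel (\<lambda>\<xi>. FT g \<xi> * cnj (FT u \<xi>))" by (intro L2_integrable_mult L2_borel_cnj L2_FT g u)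
      have sP: "integrable lborel (\<lambda>\<xi>. of_real (sgn (a \<bullet> \<xi> - b)) * (FT g \<xi> * cnj (FT u \<xi>)))"
        by (rule Bochner_Integration.integrable_bound[OF P]) (auto simp: norm_mult sgn_if)
      have "complex_of_real I = (LINT \<xi>|lborel. FT h \<xi> * cnj (FT u \<xi>))"
        unfolding hu[symmetric] FT_Parseval[OF h u] ..
      also have "\<dots> = (LINT \<xi>|lborel. (1 / 2) * (FT g \<xi> * cnj (FT u \<xi>)) - (1 / 2) * (of_real (sgn (a \<bullet> \<xi> - b)) * (FT g \<xi> * cnj (FT u \<xi>))))"
      proof (rule integral_cong_AE)
        show "AE \<xi> in lborel. FT h \<xi> * cnj (FT u \<xi>)
            = (1 / 2) * (FT g \<xi> * cnj (FT u \<xi>)) - (1 / 2) * (of_real (sgn (a \<bullet> \<xi> - b)) * (FT g \<xi> * cnj (FT u \<xi>)))"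
          using Fhg by eventually_elim (simp only: left_diff_distrib mult.assoc)
      qed measurable
      also have "\<dots> = (1 / 2) * J1 - (1 / 2) * J2"
        unfolding J1_def J2_def FT_Parseval[OF g u, symmetric] using P sP by simp
      finally have "complex_of_real I = (1 / 2) * J1 - (1 / 2) * J2" .
      then have "cmod (complex_of_real I) \<le> cmod ((1 / 2) * J1) + cmod ((1 / 2) * J2)"
        using norm_triangle_ineq4[of "(1 / 2) * J1" "(1 / 2) * J2"] by simp
      then have I: "I \<le> (1 / 2) * cmod J1 + (1 / 2) * cmod J2"
        using I0 by (simp add: norm_mult norm_divide)
      have J1: "cmod J1 \<le> t / 2 * (C * R') + 1 / (2 * t) * I"
      proof -
        have "ennreal (cmod J1) \<le> (\<integral>\<^sup>+x. ennreal (cmod (g x * cnj (u x))) \<partial>lborel)"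
          unfolding J1_def by (rule integral_norm_bound_ennreal) (intro L2_integrable_mult L2_borel_cnj g u)
        also have "\<dots> \<le> (\<integral>\<^sup>+x. ennreal (t / 2) * (ennreal ((cmod (g x))\<^sup>2) * ennreal (w x)) + ennreal (1 / (2 * t)) * ennreal ((cmod (u x))\<^sup>2 / w x) \<partial>lborel)"
          using ennreal_weighted_AM_GM[OF t w0, of "cmod (g _)" "cmod (u _)"] by (intro nn_integral_mono) (simp add: norm_mult)
        also have "\<dots> = ennreal (t / 2) * G + ennreal (1 / (2 * t)) * ennreal I"
          unfolding G_def nnI[symmetric] by (subst nn_integral_add) (auto simp: nn_integral_cmult)
        also have "\<dots> \<le> ennreal (t / 2) * (ennreal C * R) + ennreal (1 / (2 * t)) * ennreal I"
          by (intro add_right_mono mult_left_mono G) simp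
        also have "\<dots> = ennreal (t / 2 * (C * R') + 1 / (2 * t) * I)"
        proof -
          have "0 \<le> C" "0 \<le> R'" "0 \<le> I" "0 \<le> t / 2" "0 \<le> 1 / (2 * t)" "0 \<le> C * R'"
            "0 \<le> t / 2 * (C * R')" "0 \<le> 1 / (2 * t) * I" using t C R'(2) I0 by auto
          then show ?thesis unfolding R'(1) by (simp only: ennreal_mult[symmetric] ennreal_plus[symmetric])
        qed
        finally show ?thesis using t C R'(2) I0 by (subst (asm) ennreal_le_iff) auto
      qed
      have J2: "c * cmod J2 \<le> t / 2 * (C * (square_const * (K powr \<beta> * R'))) + 1 / (2 * t) * (dual_const \<beta> * I)"
      proof -
        define u' where "u' x = cis (- (2 * pi * (\<eta> \<bullet> x))) * u x" for x
        have [measurable]: "u' \<in> borel_measurable borel" unfolding u'_def[abs_def] by measurable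
        have un: "cmod (u' x) = cmod (u x)" for x by (simp add: u'_def norm_mult)
        define D where "D r x = haar_gauss a b r u x" for r x
        have Dn: "cmod (D r x) = cmod (haar_op a (half_pow r) (avg a (half_pow r) u') x)" for r x
          unfolding D_def u'_def[abs_def] by (rule norm_haar_gauss[OF \<eta>])
        have Vr [measurable]: "(\<lambda>(r::real, x). V \<lfloor>r\<rfloor> x) \<in> borel_measurable (borel \<Otimes>\<^sub>M borel)"
          unfolding V_def avg_def by measurable
        have Dm [measurable]: "(\<lambda>(r, x). D r x) \<in> borel_measurable (borel \<Otimes>\<^sub>M borel)" unfolding D_def by measurable
        have Y: "(\<integral>\<^sup>+r. (\<integral>\<^sup>+x. ennreal ((cmod (D r x))\<^sup>2 / V \<lfloor>r\<rfloor> x) \<partial>lborel) \<partial>lborel) \<le> ennreal (dual_const \<beta>) * ennreal I"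
          using dual_square_function[OF \<beta>, where u=u' and v=v and B="B * real j" and e="e powr s" and B'="B powr s" and a=a] ub es vb
          unfolding Dn V_def un v\<beta> nnI by simp
        have "ennreal (c * cmod J2) \<le> (\<integral>\<^sup>+r. (\<integral>\<^sup>+x. ennreal (cmod (haar_sq a b r g x) * cmod (D r x)) \<partial>lborel) \<partial>lborel)"
          unfolding c_def J2_def D_def by (rule sgn_multiplier_pairing_le[OF a g u])
        also have "\<dots> \<le> (\<integral>\<^sup>+r. (\<integral>\<^sup>+x. ennreal (t / 2) * (ennreal ((cmod (haar_sq a b r g x))\<^sup>2) * ennreal (V \<lfloor>r\<rfloor> x))
            + ennreal (1 / (2 * t)) * ennreal ((cmod (D r x))\<^sup>2 / V \<lfloor>r\<rfloor> x) \<partial>lborel) \<partial>lborel)"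
          using ennreal_weighted_AM_GM[OF t V0, of "cmod (haar_sq a b _ g _)" "cmod (D _ _)"] by (intro nn_integral_mono) simp
        also have "\<dots> = (\<integral>\<^sup>+r. ennreal (t / 2) * (\<integral>\<^sup>+x. ennreal ((cmod (haar_sq a b r g x))\<^sup>2) * ennreal (V \<lfloor>r\<rfloor> x) \<partial>lborel)
            + ennreal (1 / (2 * t)) * (\<integral>\<^sup>+x. ennreal ((cmod (D r x))\<^sup>2 / V \<lfloor>r\<rfloor> x) \<partial>lborel) \<partial>lborel)"
          by (intro nn_integral_cong, subst nn_integral_add, measurable, subst (1 2) nn_integral_cmult, measurable)
        also have "\<dots> = ennreal (t / 2) * X + ennreal (1 / (2 * t)) * (\<integral>\<^sup>+r. (\<integral>\<^sup>+x. ennreal ((cmod (D r x))\<^sup>2 / V \<lfloor>r\<rfloor> x) \<partial>lborel) \<partial>lborel)"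
          unfolding X_def by (subst nn_integral_add, measurable, subst (1 2) nn_integral_cmult, measurable)
        also have "\<dots> \<le> ennreal (t / 2) * (ennreal C * (ennreal square_const * (ennreal (K powr \<beta>) * R)))
            + ennreal (1 / (2 * t)) * (ennreal (dual_const \<beta>) * ennreal I)"
          by (intro add_mono mult_left_mono X Y) auto
        also have "\<dots> = ennreal (t / 2 * (C * (square_const * (K powr \<beta> * R'))) + 1 / (2 * t) * (dual_const \<beta> * I))"
        proof -
          have "0 \<le> C" "0 \<le> R'" "0 \<le> I" "0 \<le> t / 2" "0 \<le> 1 / (2 * t)" "0 \<le> K powr \<beta>" "0 \<le> dual_const \<beta>"
            "0 \<le> K powr \<beta> * R'" "0 \<le> square_const * (K powr \<beta> * R')" "0 \<le> C * (square_const * (K powr \<beta> * R'))"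
            "0 \<le> t / 2 * (C * (square_const * (K powr \<beta> * R')))" "0 \<le> dual_const \<beta> * I" "0 \<le> 1 / (2 * t) * (dual_const \<beta> * I)"
            using t C R'(2) I0 square_const_nonneg dual_const_pos[OF \<beta>] by auto
          then show ?thesis unfolding R'(1)
            by (simp only: square_const_nonneg ennreal_mult[symmetric] ennreal_plus[symmetric])
        qed
        finally show ?thesis using t C R'(2) I0 square_const_nonneg dual_const_pos[OF \<beta>]
          by (subst (asm) ennreal_le_iff) (auto intro!: add_nonneg_nonneg mult_nonneg_nonneg)
      qed
      have "I \<le> step_const s * C * R'"
      proof -
        have "cmod J2 \<le> (t / 2 * (C * (square_const * (K powr \<beta> * R'))) + 1 / (2 * t) * (dual_const \<beta> * I)) / c"
          using J2 c by (simp add: pos_le_divide_eq mult.commute)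
        then have "(1 / 2) * cmod J1 + (1 / 2) * cmod J2 \<le> (1 / 2) * (t / 2 * (C * R') + 1 / (2 * t) * I)
            + (1 / 2) * ((t / 2 * (C * (square_const * (K powr \<beta> * R'))) + 1 / (2 * t) * (dual_const \<beta> * I)) / c)"
          by (intro add_mono mult_left_mono J1) auto
        \<comment> \<open>Now I stands on both sides; with t = 2 a1 its coefficient on the right is
          1/2, and it is absorbed.\<close>
        note order_trans[OF I this]
        also have "\<dots> = (1 / t) * a1 * I + t / 4 * (1 + square_const * K powr \<beta> / c) * (C * R')"
          using t c unfolding a1_def by (simp add: field_simps)
        also have "(1 / t) * a1 = 1 / 2" using a1 by (simp add: t_def)
        finally have "I \<le> t / 2 * (1 + square_const * K powr \<beta> / c) * (C * R')" by (simp add: field_simps)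
        also have "\<dots> = step_const s * C * R'"
          unfolding step_const_def a1_def t_def c_def \<beta>_def K_def by simp
        finally show ?thesis .
      qed
      then have "ennreal I \<le> ennreal (step_const s * C) * R"
        unfolding R'(1) using step_const_pos[OF s] C R'(2) by (simp add: ennreal_leI flip: ennreal_mult)
      moreover have "(\<integral>\<^sup>+x. ennreal ((cmod (h x))\<^sup>2) * ennreal (w x) * indicator A x \<partial>lborel) = ennreal I"
        unfolding nnI[symmetric] uw using w0
        by (intro nn_integral_cong) (auto simp: indicator_def ennreal_mult less_imp_le)
      ultimately show ?thesis unfolding A_def by simp
    qed
    have "(\<lambda>j::nat. \<integral>\<^sup>+x. ennreal ((cmod (h x))\<^sup>2) * ennreal (w x) * indicator {x. cmod (h x) \<le> real j \<and> norm x \<le> real j} x \<partial>lborel)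
        \<longlonglongrightarrow> (\<integral>\<^sup>+x. ennreal ((cmod (h x))\<^sup>2) * ennreal (w x) \<partial>lborel)"
    proof (rule nn_integral_LIMSEQ)
      show "incseq (\<lambda>j x. ennreal ((cmod (h x))\<^sup>2) * ennreal (w x) * indicator {x. cmod (h x) \<le> real j \<and> norm x \<le> real j} x)"
        by (auto simp: incseq_def le_fun_def intro!: mult_left_mono indicator_leI)
      show "(\<lambda>j. ennreal ((cmod (h x))\<^sup>2) * ennreal (w x) * indicator {x. cmod (h x) \<le> real j \<and> norm x \<le> real j} x)
          \<longlonglongrightarrow> ennreal ((cmod (h x))\<^sup>2) * ennreal (w x)" for x
      proof (rule tendsto_eventually)
        show "\<forall>\<^sub>F j in sequentially. ennreal ((cmod (h x))\<^sup>2) * ennreal (w x) * indicator {x. cmod (h x) \<le> real j \<and> norm x \<le> real j} x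
            = ennreal ((cmod (h x))\<^sup>2) * ennreal (w x)"
          using eventually_ge_at_top[of "nat \<lceil>max (cmod (h x)) (norm x)\<rceil>"]
        proof eventually_elim
          case (elim j)
          then have "max (cmod (h x)) (norm x) \<le> real j" by linarith
          then show ?case by simp
        qed
      qed
    qed measurable
    from LIMSEQ_le_const2[OF this] trunc show ?thesis unfolding R_def by blast
  qed
qed

lemma weighted_multiplier_bound_halfspaces:
  assumes "1 < s" "\<forall>(a, b)\<in>set hs. a \<noteq> 0"
  shows "weighted_multiplier_bound s hs (step_const s ^ length hs)"
  using assms(2)
proof (induction hs)
  case Nil
  then show ?case using weighted_multiplier_bound_Nil[of s] assms(1) by simp
next
  case (Cons h hs)
  then show ?case
    using weighted_multiplier_bound_Cons[OF assms(1), of "fst h" hs "step_const s ^ length hs" "snd h"]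
      step_const_pos[OF assms(1)] by (simp add: split_beta)
qed

section \<open>Removing the bounds on the weight\<close>

lemma iter_avg_add_const:
  assumes "v \<in> borel_measurable borel" "\<And>y. 0 \<le> v y" "\<And>y. v y \<le> B"
  shows "iter_avg as ys (\<lambda>y. v y + c) x = iter_avg as ys v x + c"
  using assms
proof (induction as ys v rule: iter_avg.induct)
  case (1 a as y ys v)
  have i: "integrable lborel (\<lambda>t. std_normal_density t *\<^sub>R v (z + (y * t) *\<^sub>R a))" for z
    using 1(3,4) by (intro avg_integrable[OF 1(2), of B]) (auto simp: abs_of_nonneg)
  have "avg a y (\<lambda>y. v y + c) z = avg a y v z + avg a y (\<lambda>_. c) z" for z
    unfolding avg_def scaleR_add_right by (intro Bochner_Integration.integral_add i) simp
  then have "avg a y (\<lambda>y. v y + c) = (\<lambda>z. avg a y v z + c)" by auto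
  moreover have "iter_avg as ys (\<lambda>z. avg a y v z + c) x = iter_avg as ys (avg a y v) x + c"
    using 1(2) by (intro 1(1) avg_bounds[OF 1(2-4)]) measurable
  ultimately show ?case by simp
qed auto

lemma powr_add_le_pow2:
  fixes x y p :: real
  assumes "0 \<le> x" "0 \<le> y" "0 < p"
  shows "(x + y) powr p \<le> 2 powr p * (x powr p + y powr p)"
proof -
  have "(x + y) powr p \<le> (2 * max x y) powr p" using assms by (intro powr_mono2) auto
  also have "\<dots> = 2 powr p * max x y powr p" using assms by (simp add: powr_mult)
  also have "\<dots> \<le> 2 powr p * (x powr p + y powr p)" by (intro mult_left_mono) (auto simp: max_def)
  finally show ?thesis .
qed

text \<open>A quasi-triangle inequality used twice, for the exponents s and 1/s: the losses are 2
  and 2^(1/s) <= 2, which gives the 4.\<close>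

lemma iter_avg_shift_powr_le:
  assumes s: "1 < s" and u [measurable]: "u \<in> borel_measurable borel"
    and b: "\<And>y. 0 \<le> u y" "\<And>y. u y \<le> B" and \<epsilon>: "0 < \<epsilon>"
  shows "iter_avg as ys (\<lambda>y. (u y + \<epsilon>) powr s) x powr (1 / s)
    \<le> 4 * (iter_avg as ys (\<lambda>y. u y powr s) x powr (1 / s) + \<epsilon>)"
proof -
  define A where "A = iter_avg as ys (\<lambda>y. u y powr s) x"
  have pB: "u y powr s \<le> B powr s" for y using b s by (intro powr_mono2) auto
  have "0 \<le> A" unfolding A_def by (rule iter_avg_bounds(1)[OF _ _ pB]) auto
  have m: "(\<lambda>y. (u y + \<epsilon>) powr s) \<in> borel_measurable borel" "(\<lambda>y. u y powr s + \<epsilon> powr s) \<in> borel_measurable borel"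
      "(\<lambda>y. u y powr s) \<in> borel_measurable borel" by measurable
  have "iter_avg as ys (\<lambda>y. (u y + \<epsilon>) powr s) x \<le> iter_avg as ys (\<lambda>y. 2 powr s * (u y powr s + \<epsilon> powr s)) x"
    using s b \<epsilon> m(2) pB
    by (intro iter_avg_mono[OF m(1), where B="2 powr s * (B powr s + \<epsilon> powr s)"] powr_add_le_pow2 mult_left_mono) auto
  also have "\<dots> = 2 powr s * (A + \<epsilon> powr s)"
    unfolding iter_avg_cmult A_def by (subst iter_avg_add_const[OF m(3) _ pB]) auto
  finally have le: "iter_avg as ys (\<lambda>y. (u y + \<epsilon>) powr s) x \<le> 2 powr s * (A + \<epsilon> powr s)" .
  have "0 \<le> iter_avg as ys (\<lambda>y. (u y + \<epsilon>) powr s) x"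
  proof (rule iter_avg_bounds(1)[OF m(1)])
    show "(u y + \<epsilon>) powr s \<le> (B + \<epsilon>) powr s" for y using b[of y] \<epsilon> s by (intro powr_mono2) auto
  qed auto
  then have "iter_avg as ys (\<lambda>y. (u y + \<epsilon>) powr s) x powr (1 / s) \<le> (2 powr s * (A + \<epsilon> powr s)) powr (1 / s)"
    using le s by (intro powr_mono2) auto
  also have "\<dots> = 2 * (A + \<epsilon> powr s) powr (1 / s)"
    using \<open>0 \<le> A\<close> s by (simp add: powr_mult powr_powr)
  also have "\<dots> \<le> 2 * (2 powr (1 / s) * (A powr (1 / s) + (\<epsilon> powr s) powr (1 / s)))"
    using \<open>0 \<le> A\<close> s by (intro mult_left_mono powr_add_le_pow2) auto
  also have "(\<epsilon> powr s) powr (1 / s) = \<epsilon>" using s \<epsilon> by (simp add: powr_powr)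
  also have "2 powr (1 / s) \<le> (2::real) powr 1" using s by (intro powr_mono) auto
  finally show ?thesis using \<open>0 \<le> A\<close> \<epsilon> unfolding A_def by (simp add: mult_right_mono)
qed

text \<open>The truncation at j keeps the Bochner integrals in \<open>iter_avg\<close> meaningful:
  for an unbounded weight they could fail to exist and would then count as 0.\<close>

definition iter_avg_sup :: "real \<Rightarrow> 'a::euclidean_space list \<Rightarrow> ('a \<Rightarrow> real) \<Rightarrow> 'a \<Rightarrow> ennreal" where
  "iter_avg_sup s as w x = (SUP (j, ys)\<in>UNIV \<times> scale_tuples (length as).
     ennreal (iter_avg as ys (\<lambda>y. min (w y) (real j) powr s) x powr (1 / s)))"

lemma iter_avg_sup_measurable [measurable]:
  assumes [measurable]: "w \<in> borel_measurable borel"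
  shows "iter_avg_sup s as w \<in> borel_measurable borel"
proof -
  have [measurable]: "iter_avg as ys (\<lambda>y. min (w y) (real j) powr s) \<in> borel_measurable borel" for ys and j :: nat
    by (rule iter_avg_measurable) measurable
  show ?thesis unfolding iter_avg_sup_def[abs_def] split_beta
    by (intro borel_measurable_SUP countable_SIGMA countable_scale_tuples) auto
qed

lemma SUP_ennreal_min_real: "(SUP j::nat. ennreal (min x (real j))) = ennreal x"
proof (rule antisym)
  obtain j :: nat where "x \<le> real j" using real_arch_simple by blast
  then have "ennreal x = ennreal (min x (real j))" by simp
  also have "\<dots> \<le> (SUP j::nat. ennreal (min x (real j)))" by (rule SUP_upper) simp
  finally show "ennreal x \<le> (SUP j::nat. ennreal (min x (real j)))" .
qed (auto intro!: SUP_least ennreal_leI)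

text \<open>The weight is cut at j and raised by \<epsilon> to meet the bounds in
  \<open>weighted_multiplier_bound\<close>. Raising costs a multiple of \<epsilon> times the squared
  norm of \<open>f\<close>, which is finite; monotone convergence removes j.\<close>

lemma multiplier_estimate:
  fixes w :: "'a::euclidean_space \<Rightarrow> real"
  assumes s: "1 < s" and hs: "\<forall>(a, b)\<in>set hs. a \<noteq> 0"
    and f: "f \<in> L2_borel" and h: "h \<in> L2_borel"
    and Fh: "AE \<xi> in lborel. FT h \<xi> = indicator (halfspaces hs) \<xi> * FT f \<xi>"
    and w [measurable]: "w \<in> borel_measurable borel" and w0: "\<And>x. 0 \<le> w x"
  shows "(\<integral>\<^sup>+x. ennreal ((cmod (h x))\<^sup>2) * ennreal (w x) \<partial>lborel)
    \<le> ennreal (4 * step_const s ^ length hs) * (\<integral>\<^sup>+x. ennreal ((cmod (f x))\<^sup>2) * iter_avg_sup s (map fst hs) w x \<partial>lborel)"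
proof -
  define C where "C = step_const s ^ length hs"
  have C: "0 < C" unfolding C_def using step_const_pos[OF s] by simp
  define W where "W = iter_avg_sup s (map fst hs) w"
  have [measurable]: "W \<in> borel_measurable borel" unfolding W_def by measurable
  note [measurable] = L2_borel_measurable[OF f] L2_borel_measurable[OF h]
  define I where "I = (\<integral>\<^sup>+x. ennreal ((cmod (f x))\<^sup>2) * W x \<partial>lborel)"
  define N where "N = (L2_norm f)\<^sup>2"
  have N: "0 \<le> N" by (simp add: N_def)
  have j: "(\<integral>\<^sup>+x. ennreal ((cmod (h x))\<^sup>2) * ennreal (min (w x) (real j)) \<partial>lborel) \<le> ennreal (4 * C) * I" for j :: nat
  proof (rule ennreal_le_epsilon)
    fix e :: real assume e: "0 < e"
    \<comment> \<open>Makes the error \<open>4 * C * N * \<epsilon>\<close> at most e; the added 1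
      keeps the quotient meaningful for N = 0.\<close>
    define \<epsilon> where "\<epsilon> = e / (4 * C * N + 1)"
    have \<epsilon>: "0 < \<epsilon>" using e C N by (simp add: \<epsilon>_def add_nonneg_pos)
    define u where "u y = min (w y) (real j)" for y
    have [measurable]: "u \<in> borel_measurable borel" unfolding u_def[abs_def] by measurable
    have u: "0 \<le> u y" "u y \<le> real j" for y by (auto simp: u_def w0)
    have "(\<integral>\<^sup>+x. ennreal ((cmod (h x))\<^sup>2) * ennreal (u x) \<partial>lborel) \<le> (\<integral>\<^sup>+x. ennreal ((cmod (h x))\<^sup>2) * ennreal (u x + \<epsilon>) \<partial>lborel)"
      using \<epsilon> by (intro nn_integral_mono mult_left_mono ennreal_leI) auto
    also have "\<dots> \<le> ennreal C * (\<integral>\<^sup>+x. ennreal ((cmod (f x))\<^sup>2) * (4 * (W x + ennreal \<epsilon>)) \<partial>lborel)"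
      unfolding C_def
    proof (rule weighted_multiplier_boundD[OF weighted_multiplier_bound_halfspaces[OF s hs] f h Fh])
      show "\<epsilon> \<le> u x + \<epsilon>" "u x + \<epsilon> \<le> real j + \<epsilon>" for x using u[of x] by auto
      fix ys x assume ys: "ys \<in> scale_tuples (length hs)"
      have "ennreal (iter_avg (map fst hs) ys (\<lambda>y. u y powr s) x powr (1 / s)) \<le> W x"
        unfolding W_def iter_avg_sup_def u_def using ys by (intro SUP_upper2[where i="(j, ys)"]) auto
      then have "ennreal (4 * (iter_avg (map fst hs) ys (\<lambda>y. u y powr s) x powr (1 / s) + \<epsilon>)) \<le> 4 * (W x + ennreal \<epsilon>)"
        using \<epsilon> by (simp add: ennreal_mult' ennreal_plus mult_left_mono add_right_mono)
      moreover have "iter_avg (map fst hs) ys (\<lambda>y. (u y + \<epsilon>) powr s) x powr (1 / s)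
          \<le> 4 * (iter_avg (map fst hs) ys (\<lambda>y. u y powr s) x powr (1 / s) + \<epsilon>)"
        by (rule iter_avg_shift_powr_le[OF s \<open>u \<in> borel_measurable borel\<close> u \<epsilon>])
      ultimately show "ennreal (iter_avg (map fst hs) ys (\<lambda>y. (u y + \<epsilon>) powr s) x powr (1 / s)) \<le> 4 * (W x + ennreal \<epsilon>)"
        using order_trans[OF ennreal_leI] by blast
    qed (use \<epsilon> in measurable)
    also have "(\<integral>\<^sup>+x. ennreal ((cmod (f x))\<^sup>2) * (4 * (W x + ennreal \<epsilon>)) \<partial>lborel)
        = (\<integral>\<^sup>+x. 4 * (ennreal ((cmod (f x))\<^sup>2) * W x) + ennreal (4 * \<epsilon>) * ennreal ((cmod (f x))\<^sup>2) \<partial>lborel)"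
      using \<epsilon> by (simp add: ennreal_mult' distrib_left mult_ac)
    also have "\<dots> = 4 * I + ennreal (4 * \<epsilon>) * ennreal N"
      unfolding I_def N_def nn_integral_L2[OF f, symmetric] by (simp add: nn_integral_add nn_integral_cmult)
    also have "ennreal C * \<dots> = ennreal (4 * C) * I + ennreal (4 * C * N * \<epsilon>)"
      using C \<epsilon> N by (simp add: distrib_left ennreal_mult' mult_ac flip: ennreal_mult)
    also have "\<dots> \<le> ennreal (4 * C) * I + ennreal e"
    proof (intro add_left_mono ennreal_leI)
      have "4 * C * N * \<epsilon> \<le> (4 * C * N + 1) * \<epsilon>" using \<epsilon> by (intro mult_right_mono) auto
      also have "\<dots> = e" unfolding \<epsilon>_def using mult_nonneg_nonneg[of "4 * C" N] C N by (simp add: add_nonneg_eq_0_iff)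
      finally show "4 * C * N * \<epsilon> \<le> e" .
    qed
    finally show "(\<integral>\<^sup>+x. ennreal ((cmod (h x))\<^sup>2) * ennreal (min (w x) (real j)) \<partial>lborel) \<le> ennreal (4 * C) * I + ennreal e"
      by (simp add: u_def)
  qed
  have "(\<integral>\<^sup>+x. ennreal ((cmod (h x))\<^sup>2) * ennreal (w x) \<partial>lborel)
      = (\<integral>\<^sup>+x. (SUP j::nat. ennreal ((cmod (h x))\<^sup>2) * ennreal (min (w x) (real j))) \<partial>lborel)"
    by (simp add: SUP_mult_left_ennreal[symmetric] SUP_ennreal_min_real)
  also have "\<dots> = (SUP j::nat. \<integral>\<^sup>+x. ennreal ((cmod (h x))\<^sup>2) * ennreal (min (w x) (real j)) \<partial>lborel)"
    by (rule nn_integral_monotone_convergence_SUP)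
      (auto simp: incseq_def le_fun_def intro!: mult_left_mono ennreal_leI)
  also have "\<dots> \<le> ennreal (4 * C) * I" using j by (rule SUP_least)
  finally show ?thesis unfolding I_def C_def W_def .
qed

section \<open>Domination by the maximal function\<close>

text \<open>Substituting \<mu> t for t gives a factor \<mu> <= 2, and the Gaussian density does not
  increase when its argument is stretched.\<close>

lemma avg_le_dilated:
  fixes v :: "'a::euclidean_space \<Rightarrow> real"
  assumes v: "v \<in> borel_measurable borel" and b: "\<And>y. 0 \<le> v y" "\<And>y. v y \<le> B" and \<mu>: "1 \<le> \<mu>" "\<mu> \<le> 2"
  shows "avg a \<rho> v x \<le> 2 * avg a (\<mu> * \<rho>) v x"
proof -
  have i: "integrable lborel (\<lambda>t. std_normal_density t *\<^sub>R v (x + (r * t) *\<^sub>R a))" for r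
    using b by (intro avg_integrable[OF v, of B]) (auto simp: abs_of_nonneg)
  have n: "std_normal_density (\<mu> * t) \<le> std_normal_density t" for t
  proof -
    have "1 * t\<^sup>2 \<le> \<mu>\<^sup>2 * t\<^sup>2" using \<mu> by (intro mult_right_mono) auto
    then show ?thesis by (simp add: std_normal_density_def divide_right_mono power_mult_distrib)
  qed
  have "avg a \<rho> v x = \<mu> * (LINT t|lborel. std_normal_density (\<mu> * t) *\<^sub>R v (x + (\<rho> * (\<mu> * t)) *\<^sub>R a))"
    unfolding avg_def using \<mu> by (subst lborel_integral_real_affine[of \<mu> _ 0]) auto
  also have "\<dots> \<le> \<mu> * (LINT t|lborel. std_normal_density t *\<^sub>R v (x + (\<mu> * \<rho> * t) *\<^sub>R a))"
  proof (intro mult_left_mono integral_mono i)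
    show "integrable lborel (\<lambda>t. std_normal_density (\<mu> * t) *\<^sub>R v (x + (\<rho> * (\<mu> * t)) *\<^sub>R a))"
      using lborel_integrable_real_affine[OF i[of \<rho>], of \<mu> 0] \<mu> by simp
    show "std_normal_density (\<mu> * t) *\<^sub>R v (x + (\<rho> * (\<mu> * t)) *\<^sub>R a) \<le> std_normal_density t *\<^sub>R v (x + (\<mu> * \<rho> * t) *\<^sub>R a)" for t
      using mult_right_mono[OF n b(1), of t "x + (\<rho> * (\<mu> * t)) *\<^sub>R a"] by (simp add: mult_ac)
  qed (use \<mu> in auto)
  also have "\<dots> = \<mu> * avg a (\<mu> * \<rho>) v x" by (simp add: avg_def)
  also have "\<dots> \<le> 2 * avg a (\<mu> * \<rho>) v x" using \<mu> avg_bounds(1)[OF v b] by (intro mult_right_mono)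
  finally show ?thesis .
qed

lemma iter_avg_le_dilated:
  fixes v :: "'a::euclidean_space \<Rightarrow> real"
  assumes "v \<in> borel_measurable borel" "\<And>y. 0 \<le> v y" "\<And>y. v y \<le> B" and \<mu>: "1 \<le> \<mu>" "\<mu> \<le> 2"
  shows "iter_avg as ys v x \<le> 2 ^ length as * iter_avg as (map ((*) \<mu>) ys) v x"
  using assms(1-3)
proof (induction as ys v arbitrary: B rule: iter_avg.induct)
  case (1 a as y ys v)
  note b = avg_bounds[OF 1(2-4)]
  have m: "avg a r v \<in> borel_measurable borel" for r using 1(2) by measurable
  have "iter_avg as ys (avg a y v) x \<le> 2 ^ length as * iter_avg as (map ((*) \<mu>) ys) (avg a y v) x"
    by (rule 1(1)[OF m b])
  also have "\<dots> \<le> 2 ^ length as * iter_avg as (map ((*) \<mu>) ys) (\<lambda>z. 2 * avg a (\<mu> * y) v z) x"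
    using m[of "\<mu> * y"] by (intro mult_left_mono iter_avg_mono[OF m b(1), where B="2 * B"] avg_le_dilated[OF 1(2-4) \<mu>]) (auto intro: b)
  finally show ?case unfolding iter_avg_cmult by simp
next
  case ("2_1" ys v)
  then show ?case by simp
next
  case ("2_2" as v)
  have "1 * v x \<le> 2 ^ length as * v x" using "2_2"(2) by (intro mult_right_mono) auto
  then show ?case by (cases as) auto
qed

lemma avg_measurable_pair [measurable]:
  fixes v :: "real \<Rightarrow> 'a::euclidean_space \<Rightarrow> real"
  assumes [measurable]: "(\<lambda>(\<mu>, z). v \<mu> z) \<in> borel_measurable (borel \<Otimes>\<^sub>M borel)"
  shows "(\<lambda>(\<mu>, z). avg a (\<mu> * \<rho>) (v \<mu>) z) \<in> borel_measurable (borel \<Otimes>\<^sub>M borel)"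
  unfolding avg_def by measurable

text \<open>
  Gaussian averages along several directions are averages over directions of averages along rays:
  freeze the Gaussian variables and average only over the common dilation factor.
\<close>

lemma nn_integral_iter_avg_dilated_le:
  fixes v :: "real \<Rightarrow> 'a::euclidean_space \<Rightarrow> real"
  assumes "(\<lambda>(\<mu>, z). v \<mu> z) \<in> borel_measurable (borel \<Otimes>\<^sub>M borel)"
    and "\<And>\<mu> z. 0 \<le> v \<mu> z" "\<And>\<mu> z. v \<mu> z \<le> B"
    and "\<And>z. (\<integral>\<^sup>+\<mu>. ennreal (v \<mu> (x + \<mu> *\<^sub>R z)) * indicator {1..2} \<mu> \<partial>lborel) \<le> M"
  shows "(\<integral>\<^sup>+\<mu>. ennreal (iter_avg as (map ((*) \<mu>) ys) (v \<mu>) x) * indicator {1..2} \<mu> \<partial>lborel) \<le> M"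
  using assms
proof (induction as arbitrary: ys v)
  case Nil
  from Nil(4)[of 0] show ?case by simp
next
  case (Cons a as)
  note [measurable] = Cons(2)
  show ?case
  proof (cases ys)
    case Nil
    then show ?thesis using Cons(5)[of 0] by simp
  next
    case (Cons y ys')
    \<comment> \<open>After one average the function itself depends on the dilation factor, which is
      why the statement concerns a family \<open>v \<mu>\<close>.\<close>
    define v' where "v' \<mu> z = avg a (\<mu> * y) (v \<mu>) z" for \<mu> z
    have m: "v \<mu> \<in> borel_measurable borel" for \<mu> by measurable
    have m': "(\<lambda>(\<mu>, z). v' \<mu> z) \<in> borel_measurable (borel \<Otimes>\<^sub>M borel)" unfolding v'_def by measurable
    have "(\<integral>\<^sup>+\<mu>. ennreal (v' \<mu> (x + \<mu> *\<^sub>R z)) * indicator {1..2} \<mu> \<partial>lborel) \<le> M" for z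
    proof -
      have "(\<integral>\<^sup>+\<mu>. ennreal (v' \<mu> (x + \<mu> *\<^sub>R z)) * indicator {1..2} \<mu> \<partial>lborel)
        = (\<integral>\<^sup>+\<mu>. (\<integral>\<^sup>+t. ennreal (std_normal_density t) * (ennreal (v \<mu> (x + \<mu> *\<^sub>R (z + (y * t) *\<^sub>R a))) * indicator {1..2} \<mu>) \<partial>lborel) \<partial>lborel)"
      proof (rule nn_integral_cong)
        fix \<mu>
        have "ennreal (v' \<mu> (x + \<mu> *\<^sub>R z)) = (\<integral>\<^sup>+t. ennreal (std_normal_density t * v \<mu> (x + \<mu> *\<^sub>R z + (\<mu> * y * t) *\<^sub>R a)) \<partial>lborel)"
          unfolding v'_def avg_def using Cons.prems(2,3) avg_integrable[OF m, of \<mu> B "x + \<mu> *\<^sub>R z" "\<mu> * y" a]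
          by (subst nn_integral_eq_integral) (auto simp: abs_of_nonneg)
        \<comment> \<open>For a frozen Gaussian variable t the dilation acts on the whole
          displacement, so the hypothesis applies to the ray in direction z + (y t) a.\<close>
        moreover have "x + \<mu> *\<^sub>R z + (\<mu> * y * t) *\<^sub>R a = x + \<mu> *\<^sub>R (z + (y * t) *\<^sub>R a)" for t
          by (simp add: scaleR_add_right add.assoc mult.assoc)
        ultimately have "ennreal (v' \<mu> (x + \<mu> *\<^sub>R z))
          = (\<integral>\<^sup>+t. ennreal (std_normal_density t) * ennreal (v \<mu> (x + \<mu> *\<^sub>R (z + (y * t) *\<^sub>R a))) \<partial>lborel)"
          by (simp only: ennreal_mult' normal_density_nonneg)
        then show "ennreal (v' \<mu> (x + \<mu> *\<^sub>R z)) * indicator {1..2} \<mu>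
          = (\<integral>\<^sup>+t. ennreal (std_normal_density t) * (ennreal (v \<mu> (x + \<mu> *\<^sub>R (z + (y * t) *\<^sub>R a))) * indicator {1..2} \<mu>) \<partial>lborel)"
          by (simp only: mult.assoc[symmetric], subst nn_integral_multc) measurable
      qed
      also have "\<dots> = (\<integral>\<^sup>+t. (\<integral>\<^sup>+\<mu>. ennreal (std_normal_density t) * (ennreal (v \<mu> (x + \<mu> *\<^sub>R (z + (y * t) *\<^sub>R a))) * indicator {1..2} \<mu>) \<partial>lborel) \<partial>lborel)"
        by (rule lborel_pair.Fubini') measurable
      also have "\<dots> = (\<integral>\<^sup>+t. ennreal (std_normal_density t) * (\<integral>\<^sup>+\<mu>. ennreal (v \<mu> (x + \<mu> *\<^sub>R (z + (y * t) *\<^sub>R a))) * indicator {1..2} \<mu> \<partial>lborel) \<partial>lborel)"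
        by (simp add: nn_integral_cmult)
      also have "\<dots> \<le> (\<integral>\<^sup>+t. ennreal (std_normal_density t) * M \<partial>lborel)"
        by (intro nn_integral_mono mult_left_mono Cons.prems(4)) simp
      also have "\<dots> = M" by (simp add: nn_integral_multc nn_integral_eq_integral)
      finally show ?thesis .
    qed
    moreover have "0 \<le> v' \<mu> z" "v' \<mu> z \<le> B" for \<mu> z
      unfolding v'_def using avg_bounds[OF m Cons.prems(2,3)] by auto
    ultimately have "(\<integral>\<^sup>+\<mu>. ennreal (iter_avg as (map ((*) \<mu>) ys') (v' \<mu>) x) * indicator {1..2} \<mu> \<partial>lborel) \<le> M"
      by (intro Cons.IH[OF m'])
    then show ?thesis by (simp add: Cons v'_def[abs_def])
  qed
qed

lemma iter_avg_le_of_segments: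
  fixes v :: "'a::euclidean_space \<Rightarrow> real"
  assumes v [measurable]: "v \<in> borel_measurable borel" and b: "\<And>y. 0 \<le> v y" "\<And>y. v y \<le> B"
    and M: "\<And>z. (\<integral>\<^sup>+\<mu>. ennreal (v (x + \<mu> *\<^sub>R z)) * indicator {1..2} \<mu> \<partial>lborel) \<le> M"
  shows "ennreal (iter_avg as ys v x) \<le> 2 ^ length as * M"
proof -
  define k :: real where "k = 2 ^ length as"
  have k: "0 \<le> k" "ennreal k = 2 ^ length as" by (simp_all add: k_def ennreal_power[symmetric])
  \<comment> \<open>The interval [1, 2] has length 1, so integrating a constant over it changes
    nothing.\<close>
  have "ennreal (iter_avg as ys v x) = (\<integral>\<^sup>+\<mu>. ennreal (iter_avg as ys v x) * indicator {1..2::real} \<mu> \<partial>lborel)"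
    by (simp add: nn_integral_cmult_indicator)
  also have "\<dots> \<le> (\<integral>\<^sup>+\<mu>. ennreal (iter_avg as (map ((*) \<mu>) ys) (\<lambda>z. k * v z) x) * indicator {1..2} \<mu> \<partial>lborel)"
  proof (rule nn_integral_mono)
    fix \<mu> :: real
    have "ennreal (iter_avg as ys v x) \<le> ennreal (k * iter_avg as (map ((*) \<mu>) ys) v x)" if "1 \<le> \<mu>" "\<mu> \<le> 2"
      unfolding k_def by (intro ennreal_leI iter_avg_le_dilated[OF v b that])
    then show "ennreal (iter_avg as ys v x) * indicator {1..2} \<mu> \<le> ennreal (iter_avg as (map ((*) \<mu>) ys) (\<lambda>z. k * v z) x) * indicator {1..2} \<mu>"
      unfolding iter_avg_cmult by (auto simp: indicator_def)
  qed
  also have "\<dots> \<le> ennreal k * M"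
  proof (rule nn_integral_iter_avg_dilated_le[where v="\<lambda>_ z. k * v z" and B="k * B"])
    have "(\<integral>\<^sup>+\<mu>. ennreal (k * v (x + \<mu> *\<^sub>R z)) * indicator {1..2} \<mu> \<partial>lborel)
        = ennreal k * (\<integral>\<^sup>+\<mu>. ennreal (v (x + \<mu> *\<^sub>R z)) * indicator {1..2} \<mu> \<partial>lborel)" for z
      using k(1) by (simp add: ennreal_mult' mult.assoc nn_integral_cmult)
    then show "(\<integral>\<^sup>+\<mu>. ennreal (k * v (x + \<mu> *\<^sub>R z)) * indicator {1..2} \<mu> \<partial>lborel) \<le> ennreal k * M" for z
      using mult_left_mono[OF M[of z], of "ennreal k"] by simp
  qed (use k(1) b in \<open>auto intro: mult_left_mono\<close>)
  finally show ?thesis by (simp add: k(2))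
qed

text \<open>The parameters in [1, 2] lie in the centred interval [-2, 2] of length 4, hence the
  factor 4. For z = 0 the segment degenerates to the point x, and continuity bounds the point value
  by averages over short segments.\<close>

lemma nikodym_segment:
  fixes u :: "real ^ 'n \<Rightarrow> real"
  assumes c: "continuous_on UNIV u"
  shows "(\<integral>\<^sup>+\<mu>. ennreal (u (x + \<mu> *\<^sub>R z)) * indicator {1..2} \<mu> \<partial>lborel) \<le> 4 * nikodym_maximal u x"
proof -
  have [measurable]: "u \<in> borel_measurable borel" using c by (rule borel_measurable_continuous_onI)
  have seg: "ennreal (1 / (2 * r)) * (\<integral>\<^sup>+t\<in>{-r..r}. ennreal (u (x - t *\<^sub>R \<omega>)) \<partial>lborel) \<le> nikodym_maximal u x"
    if "0 < r" "norm \<omega> = 1" for r \<omega>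
    unfolding nikodym_maximal_def using that by (intro SUP_upper2[where i="(r, \<omega>)"]) auto
  show ?thesis
  proof (cases "z = 0")
    case False
    then have n: "0 < norm z" by simp
    \<comment> \<open>The sign matches \<open>x - t *\<^sub>R \<omega>\<close> in the definition of
      the maximal function.\<close>
    define \<omega> where "\<omega> = - (1 / norm z) *\<^sub>R z"
    have t: "(norm z * \<mu>) *\<^sub>R \<omega> = - (\<mu> *\<^sub>R z)" for \<mu> using n by (simp add: \<omega>_def)
    have ind: "indicator {- (2 * norm z)..2 * norm z} (norm z * \<mu>) = (indicator {-2..2} \<mu> :: ennreal)" for \<mu>
      using mult_le_cancel_left_pos[OF n, of "-2" \<mu>] mult_le_cancel_left_pos[OF n, of \<mu> 2]
      by (simp add: indicator_def mult.commute)
    have e: "ennreal (1 / (2 * (2 * norm z))) * ennreal (norm z) = ennreal (1 / 4)"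
      using n by (simp flip: ennreal_mult)
    have "(\<integral>\<^sup>+\<mu>. ennreal (u (x + \<mu> *\<^sub>R z)) * indicator {1..2} \<mu> \<partial>lborel)
        \<le> (\<integral>\<^sup>+\<mu>. ennreal (u (x + \<mu> *\<^sub>R z)) * indicator {-2..2} \<mu> \<partial>lborel)"
      by (intro nn_integral_mono) (auto simp: indicator_def)
    also have "\<dots> = 4 * (ennreal (1 / 4) * (\<integral>\<^sup>+\<mu>. ennreal (u (x + \<mu> *\<^sub>R z)) * indicator {-2..2} \<mu> \<partial>lborel))"
      by (simp add: mult.assoc[symmetric] flip: ennreal_mult ennreal_numeral)
    also have "ennreal (1 / 4) * (\<integral>\<^sup>+\<mu>. ennreal (u (x + \<mu> *\<^sub>R z)) * indicator {-2..2} \<mu> \<partial>lborel)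
        = ennreal (1 / (2 * (2 * norm z))) * (\<integral>\<^sup>+t\<in>{- (2 * norm z)..2 * norm z}. ennreal (u (x - t *\<^sub>R \<omega>)) \<partial>lborel)"
    proof -
      have "(\<integral>\<^sup>+t\<in>{- (2 * norm z)..2 * norm z}. ennreal (u (x - t *\<^sub>R \<omega>)) \<partial>lborel)
          = ennreal (norm z) * (\<integral>\<^sup>+\<mu>. ennreal (u (x + \<mu> *\<^sub>R z)) * indicator {-2..2} \<mu> \<partial>lborel)"
        using n by (subst nn_integral_real_affine[where c="norm z" and t=0]) (simp_all add: t ind)
      then show ?thesis unfolding e[symmetric] by (simp only: mult.assoc)
    qed
    also have "\<dots> \<le> nikodym_maximal u x" using n by (intro seg) (auto simp: \<omega>_def)
    finally show ?thesis by (simp add: mult_left_mono)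
  next
    case True
    obtain \<omega> :: "real ^ 'n" where \<omega>: "norm \<omega> = 1" using vector_choose_size[of 1] by auto
    have "ennreal (u x) \<le> nikodym_maximal u x"
    proof (rule ennreal_le_epsilon)
      fix e :: real assume e: "0 < e"
      from c have "isCont u x" by (simp add: continuous_on_eq_continuous_at)
      with e obtain d where d: "0 < d" "\<And>y. dist y x < d \<Longrightarrow> dist (u y) (u x) < e"
        unfolding continuous_at_eps_delta by blast
      define r where "r = d / 2"
      have r: "0 < r" using d by (simp add: r_def)
      have "u x \<le> u (x - t *\<^sub>R \<omega>) + e" if "t \<in> {-r..r}" for t
      proof -
        have "dist (x - t *\<^sub>R \<omega>) x < d" using that d(1) \<omega> by (auto simp: dist_norm r_def)
        from d(2)[OF this] show ?thesis by (simp add: dist_real_def)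
      qed
      then have le: "ennreal (u x) \<le> ennreal (u (x - t *\<^sub>R \<omega>)) + ennreal e" if "t \<in> {-r..r}" for t
        using that e by (smt (verit) ennreal_leI ennreal_plus_if add_increasing2)
      have e': "ennreal (1 / (2 * r)) * ennreal (2 * r) = 1" using r by (simp flip: ennreal_mult)
      have em: "emeasure lborel {-r..r} = ennreal (2 * r)" using r by simp
      have "ennreal (u x) = ennreal (1 / (2 * r)) * (\<integral>\<^sup>+t\<in>{-r..r}. ennreal (u x) \<partial>lborel)"
        unfolding nn_integral_cmult_indicator[of "{-r..r}" lborel, simplified]
        using e' r by (simp add: mult.left_commute[of _ "ennreal (u x)"])
      also have "\<dots> \<le> ennreal (1 / (2 * r)) * (\<integral>\<^sup>+t. ennreal (u (x - t *\<^sub>R \<omega>)) * indicator {-r..r} t + ennreal e * indicator {-r..r} t \<partial>lborel)"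
        using le by (intro mult_left_mono nn_integral_mono) (auto simp: indicator_def)
      also have "\<dots> = ennreal (1 / (2 * r)) * (\<integral>\<^sup>+t\<in>{-r..r}. ennreal (u (x - t *\<^sub>R \<omega>)) \<partial>lborel) + ennreal (1 / (2 * r)) * (ennreal e * ennreal (2 * r))"
        by (subst nn_integral_add) (simp_all add: distrib_left nn_integral_cmult_indicator em)
      also have "ennreal (1 / (2 * r)) * (ennreal e * ennreal (2 * r)) = ennreal e"
        using e' by (simp add: mult.left_commute[of _ "ennreal e"])
      also have "ennreal (1 / (2 * r)) * (\<integral>\<^sup>+t\<in>{-r..r}. ennreal (u (x - t *\<^sub>R \<omega>)) \<partial>lborel) + ennreal e \<le> nikodym_maximal u x + ennreal e"
        by (intro add_right_mono seg r \<omega>)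
      finally show "ennreal (u x) \<le> nikodym_maximal u x + ennreal e" .
    qed
    also have "1 * nikodym_maximal u x \<le> 4 * nikodym_maximal u x" by (intro mult_right_mono) auto
    finally show ?thesis using True by (simp add: nn_integral_cmult_indicator)
  qed
qed

text \<open>Truncation only lowers the integrals over segments, so the bound is uniform in j as well
  as in the scales; the power 1/s is monotone.\<close>

lemma iter_avg_sup_le_nikodym:
  fixes w :: "real ^ 'n \<Rightarrow> real"
  assumes s: "1 < s" and c: "continuous_on UNIV w" and w0: "\<And>x. 0 \<le> w x"
  shows "iter_avg_sup s as w x \<le> ennreal ((2 ^ length as * 4) powr (1 / s)) * ennreal_powr (nikodym_maximal (\<lambda>y. w y powr s) x) (1 / s)"
  unfolding iter_avg_sup_def
proof (safe intro!: SUP_least)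
  fix j :: nat and ys
  have [measurable]: "w \<in> borel_measurable borel" using c by (rule borel_measurable_continuous_onI)
  define N where "N = nikodym_maximal (\<lambda>y. w y powr s) x"
  define v where "v y = min (w y) (real j) powr s" for y
  have v: "0 \<le> v y" "v y \<le> real j powr s" "v y \<le> w y powr s" for y
    using s w0 by (auto simp: v_def intro!: powr_mono2)
  have [measurable]: "v \<in> borel_measurable borel" unfolding v_def by measurable
  have cs: "continuous_on UNIV (\<lambda>y. w y powr s)" using c w0 s by (intro continuous_on_powr') auto
  have le: "ennreal (iter_avg as ys v x) \<le> 2 ^ length as * (4 * N)"
  proof (rule iter_avg_le_of_segments[where B="real j powr s"])
    fix z
    have "(\<integral>\<^sup>+\<mu>. ennreal (v (x + \<mu> *\<^sub>R z)) * indicator {1..2} \<mu> \<partial>lborel)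
        \<le> (\<integral>\<^sup>+\<mu>. ennreal (w (x + \<mu> *\<^sub>R z) powr s) * indicator {1..2} \<mu> \<partial>lborel)"
      by (intro nn_integral_mono mult_right_mono ennreal_leI v) simp
    also have "\<dots> \<le> 4 * N" unfolding N_def by (rule nikodym_segment[OF cs])
    finally show "(\<integral>\<^sup>+\<mu>. ennreal (v (x + \<mu> *\<^sub>R z)) * indicator {1..2} \<mu> \<partial>lborel) \<le> 4 * N" .
  qed (auto intro: v)
  show "ennreal (iter_avg as ys v x powr (1 / s)) \<le> ennreal ((2 ^ length as * 4) powr (1 / s)) * ennreal_powr N (1 / s)"
  proof (cases N)
    case top
    then show ?thesis by (simp add: ennreal_powr_def ennreal_mult_top)
  next
    case (real n)
    have "2 ^ length as * (4 * N) = ennreal (2 ^ length as * 4 * n)"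
      using real by (simp add: ennreal_mult ennreal_power[symmetric] mult.assoc)
    then have "iter_avg as ys v x \<le> 2 ^ length as * 4 * n" using le real by (simp add: ennreal_le_iff)
    moreover have "0 \<le> iter_avg as ys v x" by (rule iter_avg_bounds(1)[OF _ v(1,2)]) simp
    ultimately have "iter_avg as ys v x powr (1 / s) \<le> (2 ^ length as * 4 * n) powr (1 / s)"
      using s by (intro powr_mono2) auto
    also have "\<dots> = (2 ^ length as * 4) powr (1 / s) * n powr (1 / s)" using real(1) by (simp add: powr_mult)
    finally show ?thesis using real by (simp add: ennreal_powr_def ennreal_leI flip: ennreal_mult)
  qed
qed

section \<open>From Borel to Lebesgue measurable functions\<close>

lemma lebesgue_measurable_borel_version:
  fixes f :: "'a::euclidean_space \<Rightarrow> complex"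
  assumes [measurable]: "f \<in> borel_measurable lebesgue"
  obtains f' where "f' \<in> borel_measurable borel" "AE x in lborel. f x = f' x"
proof -
  have "(\<lambda>x. Re (f x)) \<in> borel_measurable lebesgue" "(\<lambda>x. Im (f x)) \<in> borel_measurable lebesgue" by measurable
  from this[THEN completion_ex_borel_measurable_real] obtain g h :: "'a \<Rightarrow> real"
    where [measurable]: "g \<in> borel_measurable borel" "h \<in> borel_measurable borel"
      and ae: "AE x in lborel. Re (f x) = g x" "AE x in lborel. Im (f x) = h x"
    by (metis measurable_lborel2)
  show thesis
  proof (rule that)
    show "(\<lambda>x. complex_of_real (g x) + \<i> * complex_of_real (h x)) \<in> borel_measurable borel" by measurable
    show "AE x in lborel. f x = complex_of_real (g x) + \<i> * complex_of_real (h x)"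
      using ae by eventually_elim (simp add: complex_eq_iff)
  qed
qed

lemma L2_functions_borel_version:
  assumes "f \<in> L2_functions"
  obtains f' where "f' \<in> L2_borel" "AE x in lborel. f x = f' x"
proof -
  from assms have "f \<in> borel_measurable lebesgue" by (simp add: L2_functions_def)
  then obtain f' where f': "f' \<in> borel_measurable borel" "AE x in lborel. f x = f' x"
    by (rule lebesgue_measurable_borel_version)
  have "(\<integral>\<^sup>+x. ennreal ((cmod (f' x))\<^sup>2) \<partial>lborel) = (\<integral>\<^sup>+x. ennreal ((cmod (f x))\<^sup>2) \<partial>lborel)"
    using f'(2) by (intro nn_integral_cong_AE) auto
  with assms have "f' \<in> L2_borel"
    by (intro L2_borelI_nn f'(1)) (simp add: L2_functions_def nn_integral_completion)
  with f'(2) show thesis by (rule that[rotated])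
qed

lemma L2_borel_imp_L2_functions:
  assumes "f \<in> L2_borel"
  shows "f \<in> L2_functions"
proof -
  have "f \<in> borel_measurable lborel" using L2_borel_measurable[OF assms] by simp
  then have "f \<in> borel_measurable lebesgue" by (rule measurable_completion)
  with nn_integral_L2[OF assms] show ?thesis by (simp add: L2_functions_def nn_integral_completion)
qed

lemma fourier_integral_eq_ft:
  assumes f: "f \<in> borel_measurable lebesgue" and f' [measurable]: "f' \<in> borel_measurable borel"
    and ae: "AE x in lborel. f x = f' x"
  shows "fourier_integral f \<xi> = ft f' \<xi>"
proof -
  have b: "(\<lambda>x. cis (- (2 * pi * (x \<bullet> \<xi>)))) \<in> borel_measurable lborel" by measurable
  have m: "(\<lambda>x. cis (- (2 * pi * (x \<bullet> \<xi>))) * f' x) \<in> borel_measurable lborel" by measurable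
  have "fourier_integral f \<xi> = (LINT x|lebesgue. cis (- (2 * pi * (x \<bullet> \<xi>))) * f' x)"
    unfolding fourier_integral_def
    using ae by (intro integral_cong_AE borel_measurable_times f measurable_completion[OF b] measurable_completion[OF m])
      (auto simp: AE_completion_iff)
  also have "\<dots> = ft f' \<xi>" unfolding ft_def by (rule integral_completion[OF m])
  finally show ?thesis .
qed

text \<open>Both sides are chosen limits of the same Fourier integrals. The choice in
  \<open>fourier_L2\<close> ranges over Lebesgue measurable functions, so it is first replaced by a
  Borel version, after which uniqueness of L2 limits applies.\<close>

lemma fourier_L2_eq_FT:
  assumes f: "f \<in> L2_functions" and f': "f' \<in> L2_borel" and ae: "AE x in lborel. f x = f' x"
  shows "AE \<xi> in lborel. fourier_L2 f \<xi> = FT f' \<xi>"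
proof -
  have tr: "ball_trunc k f' \<in> L2_borel" "integrable lborel (ball_trunc k f')" for k
    using L2_borel_ball_trunc[OF f'] integrable_ball_trunc[OF f'] by auto
  have fm: "f \<in> borel_measurable lebesgue" using f by (simp add: L2_functions_def)
  have F: "fourier_integral (\<lambda>x. indicator (cball 0 (real k)) x * f x) \<xi> = ft (ball_trunc k f') \<xi>" for k \<xi>
  proof (rule fourier_integral_eq_ft)
    have "(indicator (cball 0 (real k)) :: _ \<Rightarrow> complex) \<in> borel_measurable lborel"
      by (simp add: borel_measurable_indicator borel_closed)
    from borel_measurable_times[OF measurable_completion[OF this] fm]
    show "(\<lambda>x. indicator (cball 0 (real k)) x * f x) \<in> borel_measurable lebesgue" .
    show "ball_trunc k f' \<in> borel_measurable borel" by (rule L2_borel_measurable[OF tr(1)])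
    show "AE x in lborel. indicator (cball 0 (real k)) x * f x = ball_trunc k f' x"
      using ae by eventually_elim (simp add: ball_trunc_def)
  qed
  define P where "P g \<longleftrightarrow> g \<in> L2_functions \<and>
     (\<lambda>k::nat. \<integral>\<^sup>+\<xi>. ennreal ((cmod (ft (ball_trunc k f') \<xi> - g \<xi>))\<^sup>2) \<partial>lborel) \<longlonglongrightarrow> 0" for g
  have n: "(\<integral>\<^sup>+\<xi>. ennreal ((cmod (ft (ball_trunc k f') \<xi> - g \<xi>))\<^sup>2) \<partial>lborel)
      = ennreal ((L2_norm (\<lambda>\<xi>. ft (ball_trunc k f') \<xi> - g \<xi>))\<^sup>2)" if "g \<in> L2_borel" for g k
    by (rule nn_integral_L2[OF L2_borel_diff[OF L2_ft(1)[OF tr] that]])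
  have "P (FT f')"
  proof -
    have "(\<lambda>k. ennreal ((L2_norm (\<lambda>\<xi>. ft (ball_trunc k f') \<xi> - FT f' \<xi>))\<^sup>2)) \<longlonglongrightarrow> ennreal (0\<^sup>2)"
      by (intro tendsto_ennrealI tendsto_power FT_limit[OF f'])
    then show ?thesis by (simp add: P_def n L2_FT[OF f'] L2_borel_imp_L2_functions)
  qed
  moreover have "fourier_L2 f = (SOME g. P g)"
    unfolding fourier_L2_def P_def F nn_integral_completion ..
  ultimately have P: "P (fourier_L2 f)" by (metis someI)
  then have "fourier_L2 f \<in> L2_functions" by (simp add: P_def)
  then obtain g where g: "g \<in> L2_borel" "AE \<xi> in lborel. fourier_L2 f \<xi> = g \<xi>" by (rule L2_functions_borel_version)
  have "(\<integral>\<^sup>+\<xi>. ennreal ((cmod (ft (ball_trunc k f') \<xi> - fourier_L2 f \<xi>))\<^sup>2) \<partial>lborel)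
      = (\<integral>\<^sup>+\<xi>. ennreal ((cmod (ft (ball_trunc k f') \<xi> - g \<xi>))\<^sup>2) \<partial>lborel)" for k
    using g(2) by (intro nn_integral_cong_AE) auto
  with P have "(\<lambda>k. ennreal ((L2_norm (\<lambda>\<xi>. ft (ball_trunc k f') \<xi> - g \<xi>))\<^sup>2)) \<longlonglongrightarrow> ennreal 0"
    by (simp add: P_def n[OF g(1)])
  then have "(\<lambda>k. (L2_norm (\<lambda>\<xi>. ft (ball_trunc k f') \<xi> - g \<xi>))\<^sup>2) \<longlonglongrightarrow> 0"
    by (rule tendsto_ennrealD) auto
  then have "(\<lambda>k. sqrt ((L2_norm (\<lambda>\<xi>. ft (ball_trunc k f') \<xi> - g \<xi>))\<^sup>2)) \<longlonglongrightarrow> sqrt 0"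
    by (rule tendsto_real_sqrt)
  then have "(\<lambda>k. L2_norm (\<lambda>\<xi>. ft (ball_trunc k f') \<xi> - g \<xi>)) \<longlonglongrightarrow> 0" by simp
  from FT_eqI[OF f' g(1) this] g(2) show "AE \<xi> in lborel. fourier_L2 f \<xi> = FT f' \<xi>"
    by eventually_elim simp
qed

text \<open>\<open>FT_surj\<close> shows that the choice defining the operator is not vacuous; every
  admissible choice has the stated transform, so it does not matter which one is taken.\<close>

lemma set_multiplier_borel_version:
  assumes K: "K \<in> sets borel" and f: "f \<in> L2_functions" and f': "f' \<in> L2_borel" and ae: "AE x in lborel. f x = f' x"
  obtains h where "h \<in> L2_borel" "AE x in lborel. set_multiplier K f x = h x"
    "AE \<xi> in lborel. FT h \<xi> = indicator K \<xi> * FT f' \<xi>"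
proof -
  define P where "P h \<longleftrightarrow> h \<in> L2_functions \<and> (AE \<xi> in lborel. fourier_L2 h \<xi> = indicator K \<xi> * fourier_L2 f \<xi>)" for h
  note Ff = fourier_L2_eq_FT[OF f f' ae]
  have m: "(indicator K :: _ \<Rightarrow> complex) \<in> borel_measurable borel" using K by measurable
  have "(\<lambda>\<xi>. indicator K \<xi> * FT f' \<xi>) \<in> L2_borel"
    by (rule L2_borel_bounded_mult[OF L2_FT[OF f'] m, of 1]) (auto simp: indicator_def)
  then obtain h where h: "h \<in> L2_borel" "AE \<xi> in lborel. FT h \<xi> = indicator K \<xi> * FT f' \<xi>" by (rule FT_surj)
  have "AE \<xi> in lborel. fourier_L2 h \<xi> = FT h \<xi>"
    by (rule fourier_L2_eq_FT[OF L2_borel_imp_L2_functions[OF h(1)] h(1)]) simp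
  with h(2) Ff have "AE \<xi> in lborel. fourier_L2 h \<xi> = indicator K \<xi> * fourier_L2 f \<xi>"
    by eventually_elim simp
  then have "P h" using L2_borel_imp_L2_functions[OF h(1)] by (simp add: P_def)
  moreover have "set_multiplier K f = (SOME h. P h)"
    unfolding set_multiplier_def fourier_multiplier_def P_def AE_completion_iff ..
  ultimately have P: "P (set_multiplier K f)" by (metis someI)
  then have S: "set_multiplier K f \<in> L2_functions" by (simp add: P_def)
  then obtain h' where h': "h' \<in> L2_borel" "AE x in lborel. set_multiplier K f x = h' x"
    by (rule L2_functions_borel_version)
  have "AE \<xi> in lborel. fourier_L2 (set_multiplier K f) \<xi> = indicator K \<xi> * fourier_L2 f \<xi>" using P by (simp add: P_def)
  with fourier_L2_eq_FT[OF S h'] Ff have "AE \<xi> in lborel. FT h' \<xi> = indicator K \<xi> * FT f' \<xi>"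
    by eventually_elim simp
  with h' show thesis by (rule that)
qed

lemma polyhedron_eq_halfspaces:
  assumes "polyhedron K"
  obtains hs where "K = halfspaces hs" "\<forall>(a, b)\<in>set hs. a \<noteq> 0"
proof -
  obtain F where F: "finite F" "K = \<Inter> F" "\<forall>h\<in>F. \<exists>a b. a \<noteq> 0 \<and> h = {x. a \<bullet> x \<le> b}"
    using assms unfolding polyhedron_def by blast
  obtain a b where ab: "\<And>h. h \<in> F \<Longrightarrow> a h \<noteq> 0 \<and> h = {x. a h \<bullet> x \<le> b h}" using F(3) by metis
  obtain xs where xs: "set xs = F" using finite_list[OF F(1)] by blast
  show thesis
  proof (rule that[of "map (\<lambda>h. (a h, b h)) xs"])
    have "x \<in> h \<longleftrightarrow> a h \<bullet> x \<le> b h" if "h \<in> F" for x h using ab[OF that] by blast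
    then show "K = halfspaces (map (\<lambda>h. (a h, b h)) xs)"
      by (auto simp: F(2) halfspaces_def xs)
  qed (use ab xs in auto)
qed

theorem theorem1p3:
  fixes K :: "(real ^ 'n) set" and s :: real
  assumes "polytope K" and "1 < s"
  shows "\<exists>C::real. 0 \<le> C \<and>
    (\<forall>(f :: real ^ 'n \<Rightarrow> complex) (w :: real ^ 'n \<Rightarrow> real).
      f \<in> L2_functions \<longrightarrow> continuous_on UNIV w \<longrightarrow> (\<forall>x. 0 \<le> w x) \<longrightarrow>
      (\<integral>\<^sup>+x. ennreal ((cmod (set_multiplier K f x))\<^sup>2 * w x) \<partial>lebesgue)
        \<le> ennreal C * (\<integral>\<^sup>+x. ennreal ((cmod (f x))\<^sup>2)
              * ennreal_powr (nikodym_maximal (\<lambda>y. w y powr s) x) (1 / s) \<partial>lebesgue))"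
proof -
  obtain hs where K: "K = halfspaces hs" and hs: "\<forall>(a, b)\<in>set hs. a \<noteq> 0"
    using polyhedron_eq_halfspaces[OF polytope_imp_polyhedron[OF assms(1)]] by blast
  define C1 where "C1 = 4 * step_const s ^ length hs"
  \<comment> \<open>A factor 2 for the dilation in each direction, and the 4 of
    \<open>nikodym_segment\<close>.\<close>
  define C2 where "C2 = (2 ^ length hs * 4) powr (1 / s)"
  have C: "0 \<le> C1" "0 < C2" using step_const_pos[OF assms(2)] by (simp_all add: C1_def C2_def)
  show ?thesis
  proof (intro exI[of _ "C1 * C2"] conjI allI impI)
    fix f :: "real ^ 'n \<Rightarrow> complex" and w :: "real ^ 'n \<Rightarrow> real"
    assume f: "f \<in> L2_functions" and c: "continuous_on UNIV w" and w0: "\<forall>x. 0 \<le> w x"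
    obtain f' where f': "f' \<in> L2_borel" "AE x in lborel. f x = f' x" using f by (rule L2_functions_borel_version)
    obtain h where h: "h \<in> L2_borel" "AE x in lborel. set_multiplier K f x = h x"
      "AE \<xi> in lborel. FT h \<xi> = indicator (halfspaces hs) \<xi> * FT f' \<xi>"
      unfolding K by (rule set_multiplier_borel_version[OF halfspaces_measurable f f'])
    note [measurable] = L2_borel_measurable[OF f'(1)] L2_borel_measurable[OF h(1)] borel_measurable_continuous_onI[OF c]
    define W where "W = iter_avg_sup s (map fst hs) w"
    have [measurable]: "W \<in> borel_measurable borel" unfolding W_def by measurable
    define P where "P x = ennreal_powr (nikodym_maximal (\<lambda>y. w y powr s) x) (1 / s)" for x
    have WP: "W x \<le> ennreal C2 * P x" for x
      using iter_avg_sup_le_nikodym[OF assms(2) c, of "map fst hs" x] w0 by (simp add: W_def P_def C2_def)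
    have "(\<integral>\<^sup>+x. ennreal ((cmod (set_multiplier K f x))\<^sup>2 * w x) \<partial>lborel) = (\<integral>\<^sup>+x. ennreal ((cmod (h x))\<^sup>2) * ennreal (w x) \<partial>lborel)"
      using h(2) w0 by (intro nn_integral_cong_AE) (auto simp: ennreal_mult')
    also have "\<dots> \<le> ennreal C1 * (\<integral>\<^sup>+x. ennreal ((cmod (f' x))\<^sup>2) * W x \<partial>lborel)"
      unfolding C1_def W_def using w0 by (intro multiplier_estimate[OF assms(2) hs f'(1) h(1,3)]) auto
    \<comment> \<open>Measurability of \<open>P\<close> is not established. The constant C2 is
      therefore pulled out while the integrand still contains the measurable \<open>W\<close>, and
      only afterwards is W / C2 bounded by \<open>P\<close>.\<close>
    also have "(\<integral>\<^sup>+x. ennreal ((cmod (f' x))\<^sup>2) * W x \<partial>lborel)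
        = (\<integral>\<^sup>+x. ennreal C2 * (ennreal ((cmod (f' x))\<^sup>2) * (ennreal (1 / C2) * W x)) \<partial>lborel)"
    proof -
      have "a * b = ennreal C2 * (a * (ennreal (1 / C2) * b))" for a b
      proof -
        have "ennreal C2 * (a * (ennreal (1 / C2) * b)) = (ennreal C2 * ennreal (1 / C2)) * (a * b)" by (simp only: mult_ac)
        also have "ennreal C2 * ennreal (1 / C2) = 1" using C(2) by (simp flip: ennreal_mult)
        finally show ?thesis by simp
      qed
      then show ?thesis by (intro nn_integral_cong)
    qed
    also have "\<dots> = ennreal C2 * (\<integral>\<^sup>+x. ennreal ((cmod (f' x))\<^sup>2) * (ennreal (1 / C2) * W x) \<partial>lborel)"
      by (rule nn_integral_cmult) measurable
    also have "\<dots> \<le> ennreal C2 * (\<integral>\<^sup>+x. ennreal ((cmod (f' x))\<^sup>2) * P x \<partial>lborel)"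
    proof (intro mult_left_mono nn_integral_mono)
      fix x
      have "ennreal (1 / C2) * W x \<le> ennreal (1 / C2) * (ennreal C2 * P x)" by (intro mult_left_mono WP) simp
      also have "\<dots> = P x" using C(2) by (simp flip: ennreal_mult mult.assoc)
      finally show "ennreal (1 / C2) * W x \<le> P x" .
    qed simp_all
    also have "(\<integral>\<^sup>+x. ennreal ((cmod (f' x))\<^sup>2) * P x \<partial>lborel) = (\<integral>\<^sup>+x. ennreal ((cmod (f x))\<^sup>2) * P x \<partial>lborel)"
      using f'(2) by (intro nn_integral_cong_AE) auto
    finally show "(\<integral>\<^sup>+x. ennreal ((cmod (set_multiplier K f x))\<^sup>2 * w x) \<partial>lebesgue)
        \<le> ennreal (C1 * C2) * (\<integral>\<^sup>+x. ennreal ((cmod (f x))\<^sup>2) * ennreal_powr (nikodym_maximal (\<lambda>y. w y powr s) x) (1 / s) \<partial>lebesgue)"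
      using C by (simp add: nn_integral_completion P_def mult_left_mono ennreal_mult mult.assoc)
  qed (use C in simp)
qed

end
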